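(* Let $X_n$ be the sum of digits $\sum_{h\in\mathcal S}a(h)$ of a multi-base representation $a$ of $n$ chosen uniformly at random among all $P(n)$ representations. Then \[ \mathbb E[X_n]=\frac{\kappa(d-1)}{2\log d}(\log n)^m+O\big((\log n)^{m-1}\log\log n\big),\qquad \operatorname{Var}[X_n]=\frac{\kappa(d-1)(d+1)}{12\log d}(\log n)^m+O\big((\log n)^{m-1}\log\log n\big), \] and $(X_n-\mathbb E[X_n])/\sqrt{\operatorname{Var}[X_n]}$ converges in distribution to a standard Gaussian random variable as $n\to\infty$.
   Context: Fix integers $d\geq 2$ and $m\geq 2$, and integers $1<p_1<p_2<\dots<p_m$ with $\gcd(p_i,p_j)=1$ for $i\neq j$. Let $\mathcal S=\{p_1^{\alpha_1}p_2^{\alpha_2}\cdots p_m^{\alpha_m}:\alpha_1,\dots,\alpha_m\in\mathbb Z_{\ge 0}\}$. A multi-base representation of a positive integer $n$ (with bases $p_1,\dots,p_m$ and digit set $\{0,1,\dots,d-1\}$) is a function $a:\mathcal S\to\{0,1,\dots,d-1\}$ with finite support such that $\sum_{h\in\mathcal S}a(h)\,h=n$. Let $P(n)$ be the (finite) number of multi-base representations of $n$. Set $\kappa=\frac{\log d}{m!}\prod_{j=1}^m\frac{1}{\log p_j}$. *)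

theory Defs
  imports "HOL-Probability.Probability" "HOL-Library.Landau_Symbols"
begin

text \<open>Bases are given as p 0 < p 1 < ... < p (m-1) (indices i < m).\<close>

definition mb_S :: "(nat \<Rightarrow> nat) \<Rightarrow> nat \<Rightarrow> nat set" where
  "mb_S p m = {h. \<exists>\<alpha>::nat \<Rightarrow> nat. h = (\<Prod>i<m. p i ^ \<alpha> i)}"

definition mb_reps :: "nat \<Rightarrow> (nat \<Rightarrow> nat) \<Rightarrow> nat \<Rightarrow> nat \<Rightarrow> (nat \<Rightarrow> nat) set" where
  "mb_reps d p m n = {a. (\<forall>h. a h < d) \<and> (\<forall>h. h \<notin> mb_S p m \<longrightarrow> a h = 0)
      \<and> finite {h. a h \<noteq> 0} \<and> (\<Sum>h\<in>{h. a h \<noteq> 0}. a h * h) = n}"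

definition mb_P :: "nat \<Rightarrow> (nat \<Rightarrow> nat) \<Rightarrow> nat \<Rightarrow> nat \<Rightarrow> nat" where
  "mb_P d p m n = card (mb_reps d p m n)"

definition digit_sum :: "(nat \<Rightarrow> nat) \<Rightarrow> nat" where
  "digit_sum a = (\<Sum>h\<in>{h. a h \<noteq> 0}. a h)"

definition mb_dist :: "nat \<Rightarrow> (nat \<Rightarrow> nat) \<Rightarrow> nat \<Rightarrow> nat \<Rightarrow> (nat \<Rightarrow> nat) pmf" where
  "mb_dist d p m n = pmf_of_set (mb_reps d p m n)"

definition mb_mean :: "nat \<Rightarrow> (nat \<Rightarrow> nat) \<Rightarrow> nat \<Rightarrow> nat \<Rightarrow> real" where
  "mb_mean d p m n = measure_pmf.expectation (mb_dist d p m n) (\<lambda>a. real (digit_sum a))"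

definition mb_var :: "nat \<Rightarrow> (nat \<Rightarrow> nat) \<Rightarrow> nat \<Rightarrow> nat \<Rightarrow> real" where
  "mb_var d p m n = measure_pmf.variance (mb_dist d p m n) (\<lambda>a. real (digit_sum a))"

definition mb_kappa :: "nat \<Rightarrow> (nat \<Rightarrow> nat) \<Rightarrow> nat \<Rightarrow> real" where
  "mb_kappa d p m = ln (real d) / fact m * (\<Prod>j<m. 1 / ln (real (p j)))"

end

theory Submission
  imports Defs "HOL-Real_Asymp.Real_Asymp"
begin

text \<open>
  Give the digit at \<open>h\<close> weights proportional to \<open>exp (- r h k)\<close>, independently for all \<open>h \<le> n\<close> in the
  multi-base set. Conditioned on the event that the represented value is \<open>n\<close>, this product law is the
  uniform law on representations, whatever \<open>r\<close> is; choose \<open>r\<close> so that the expected value is \<open>n\<close>. With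
  \<open>R = 1 / r\<close> and \<open>l = ln n\<close>, the value has standard deviation of order \<open>s = R * sqrt (l ^ (m - 1))\<close>, and a
  local limit theorem shows that \<open>n\<close> is hit with probability of order \<open>1 / s\<close>.

  Away from \<open>0\<close> the characteristic function is controlled by a smoothing set of only \<open>O(l ln l)\<close> elements,
  consisting of \<open>O(ln l)\<close> geometric progressions along each of the first two bases. The integral of its
  modulus is at most a power of \<open>l\<close> over \<open>R\<close> by a transfer-operator argument. A frequency at which few
  elements of the set are far from integers is close both to a fraction whose denominator is a power of
  one base and to a fraction whose denominator is a power of the other, hence to an integer.

  There are two consequences. Digits at \<open>h\<close> much smaller than \<open>R\<close> keep their (nearly uniform) product law
  after conditioning, and stay independent of the other digits, up to an error that is an arbitrary power
  of \<open>1 / l\<close>. The remaining \<open>O(l ^ (m - 1) ln l)\<close> digits split by the parity of the exponent sum of the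
  first two bases, and the conditioned law of each half has bounded density with respect to the product
  law, because the other half already hits any value with probability \<open>O(1 / s)\<close>. So their sum has variance
  \<open>O(l ^ (m - 1) ln l)\<close>. Mean, variance and characteristic function of the digit sum follow.
\<close>


section \<open>Exponential sums along geometric progressions\<close>

text \<open>The permitted error l ^ (m - 1) * ln l governs the construction. Digits spent on
  smoothing are lost for the independence argument and join the exceptional digits; for m = 2 this
  leaves room for only O(l ln l) of them. On the arc |\<theta>| \<le> 1 / (2 R) so thin a set is
  bounded trivially. What saves the argument there is that the digits to be decoupled have total
  value K far below R: the coupling is O(K |\<theta>|) and costs only K / R^2. One geometric
  progression could not smooth by itself: at a fraction whose denominator is a power of its ratio,
  almost all multiples are integers. This is where the second base enters. Splitting the exceptional
  digits by parity is due to the density bound: a pattern on one half can be controlled only while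
  independent digits outside it still spread the value over a range of order s. The powers of l
  balance as 5m = 3m + m + m: l ^ (3 m) beats the square of the number of digits, O(l ^ m), one
  factor l ^ m pays for the number of terms in K, and one for s / R, which arises on dividing by the
  hitting probability.\<close>

lemma integral_mult_dilated_periodic:
  fixes f F :: "real \<Rightarrow> real" and P :: nat
  assumes f: "continuous_on UNIV f" and F: "continuous_on UNIV F"
    and per: "\<And>x. F (x + 1) = F x" and P: "P > 0"
  shows "integral {0..1} (\<lambda>\<theta>. f \<theta> * F (real P * \<theta>)) =
         (1 / real P) * integral {0..1} (\<lambda>x. (\<Sum>i<P. f ((x + real i) / real P)) * F x)"
proof -
  have per_nat: "F (x + real i) = F x" for x i
  proof (induction i)
    case (Suc i)
    have "F (x + real (Suc i)) = F ((x + real i) + 1)" by (simp add: algebra_simps)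
    then show ?case using per Suc by simp
  qed simp
  have cf: "continuous_on A (\<lambda>x. f (g x))" if "continuous_on A g" for A g
    using continuous_on_compose2[OF f that] by simp
  have cF: "continuous_on A (\<lambda>x. F (g x))" if "continuous_on A g" for A g
    using continuous_on_compose2[OF F that] by simp
  let ?g = "\<lambda>\<theta>. f \<theta> * F (real P * \<theta>)"
  let ?I = "\<lambda>i. integral {0..1} (\<lambda>x. f ((x + real i) / real P) * F x)"
  \<comment> \<open>On each of the \<open>P\<close> equal subintervals \<theta> = (x + i) / P with x
    in [0, 1], and periodicity turns F (P \<theta>) into F x. Summing over i gives the duality
    between the map x -> P x mod 1 and its transfer operator.\<close>
  have piece: "(?g has_integral ?I i / real P) {real i / real P..real (Suc i) / real P}" for i
  proof -
    have "((\<lambda>x. f ((x + real i) / real P) * F x) has_integral ?I i) (cbox 0 1)"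
      using P by (auto intro!: integrable_integral integrable_continuous_real continuous_intros cf cF)
    from has_integral_affinity'[OF this, of "real P" "- real i"] P
    have "((\<lambda>x. f x * F (real P * x - real i)) has_integral ?I i / real P)
        {real i / real P..real (Suc i) / real P}"
      by (simp add: field_simps)
    moreover have "F (real P * x - real i) = F (real P * x)" for x
      using per_nat[of "real P * x - real i" i] by simp
    ultimately show ?thesis by simp
  qed
  have "(?g has_integral (\<Sum>i<k. ?I i / real P)) {0..real k / real P}" for k
  proof (induction k)
    case (Suc k)
    have "(?g has_integral ((\<Sum>i<k. ?I i / real P) + ?I k / real P)) {0..real (Suc k) / real P}"
      by (rule has_integral_combine[OF _ _ Suc piece]) (auto simp: divide_right_mono)
    then show ?case by simp
  qed (simp add: has_integral_refl)
  from this[of P] P have "integral {0..1} ?g = (\<Sum>i<P. ?I i / real P)"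
    by (auto dest: integral_unique)
  also have "\<dots> = (1 / real P) * (\<Sum>i<P. ?I i)"
    by (simp add: sum_divide_distrib)
  also have "(\<Sum>i<P. ?I i) = integral {0..1} (\<lambda>x. \<Sum>i<P. f ((x + real i) / real P) * F x)"
    using P by (intro integral_sum[symmetric])
      (auto intro!: integrable_continuous_real continuous_intros cf cF)
  finally show ?thesis by (simp add: sum_distrib_right)
qed

lemma integral_periodic_shift:
  fixes F :: "real \<Rightarrow> real"
  assumes F: "continuous_on UNIV F" and per: "\<And>x. F (x + 1) = F x"
  shows "integral {-1/2..1/2} F = integral {0..1} F"
proof -
  have int: "F integrable_on {a..b}" for a b
    by (rule integrable_continuous_real) (rule continuous_on_subset[OF F], simp)
  have "(F has_integral integral {1/2..1} F) (cbox (1/2) 1)"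
    using int by (auto intro: integrable_integral)
  from has_integral_affinity'[OF this, of 1 1] per
  have "integral {-1/2..0} F = integral {1/2..1} F"
    by (auto dest: integral_unique)
  then show ?thesis
    using Henstock_Kurzweil_Integration.integral_combine[where f=F and a="-1/2" and c=0 and b="1/2"]
      Henstock_Kurzweil_Integration.integral_combine[where f=F and a=0 and c="1/2" and b=1] int by simp
qed

lemma cos_2pi_diff_int: "cos (2 * pi * (x - of_int a)) = cos (2 * pi * x)"
proof -
  have "2 * pi * (x - of_int a) = 2 * pi * x - of_int a * (2 * pi)"
    by (simp add: algebra_simps)
  then show ?thesis
    by (simp add: cos_diff mult.commute[of _ "2 * pi"] cos_int_2pin sin_int_2pin)
qed

lemma cos_2pi_le_away_from_int:
  fixes y :: real and P :: nat
  assumes P: "P > 0" and y: "1 / (2 * real P) \<le> y" "y \<le> 1 - 1 / (2 * real P)"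
  shows "cos (2 * pi * y) \<le> cos (pi / real P)"
proof -
  have *: "cos (2 * pi * z) \<le> cos (pi / real P)" if "1 / (2 * real P) \<le> z" "z \<le> 1/2" for z
  proof (rule cos_monotone_0_pi_le)
    have "2 * pi * (1 / (2 * real P)) \<le> 2 * pi * z"
      using that by (intro mult_left_mono) auto
    then show "pi / real P \<le> 2 * pi * z" by simp
    show "2 * pi * z \<le> pi" using that by simp
  qed simp
  show ?thesis
  proof (cases "y \<le> 1/2")
    case True then show ?thesis using * y by simp
  next
    case False
    have "cos (2 * pi * y) = cos (2 * pi * (1 - y))"
      using cos_2pi_diff_int[of y 1] by (metis cos_minus minus_diff_eq mult_minus_right of_int_1)
    then show ?thesis using *[of "1 - y"] y False by simp
  qed
qed

text \<open>The \<open>P\<close> preimages (x + i) / P are spaced by 1 / P, so all but one of them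
  keep distance at least 1 / (2 P) from the integers; only that one may contribute as much as 1.
  This is the pointwise bound for the transfer operator.\<close>

lemma sum_exp_cos_preimages_le:
  fixes c x :: real and P :: nat
  assumes P: "P > 0" and c: "c \<ge> 0" and x: "0 \<le> x" "x \<le> 1"
  shows "(\<Sum>i<P. exp (- c * (1 - cos (2 * pi * ((x + real i) / real P)))))
          \<le> 1 + real P * exp (- c * (1 - cos (pi / real P)))"
proof -
  \<comment> \<open>The preimage nearest to an integer: next to 0 when x \<le> 1/2, next to 1
    otherwise.\<close>
  define i0 where "i0 = (if x \<le> 1/2 then 0 else P - 1)"
  let ?f = "\<lambda>i. exp (- c * (1 - cos (2 * pi * ((x + real i) / real P))))"
  have i0: "i0 < P" using P by (auto simp: i0_def)
  have le: "?f i \<le> exp (- c * (1 - cos (pi / real P)))" if "i < P" "i \<noteq> i0" for i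
  proof -
    have lo: "1 / (2 * real P) \<le> (x + real i) / real P"
    proof -
      have "1/2 \<le> x + real i" using that x by (auto simp: i0_def split: if_splits)
      then show ?thesis using P by (simp add: field_simps)
    qed
    have hi: "(x + real i) / real P \<le> 1 - 1 / (2 * real P)"
    proof -
      have "x + real i \<le> real P - 1/2"
      proof (cases "x \<le> 1/2")
        case True then show ?thesis using that by (auto simp: i0_def)
      next
        case False
        then have "i + 2 \<le> P" using that by (auto simp: i0_def)
        then have "real i + 2 \<le> real P" by linarith
        then show ?thesis using x by simp
      qed
      then have "(x + real i) / real P \<le> (real P - 1/2) / real P" by (rule divide_right_mono) simp
      then show ?thesis using P by (simp add: diff_divide_distrib)
    qed
    have "cos (2 * pi * ((x + real i) / real P)) \<le> cos (pi / real P)"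
      by (rule cos_2pi_le_away_from_int[OF P lo hi])
    then show ?thesis using c by (simp add: mult_left_mono)
  qed
  have "(\<Sum>i<P. ?f i) = ?f i0 + (\<Sum>i\<in>{..<P} - {i0}. ?f i)"
    using i0 by (subst sum.remove[of _ i0]) auto
  also have "?f i0 \<le> 1" using c by simp
  also have "(\<Sum>i\<in>{..<P} - {i0}. ?f i) \<le> (\<Sum>i\<in>{..<P} - {i0}. exp (- c * (1 - cos (pi / real P))))"
    by (rule sum_mono) (use le in auto)
  also have "\<dots> \<le> real P * exp (- c * (1 - cos (pi / real P)))"
    using i0 by (simp add: mult_right_mono)
  finally show ?thesis by simp
qed

text \<open>Comparable to the sum of the squared distances of h * \<theta> to the nearest integers.
  \<open>exp (- c * phase_defect Q \<theta>)\<close> will dominate the modulus of the characteristic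
  function of the digits on \<open>Q\<close>.\<close>

definition phase_defect :: "nat set \<Rightarrow> real \<Rightarrow> real" where
  "phase_defect Q \<theta> = (\<Sum>h\<in>Q. 1 - cos (2 * pi * (real h * \<theta>)))"

lemma phase_defect_nonneg: "phase_defect Q \<theta> \<ge> 0"
  by (auto simp: phase_defect_def intro: sum_nonneg)

lemma phase_defect_mono: "finite Q \<Longrightarrow> Q' \<subseteq> Q \<Longrightarrow> phase_defect Q' \<theta> \<le> phase_defect Q \<theta>"
  unfolding phase_defect_def by (rule sum_mono2) auto

lemma continuous_on_phase_defect [continuous_intros]:
  "continuous_on A (phase_defect Q)"
  unfolding phase_defect_def by (intro continuous_intros)

lemma phase_defect_periodic: "phase_defect Q (x + 1) = phase_defect Q x"
proof -
  have "cos (2 * pi * (real h * (x + 1))) = cos (2 * pi * (real h * x))" for h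
    using cos_2pi_diff_int[of "real h * (x + 1)" "int h"] by (simp add: algebra_simps)
  then show ?thesis by (simp add: phase_defect_def)
qed

text \<open>Each induction step splits off the factor with k = 0. What remains is the shorter
  product evaluated at P * \<theta>, so the transfer operator applies and costs one factor
  \<open>?L / real P\<close>.\<close>

lemma integral_exp_chain_le:
  fixes c :: real and P \<kappa> :: nat
  assumes P: "P > 0" and c: "c \<ge> 0"
  shows "integral {0..1} (\<lambda>\<theta>. exp (- c * (\<Sum>k<\<kappa>. 1 - cos (2 * pi * (real (P ^ k) * \<theta>)))))
          \<le> ((1 + real P * exp (- c * (1 - cos (pi / real P)))) / real P) ^ \<kappa>"
proof (induction \<kappa>)
  case 0
  then show ?case by simp
next
  case (Suc \<kappa>)
  let ?f = "\<lambda>\<theta>. exp (- c * (1 - cos (2 * pi * \<theta>)))"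
  let ?F = "\<lambda>\<theta>. exp (- c * (\<Sum>k<\<kappa>. 1 - cos (2 * pi * (real (P ^ k) * \<theta>))))"
  let ?L = "1 + real P * exp (- c * (1 - cos (pi / real P)))"
  have "?F (x + 1) = ?F x" for x
  proof -
    have "cos (2 * pi * (real (P ^ k) * (x + 1))) = cos (2 * pi * (real (P ^ k) * x))" for k
      using cos_2pi_diff_int[of "real (P ^ k) * (x + 1)" "int (P ^ k)"] by (simp add: algebra_simps)
    then show ?thesis by simp
  qed
  note tr = integral_mult_dilated_periodic[of ?f ?F P, OF _ _ this P]
  have "exp (- c * (\<Sum>k<Suc \<kappa>. 1 - cos (2 * pi * (real (P ^ k) * \<theta>)))) = ?f \<theta> * ?F (real P * \<theta>)" for \<theta>
    by (simp add: sum.lessThan_Suc_shift exp_add[symmetric] algebra_simps del: sum.lessThan_Suc)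
  then have eq: "integral {0..1} (\<lambda>\<theta>. exp (- c * (\<Sum>k<Suc \<kappa>. 1 - cos (2 * pi * (real (P ^ k) * \<theta>)))))
      = 1 / real P * integral {0..1} (\<lambda>x. (\<Sum>i<P. ?f ((x + real i) / real P)) * ?F x)"
    by (subst tr[symmetric]) (auto intro!: continuous_intros)
  have "integral {0..1} (\<lambda>x. (\<Sum>i<P. ?f ((x + real i) / real P)) * ?F x)
      \<le> integral {0..1} (\<lambda>x. ?L * ?F x)"
  proof (rule integral_le)
    show "(\<Sum>i<P. ?f ((x + real i) / real P)) * ?F x \<le> ?L * ?F x" if "x \<in> {0..1}" for x
      by (rule mult_right_mono) (use sum_exp_cos_preimages_le[OF P c, of x] that in auto)
  next
    have cF: "continuous_on {0..1} ?F" by (intro continuous_intros)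
    have "continuous_on {0..1} (\<lambda>x. ?f ((x + real i) / real P))" for i
      using P by (intro continuous_intros) auto
    then show "(\<lambda>x. (\<Sum>i<P. ?f ((x + real i) / real P)) * ?F x) integrable_on {0..1}"
      by (intro integrable_continuous_real continuous_on_mult[OF _ cF] continuous_on_sum)
    show "(\<lambda>x. ?L * ?F x) integrable_on {0..1}"
      by (intro integrable_continuous_real continuous_on_mult[OF _ cF] continuous_on_const)
  qed
  also have "\<dots> = ?L * integral {0..1} ?F" by (rule integral_mult_right)
  also have "\<dots> \<le> ?L * (?L / real P) ^ \<kappa>"
    by (rule mult_left_mono[OF Suc]) (auto intro: add_nonneg_nonneg)
  finally have "1 / real P * integral {0..1} (\<lambda>x. (\<Sum>i<P. ?f ((x + real i) / real P)) * ?F x)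
      \<le> 1 / real P * (?L * (?L / real P) ^ \<kappa>)"
    by (rule mult_left_mono) simp
  then show ?case unfolding eq by (simp only: power_Suc times_divide_eq_left mult_1 times_divide_eq_right)
qed

text \<open>Multiplication by \<open>q\<close> preserves Lebesgue measure on the circle, so the
  starting value of the progression does not affect the integral.\<close>

lemma integral_exp_dilated_chain_le:
  fixes c :: real and P \<kappa> q :: nat
  assumes P: "P > 0" and c: "c \<ge> 0" and q: "q > 0"
  shows "integral {0..1} (\<lambda>\<theta>. exp (- c * (\<Sum>k<\<kappa>. 1 - cos (2 * pi * (real (P ^ k * q) * \<theta>)))))
          \<le> ((1 + real P * exp (- c * (1 - cos (pi / real P)))) / real P) ^ \<kappa>"
proof -
  let ?F = "\<lambda>\<theta>. exp (- c * (\<Sum>k<\<kappa>. 1 - cos (2 * pi * (real (P ^ k) * \<theta>))))"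
  have "?F (x + 1) = ?F x" for x
  proof -
    have "cos (2 * pi * (real (P ^ k) * (x + 1))) = cos (2 * pi * (real (P ^ k) * x))" for k
      using cos_2pi_diff_int[of "real (P ^ k) * (x + 1)" "int (P ^ k)"] by (simp add: algebra_simps)
    then show ?thesis by simp
  qed
  note tr = integral_mult_dilated_periodic[of "\<lambda>_. 1" ?F q, OF _ _ this q]
  have "continuous_on UNIV ?F" by (intro continuous_intros)
  from tr[OF _ this] q have "integral {0..1} (\<lambda>\<theta>. ?F (real q * \<theta>)) = integral {0..1} ?F"
    by simp
  then show ?thesis
    using integral_exp_chain_le[OF P c, of \<kappa>] by (simp add: mult.assoc)
qed

lemma prod_le_sum_power:
  fixes x :: "nat \<Rightarrow> real"
  assumes "\<And>j. x j \<ge> 0" "J > 0"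
  shows "(\<Prod>j<J. x j) \<le> (\<Sum>j<J. x j ^ J)"
proof -
  have fin: "finite (x ` {..<J})" "x ` {..<J} \<noteq> {}" using assms(2) by auto
  obtain j0 where j0: "j0 < J" "x j0 = Max (x ` {..<J})"
    using Max_in[OF fin] by force
  have "x j \<le> x j0" if "j < J" for j using that fin j0 by simp
  then have "(\<Prod>j<J. x j) \<le> (\<Prod>j<J. x j0)" by (intro prod_mono) (use assms in auto)
  also have "\<dots> = x j0 ^ J" by simp
  also have "\<dots> \<le> (\<Sum>j<J. x j ^ J)"
    using j0 assms by (intro member_le_sum) auto
  finally show ?thesis .
qed

text \<open>The rows are decoupled by bounding a product of \<open>J\<close> factors by the sum of their \<open>J\<close>-th
  powers: raising a chain to the power \<open>J\<close> makes every preimage but one negligible.\<close>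

lemma integral_exp_grid_le:
  fixes c :: real and P \<kappa> J :: nat and q :: "nat \<Rightarrow> nat"
  assumes P: "P > 0" and c: "c \<ge> 0" and q: "\<And>j. q j > 0" and J: "J > 0"
  shows "integral {0..1} (\<lambda>\<theta>. exp (- c * (\<Sum>j<J. \<Sum>k<\<kappa>. 1 - cos (2 * pi * (real (P ^ k * q j) * \<theta>)))))
          \<le> real J * ((1 + real P * exp (- (real J * c) * (1 - cos (pi / real P)))) / real P) ^ \<kappa>"
proof -
  let ?S = "\<lambda>j \<theta>. \<Sum>k<\<kappa>. 1 - cos (2 * pi * (real (P ^ k * q j) * \<theta>))"
  have "integral {0..1} (\<lambda>\<theta>. exp (- c * (\<Sum>j<J. ?S j \<theta>)))
      \<le> integral {0..1} (\<lambda>\<theta>. \<Sum>j<J. exp (- (real J * c) * ?S j \<theta>))"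
  proof (rule integral_le)
    show "exp (- c * (\<Sum>j<J. ?S j \<theta>)) \<le> (\<Sum>j<J. exp (- (real J * c) * ?S j \<theta>))" for \<theta>
    proof -
      have "exp (- c * (\<Sum>j<J. ?S j \<theta>)) = (\<Prod>j<J. exp (- c * ?S j \<theta>))"
        by (simp only: sum_distrib_left exp_sum finite_lessThan)
      also have "\<dots> \<le> (\<Sum>j<J. exp (- c * ?S j \<theta>) ^ J)"
        by (rule prod_le_sum_power) (use J in auto)
      also have "\<dots> = (\<Sum>j<J. exp (- (real J * c) * ?S j \<theta>))"
        by (simp only: exp_of_nat_mult[symmetric]) (simp only: mult_minus_right mult_minus_left mult.assoc)
      finally show ?thesis .
    qed
  qed (auto intro!: integrable_continuous_real continuous_intros)
  also have "\<dots> = (\<Sum>j<J. integral {0..1} (\<lambda>\<theta>. exp (- (real J * c) * ?S j \<theta>)))"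
    by (rule integral_sum) (auto intro!: integrable_continuous_real continuous_intros)
  also have "\<dots> \<le> (\<Sum>j<J. ((1 + real P * exp (- (real J * c) * (1 - cos (pi / real P)))) / real P) ^ \<kappa>)"
    by (intro sum_mono integral_exp_dilated_chain_le) (use P c q in auto)
  finally show ?thesis by simp
qed

text \<open>Let a be the integer nearest to \<open>y\<close>. As long as P ^ k * (y - a) has modulus
  at most 1/2, the cosine condition improves this to 1 / (2 P), which is exactly what the next
  multiplication by \<open>P\<close> needs.\<close>

lemma near_int_of_small_chain:
  fixes y :: real and P \<kappa> :: nat
  assumes P: "P > 0" and "\<And>k. k < \<kappa> \<Longrightarrow> cos (2 * pi * (real (P ^ k) * y)) > cos (pi / real P)"
  shows "\<exists>a::int. \<bar>y - of_int a\<bar> \<le> 1 / (2 * real P ^ \<kappa>)"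
proof -
  define a where "a = round y"
  have "\<bar>y - of_int a\<bar> \<le> 1 / (2 * real P ^ k)" if "k \<le> \<kappa>" for k
    using that
  proof (induction k)
    case 0
    show ?case using of_int_round_abs_le[of y] by (simp add: a_def abs_minus_commute)
  next
    case (Suc k)
    define u where "u = real P ^ k * (y - of_int a)"
    have u_eq: "\<bar>u\<bar> = real P ^ k * \<bar>y - of_int a\<bar>" by (simp add: u_def abs_mult)
    have u: "\<bar>u\<bar> \<le> 1/2" unfolding u_eq using Suc P by (simp add: field_simps)
    have "cos (2 * pi * (real (P ^ k) * y)) = cos (2 * pi * u)"
      using cos_2pi_diff_int[of "real (P ^ k) * y" "int (P ^ k) * a"] by (simp add: u_def algebra_simps)
    then have "cos \<bar>2 * pi * u\<bar> > cos (pi / real P)" using assms(2)[of k] Suc by simp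
    moreover have "cos \<bar>2 * pi * u\<bar> \<le> cos (pi / real P)" if "pi / real P \<le> \<bar>2 * pi * u\<bar>"
      by (rule cos_monotone_0_pi_le) (use u that in \<open>auto simp: abs_mult\<close>)
    ultimately have "\<bar>2 * pi * u\<bar> < pi / real P" by linarith
    then have "\<bar>u\<bar> < 1 / (2 * real P)" using P by (simp add: abs_mult field_simps)
    then show ?case unfolding u_eq using P by (simp add: field_simps)
  qed
  then show ?thesis by blast
qed

section \<open>The smoothing set\<close>

lemma coprime_powers_eq_iff:
  fixes a b :: nat
  assumes "a \<ge> 2" "b \<ge> 2" "coprime a b"
  shows "a ^ i * b ^ j = a ^ i' * b ^ j' \<longleftrightarrow> i = i' \<and> j = j'"
proof -
  have le: "x \<le> x'" if "c \<ge> 2" "coprime c d" "c ^ x * d ^ y = c ^ x' * d ^ y'" for c d x y x' y' :: nat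
  proof -
    have "c ^ x dvd c ^ x' * d ^ y'" using that by (metis dvd_triv_left)
    then have "c ^ x dvd c ^ x'" using that(2) by (simp add: coprime_dvd_mult_left_iff)
    then show ?thesis using that(1) by (intro power_dvd_imp_le) auto
  qed
  have cop: "coprime b a" using assms(3) by (simp add: coprime_commute)
  show ?thesis
  proof
    assume eq: "a ^ i * b ^ j = a ^ i' * b ^ j'"
    then have eq': "b ^ j * a ^ i = b ^ j' * a ^ i'" by (simp add: mult.commute)
    show "i = i' \<and> j = j'"
      using le[OF assms(1,3) eq] le[OF assms(1,3) eq[symmetric]]
        le[OF assms(2) cop eq'] le[OF assms(2) cop eq'[symmetric]] by simp
  qed auto
qed

text \<open>The shape of the exponents places the sets for \<open>e = 0\<close> and \<open>e = 1\<close> in different parity classes,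
  so that each of them remains available when the other class is being studied.\<close>

definition smoothing_set :: "nat \<Rightarrow> nat \<Rightarrow> nat \<Rightarrow> nat \<Rightarrow> real \<Rightarrow> nat set" where
  "smoothing_set a b e J R = {h. real h \<le> R \<and>
     (\<exists>k j. j < J \<and> (h = a ^ (2*k) * b ^ (2*j+e) \<or> h = b ^ (2*k) * a ^ (2*j+e)))}"

lemma finite_nat_real_le: "finite {h::nat. real h \<le> R}"
proof (rule finite_subset)
  show "{h::nat. real h \<le> R} \<subseteq> {..nat \<lfloor>R\<rfloor>}" by (auto simp: le_nat_floor)
qed simp

lemma finite_smoothing_set: "finite (smoothing_set a b e J R)"
  by (rule finite_subset[OF _ finite_nat_real_le[of R]]) (auto simp: smoothing_set_def)

lemma smoothing_set_commute: "smoothing_set a b e J R = smoothing_set b a e J R"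
  unfolding smoothing_set_def by blast

text \<open>Pigeonhole over the \<open>J\<close> progressions with ratio a^2: they are disjoint, so
  one of them has defect below the threshold for a single term. All terms of that progression are
  then near integers, and the chain bound divided by the starting value locates \<theta>.\<close>

lemma near_fraction_of_small_defect:
  fixes a b e J :: nat and R \<theta> :: real
  assumes ab: "a \<ge> 2" "b \<ge> 2" "coprime a b" and R: "R > 0" and J: "J > 0"
    and small: "phase_defect (smoothing_set a b e J R) \<theta> < (1 - cos (pi / real (a^2))) * real J"
  shows "\<exists>j<J. \<exists>z::int. \<bar>\<theta> - of_int z / real (b ^ (2*j+e))\<bar> \<le> 1 / (2 * R)"
proof -
  define A where "A j = {h. real h \<le> R \<and> (\<exists>k. h = a ^ (2*k) * b ^ (2*j+e))}" for j
  let ?\<delta> = "1 - cos (pi / real (a^2))"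
  have finA: "finite (A j)" for j
    by (rule finite_subset[OF _ finite_nat_real_le[of R]]) (auto simp: A_def)
  have "(\<Sum>j<J. phase_defect (A j) \<theta>) = phase_defect (\<Union>j\<in>{..<J}. A j) \<theta>"
    unfolding phase_defect_def
    by (rule sum.UNION_disjoint[symmetric]) (use finA in \<open>auto simp: A_def coprime_powers_eq_iff[OF ab]\<close>)
  also have "\<dots> \<le> phase_defect (smoothing_set a b e J R) \<theta>"
    by (rule phase_defect_mono[OF finite_smoothing_set]) (auto simp: A_def smoothing_set_def)
  finally have "(\<Sum>j<J. phase_defect (A j) \<theta>) < ?\<delta> * real J" using small by linarith
  moreover have "?\<delta> * real J \<le> (\<Sum>j<J. phase_defect (A j) \<theta>)"
    if "\<And>j. j < J \<Longrightarrow> phase_defect (A j) \<theta> \<ge> ?\<delta>"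
  proof -
    have "(\<Sum>j<J. ?\<delta>) \<le> (\<Sum>j<J. phase_defect (A j) \<theta>)" by (rule sum_mono) (use that in auto)
    then show ?thesis by (simp add: mult.commute)
  qed
  ultimately obtain j where j: "j < J" "phase_defect (A j) \<theta> < ?\<delta>"
    by (meson not_le)
  define q where "q = b ^ (2*j+e)"
  have q: "q > 0" using ab by (auto simp: q_def)
  define P where "P = a^2"
  have P: "P \<ge> 2" using ab self_le_power[of a 2] by (auto simp: P_def)
  have "\<exists>\<kappa>. R / real q < real P ^ \<kappa>" by (rule real_arch_pow) (use P in simp)
  then obtain \<kappa>0 where \<kappa>0: "R / real q < real P ^ \<kappa>0" by blast
  \<comment> \<open>The first power that leaves the range: all smaller exponents give elements of
    the set, while P ^ \<kappa> * q > R turns the error 1 / (2 P ^ \<kappa> q) into 1 / (2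
    R).\<close>
  define \<kappa> where "\<kappa> = (LEAST \<kappa>. R / real q < real P ^ \<kappa>)"
  have \<kappa>: "R / real q < real P ^ \<kappa>" unfolding \<kappa>_def using \<kappa>0 by (rule LeastI)
  have "cos (2 * pi * (real (P ^ k) * (real q * \<theta>))) > cos (pi / real P)" if "k < \<kappa>" for k
  proof -
    have "\<not> R / real q < real P ^ k" using not_less_Least that unfolding \<kappa>_def by blast
    then have "P ^ k * q \<in> A j" using q
      by (auto simp: A_def P_def q_def power_mult[symmetric] field_simps)
    then have "1 - cos (2 * pi * (real (P ^ k * q) * \<theta>)) \<le> phase_defect (A j) \<theta>"
      unfolding phase_defect_def by (intro member_le_sum[where f = "\<lambda>h. 1 - cos (2 * pi * (real h * \<theta>))"] finA) auto
    then show ?thesis using j(2) by (simp add: P_def mult.assoc)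
  qed
  then obtain z :: int where z: "\<bar>real q * \<theta> - of_int z\<bar> \<le> 1 / (2 * real P ^ \<kappa>)"
    using near_int_of_small_chain[of P \<kappa> "real q * \<theta>"] P by auto
  have "\<bar>\<theta> - of_int z / real q\<bar> = \<bar>real q * \<theta> - of_int z\<bar> / real q"
  proof -
    have "\<theta> - of_int z / real q = (real q * \<theta> - of_int z) / real q" using q by (simp add: field_simps)
    then show ?thesis using q by (simp add: abs_divide)
  qed
  also have "\<dots> \<le> 1 / (2 * real P ^ \<kappa>) / real q" using z q by (intro divide_right_mono) auto
  also have "\<dots> \<le> 1 / (2 * R)"
  proof -
    have "R \<le> real P ^ \<kappa> * real q" using \<kappa> q by (simp add: field_simps)
    then show ?thesis using R by (simp add: field_simps)
  qed
  finally show ?thesis using j(1) unfolding q_def by blast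
qed

lemma phase_defect_smoothing_ge:
  fixes a b e J :: nat and R \<theta> :: real
  assumes ab: "a \<ge> 2" "b \<ge> 2" "coprime a b" and J: "J > 0" and e: "e \<le> 1"
    and R: "real ((a * b) ^ (2 * J)) \<le> R"
    and \<theta>: "\<bar>\<theta>\<bar> \<le> 1/2" "1 / (2 * R) < \<bar>\<theta>\<bar>"
  shows "phase_defect (smoothing_set a b e J R) \<theta>
           \<ge> min (1 - cos (pi / real (a^2))) (1 - cos (pi / real (b^2))) * real J"
proof (rule ccontr)
  let ?D = "phase_defect (smoothing_set a b e J R) \<theta>"
  assume "\<not> ?thesis"
  then have D: "?D < min (1 - cos (pi / real (a^2))) (1 - cos (pi / real (b^2))) * real J" by simp
  have "(a * b) ^ (2 * J) \<ge> 1" using ab by simp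
  then have R1: "R \<ge> 1" using R by linarith
  have "(a*b)^(2*J) \<ge> 2" 
    using ab J self_le_power[of "a*b" "2*J"] mult_le_mono[OF ab(1,2)] by simp
  then have R2: "R \<ge> 2" using R by linarith
  have cop': "coprime b a" using ab by (simp add: coprime_commute)
  have min1: "min x y * real J \<le> x * real J" "min x y * real J \<le> y * real J" for x y :: real
    by (auto intro: mult_right_mono)
  obtain j z where j: "j < J" and z: "\<bar>\<theta> - of_int z / real (b ^ (2*j+e))\<bar> \<le> 1 / (2 * R)"
  proof -
    have "?D < (1 - cos (pi / real (a^2))) * real J" using D min1(1) by (rule less_le_trans)
    then show ?thesis using near_fraction_of_small_defect[OF ab, of R J e \<theta>] R1 J that by auto
  qed
  obtain i y where i: "i < J" and y: "\<bar>\<theta> - of_int y / real (a ^ (2*i+e))\<bar> \<le> 1 / (2 * R)"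
  proof -
    have "?D < (1 - cos (pi / real (b^2))) * real J" using D min1(2) by (rule less_le_trans)
    then show ?thesis using near_fraction_of_small_defect[OF ab(2,1) cop', of R J e \<theta>] R1 J that
      unfolding smoothing_set_commute[of b a] by auto
  qed
  define q where "q = b ^ (2*j+e)"
  define t where "t = a ^ (2*i+e)"
  have pos: "q > 0" "t > 0" using ab by (auto simp: q_def t_def)
  \<comment> \<open>This is what the size condition on \<open>R\<close> is for: distinct fractions
    with denominators \<open>q\<close> and \<open>t\<close> differ by at least 1 / (q t) > 1 / R,
    while the two at hand are within 1 / R of each other.\<close>
  have qt: "real (q * t) < R"
  proof -
    have "q * t < b ^ (2*J) * a ^ (2*J)" unfolding q_def t_def
      by (rule mult_strict_mono) (use ab i j e in \<open>auto intro!: power_strict_increasing\<close>)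
    then have "q * t < (a * b) ^ (2 * J)" by (simp add: power_mult_distrib mult.commute)
    then show ?thesis using R by linarith
  qed
  have "\<bar>of_int z / real q - of_int y / real t\<bar> \<le> 1 / R"
    using z y unfolding q_def[symmetric] t_def[symmetric] by (auto simp: field_simps)
  moreover have "of_int z / real q - of_int y / real t = of_int (z * int t - y * int q) / real (q * t)"
    using pos by (simp add: field_simps)
  ultimately have "\<bar>of_int (z * int t - y * int q)\<bar> \<le> real (q * t) / R"
    using pos by (simp add: abs_divide field_simps)
  also have "\<dots> < 1" using qt R1 by simp
  finally have eq: "z * int t = y * int q" by linarith
  have "coprime (int q) (int t)" using ab(3) unfolding q_def t_def
    by (simp add: coprime_commute)
  moreover have "int q dvd z * int t" using eq by simp
  ultimately have "int q dvd z" by (simp add: coprime_dvd_mult_left_iff)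
  then obtain w where w: "z = int q * w" by blast
  then have "\<bar>\<theta> - of_int w\<bar> \<le> 1 / (2 * R)" using z pos unfolding q_def[symmetric] by simp
  moreover have "1 / (2 * R) \<le> 1/4" using R2 by (simp add: field_simps)
  ultimately have "\<bar>of_int w\<bar> < (1::real)" using \<theta>(1) by linarith
  then have "w = 0" by linarith
  then show False using \<open>\<bar>\<theta> - of_int w\<bar> \<le> 1 / (2 * R)\<close> \<theta>(2) by simp
qed

text \<open>Only the progressions with ratio a^2 are kept, and only \<open>J\<close> of the
  \<open>J'\<close> rows. The chains must stay below \<open>R\<close> in every row used, so each
  further row shortens them and costs a factor b^2 in the end.\<close>

lemma integral_exp_defect_smoothing_le:
  fixes a b e J J' \<kappa> :: nat and R c :: real
  assumes ab: "a \<ge> 2" "b \<ge> 2" "coprime a b" and J: "J > 0" "J \<le> J'" and c: "c \<ge> 0"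
    and R: "\<And>k j. k < \<kappa> \<Longrightarrow> j < J \<Longrightarrow> real (a ^ (2*k) * b ^ (2*j+e)) \<le> R"
  shows "integral {-1/2..1/2} (\<lambda>\<theta>. exp (- c * phase_defect (smoothing_set a b e J' R) \<theta>))
    \<le> real J * ((1 + real (a^2) * exp (- (real J * c) * (1 - cos (pi / real (a^2))))) / real (a^2)) ^ \<kappa>"
proof -
  let ?Q = "smoothing_set a b e J' R"
  let ?g = "\<lambda>\<theta> j k. 1 - cos (2 * pi * (real ((a^2) ^ k * b ^ (2*j+e)) * \<theta>))"
  have le: "(\<Sum>j<J. \<Sum>k<\<kappa>. ?g \<theta> j k) \<le> phase_defect ?Q \<theta>" for \<theta>
  proof -
    let ?h = "\<lambda>(j, k). (a^2) ^ k * b ^ (2*j+e)"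
    have inj: "inj_on ?h ({..<J} \<times> {..<\<kappa>})"
      by (auto simp: inj_on_def power_mult[symmetric] coprime_powers_eq_iff[OF ab])
    have "(\<Sum>j<J. \<Sum>k<\<kappa>. ?g \<theta> j k) = (\<Sum>p\<in>{..<J} \<times> {..<\<kappa>}. 1 - cos (2 * pi * (real (?h p) * \<theta>)))"
      by (simp add: sum.cartesian_product case_prod_unfold)
    also have "\<dots> = phase_defect (?h ` ({..<J} \<times> {..<\<kappa>})) \<theta>"
      unfolding phase_defect_def by (subst sum.reindex[OF inj]) (simp add: case_prod_unfold)
    also have "\<dots> \<le> phase_defect ?Q \<theta>"
    proof (rule phase_defect_mono[OF finite_smoothing_set])
      show "?h ` ({..<J} \<times> {..<\<kappa>}) \<subseteq> ?Q"
      proof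
        fix h assume "h \<in> ?h ` ({..<J} \<times> {..<\<kappa>})"
        then obtain j k where jk: "j < J" "k < \<kappa>" "h = a ^ (2*k) * b ^ (2*j+e)"
          by (auto simp: power_mult[symmetric])
        show "h \<in> ?Q" unfolding smoothing_set_def mem_Collect_eq
          using R[of k j] J jk by (intro conjI exI[of _ k] exI[of _ j] disjI1) auto
      qed
    qed
    finally show ?thesis .
  qed
  have "integral {-1/2..1/2} (\<lambda>\<theta>. exp (- c * phase_defect ?Q \<theta>)) =
      integral {0..1} (\<lambda>\<theta>. exp (- c * phase_defect ?Q \<theta>))"
    by (rule integral_periodic_shift) (auto intro!: continuous_intros simp: phase_defect_periodic)
  also have "\<dots> \<le> integral {0..1} (\<lambda>\<theta>. exp (- c * (\<Sum>j<J. \<Sum>k<\<kappa>. ?g \<theta> j k)))"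
  proof (rule integral_le)
    show "exp (- c * phase_defect ?Q \<theta>) \<le> exp (- c * (\<Sum>j<J. \<Sum>k<\<kappa>. ?g \<theta> j k))" for \<theta>
      using mult_left_mono[OF le c] by simp
  qed (intro integrable_continuous_real continuous_intros)+
  also have "\<dots> \<le> real J * ((1 + real (a^2) * exp (- (real J * c) * (1 - cos (pi / real (a^2))))) / real (a^2)) ^ \<kappa>"
    by (rule integral_exp_grid_le[where q = "\<lambda>j. b ^ (2*j+e)"]) (use ab c J in auto)
  finally show ?thesis .
qed

lemma cos_pi_div_less_1:
  assumes "a \<ge> 2" shows "cos (pi / real (a^2)) < 1"
proof -
  have "real (a^2) \<ge> 1" using assms by simp
  moreover have "pi * 1 \<le> pi * real (a^2)" using \<open>real (a^2) \<ge> 1\<close> by (intro mult_left_mono) auto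
  ultimately have "0 < pi / real (a^2)" "pi / real (a^2) \<le> pi"
    using assms by (simp_all del: of_nat_power of_nat_eq_of_nat_power_cancel_iff add: divide_le_eq zero_less_divide_iff)
  then show ?thesis using cos_monotone_0_pi[of 0 "pi / real (a^2)"] by simp
qed

text \<open>A number of rows logarithmic in \<open>l\<close> makes the row factors only a power of
  \<open>l\<close>; the factor b^2 absorbs the ceiling.\<close>

lemma power_nat_ceiling_le:
  fixes b :: nat and C l :: real
  assumes "b \<ge> 1" "C \<ge> 0" "l \<ge> 1"
  shows "real (b ^ (2 * nat \<lceil>C * ln l\<rceil>)) \<le> real b ^ 2 * l powr (2 * C * ln (real b))"
proof -
  have nn: "C * ln l \<ge> 0" using assms by simp
  have "real (b ^ (2 * nat \<lceil>C * ln l\<rceil>)) = real b powr (2 * real (nat \<lceil>C * ln l\<rceil>))"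
    using assms by (simp add: powr_realpow[symmetric])
  also have "\<dots> \<le> real b powr (2 * (C * ln l + 1))"
    using assms nn ceiling_correct[of "C * ln l"] by (intro powr_mono) (auto simp: of_nat_nat)
  also have "\<dots> = real b ^ 2 * l powr (2 * C * ln (real b))"
  proof -
    have "real b powr (2 * (C * ln l + 1)) = real b powr 2 * real b powr (2 * C * ln l)"
      by (simp only: powr_add[symmetric]) (simp add: algebra_simps)
    also have "real b powr 2 = real b ^ 2" using assms by (simp add: powr_realpow)
    also have "real b powr (2 * C * ln l) = l powr (2 * C * ln (real b))"
      using assms by (simp add: powr_def mult_ac)
    finally show ?thesis .
  qed
  finally show ?thesis .
qed

text \<open>Asking for a continuous majorant on the whole interval replaces an integral over the
  interval with its central arc removed, so that integrability is automatic and majorants can simply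
  be added to other terms.\<close>

definition tail_majorant :: "real \<Rightarrow> nat set \<Rightarrow> real \<Rightarrow> real \<Rightarrow> (real \<Rightarrow> real) \<Rightarrow> bool" where
  "tail_majorant \<eta> Q R B g \<longleftrightarrow> continuous_on UNIV g \<and> (\<forall>\<theta>. g \<theta> \<ge> 0) \<and>
     (\<forall>\<theta>. \<bar>\<theta>\<bar> \<le> 1/2 \<longrightarrow> 1 / (2*R) < \<bar>\<theta>\<bar> \<longrightarrow> exp (- \<eta> * phase_defect Q \<theta>) \<le> g \<theta>) \<and>
     integral {-1/2..1/2} g \<le> B"

text \<open>The exponent \<eta> is spent in two halves. One is bounded pointwise off the central
  arc, where the defect is at least a multiple of C ln l, and yields any desired negative power of
  \<open>l\<close>. The other is integrated by the chain bound, which is 1 / R up to a power of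
  \<open>l\<close> that does not depend on \<open>C\<close>.\<close>

lemma smoothing_tail:
  fixes a b B :: nat and \<eta> :: real
  assumes ab: "a \<ge> 2" "b \<ge> 2" "coprime a b" and \<eta>: "\<eta> > 0"
  shows "\<exists>C>0. \<forall>\<^sub>F l in at_top. \<forall>R e. exp (l/2) \<le> R \<longrightarrow> R \<le> exp l \<longrightarrow> e \<le> 1 \<longrightarrow>
    (\<exists>g. tail_majorant \<eta> (smoothing_set a b e (nat \<lceil>C * ln l\<rceil>) R) R (1 / (l ^ B * R)) g)"
    (is "\<exists>C>0. \<forall>\<^sub>F l in at_top. ?P C l")
proof -
  define \<delta> where "\<delta> = min (1 - cos (pi / real (a^2))) (1 - cos (pi / real (b^2)))"
  have \<delta>: "\<delta> > 0" using cos_pi_div_less_1[of a] cos_pi_div_less_1[of b] ab by (simp add: \<delta>_def)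
  have \<delta>a: "\<delta> \<le> 1 - cos (pi / real (a^2))" by (simp add: \<delta>_def)
  \<comment> \<open>With C1 ln l rows the far preimages contribute O(1 / l^2) per step, so that a
    chain of at most l + 1 steps loses only a bounded factor.\<close>
  define C1 where "C1 = 4 / (\<eta> * \<delta>)"
  define E where "E = 2 * C1 * ln (real b)"
  \<comment> \<open>Chosen after \<open>E\<close>, the power lost to the row factor b ^ (2 J1): the
    pointwise half must absorb l ^ (2 + E) and still leave l ^ (- B).\<close>
  define C where "C = max C1 ((real B + 2 + E) * 2 / (\<eta> * \<delta>))"
  have C1: "C1 > 0" using \<eta> \<delta> by (simp add: C1_def)
  have C: "C \<ge> C1" "C > 0" using C1 by (auto simp: C_def)
  have C\<delta>: "\<eta> * \<delta> * C / 2 \<ge> real B + 2 + E"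
  proof -
    have "\<eta> * \<delta> * ((real B + 2 + E) * 2 / (\<eta> * \<delta>)) \<le> \<eta> * \<delta> * C"
      using \<eta> \<delta> by (intro mult_left_mono) (auto simp: C_def)
    moreover have "\<eta> * \<delta> * ((real B + 2 + E) * 2 / (\<eta> * \<delta>)) = (real B + 2 + E) * 2"
      using \<eta> \<delta> by simp
    ultimately show ?thesis by simp
  qed
  define K where "K = 2 * C * ln (real (a*b))"
  define k2 where "k2 = (real (a*b))^2"
  define a2 where "a2 = (real a)^2"
  have pos: "K > 0" "k2 > 0" "a2 > 0" using C ab less_1_mult[of "real a" "real b"] by (auto simp: K_def k2_def a2_def)
  have ev1: "\<forall>\<^sub>F l in at_top. k2 * l powr K \<le> exp (l/2)" using pos by real_asymp
  have ev2: "\<forall>\<^sub>F l in at_top. (l + 1) * a2 / l^2 \<le> 1" using pos by real_asymp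
  have ev3: "\<forall>\<^sub>F l in at_top. C1 * ln l + 1 \<le> l" using C1 by real_asymp
  have ev4: "\<forall>\<^sub>F l in at_top. l \<ge> 3 * real b^2 + 3" by real_asymp
  have ev5: "\<forall>\<^sub>F l in at_top. C1 * ln l > 0" using C1 by real_asymp
  have "\<forall>\<^sub>F l in at_top. ?P C l"
    using ev1 ev2 ev3 ev4 ev5
  proof eventually_elim
    case (elim l)
    show ?case
    proof (intro allI impI)
    fix R :: real and e :: nat
    assume RB: "exp (l/2) \<le> R" "R \<le> exp l" "e \<le> 1"
    have l3: "l \<ge> 3" and l1: "l \<ge> 1" using elim(4) zero_le_power2[of "real b"] by linarith+
    define J1 where "J1 = nat \<lceil>C1 * ln l\<rceil>"
    define J2 where "J2 = nat \<lceil>C * ln l\<rceil>"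
    have "C1 * ln l \<le> C * ln l" using C l1 by (intro mult_right_mono) auto
    then have J12: "J1 \<le> J2" unfolding J1_def J2_def by (intro nat_mono ceiling_mono)
    have J1: "J1 > 0" using elim(5) by (simp add: J1_def)
    have J1ge: "real J1 \<ge> C1 * ln l" and J1le: "real J1 \<le> C1 * ln l + 1"
      using elim(5) unfolding J1_def by (auto simp: of_nat_nat)
    have J2ge: "real J2 \<ge> C * ln l" unfolding J2_def by linarith
    define Q where "Q = smoothing_set a b e J2 R"
    have R: "R \<ge> 1" using RB(1) l1 by (meson exp_ge_zero le_divide_eq_1_pos one_le_exp_iff order_trans zero_le_divide_iff zero_le_numeral zero_le_one)
    have "real ((a*b) ^ (2 * J2)) \<le> k2 * l powr K" unfolding J2_def k2_def K_def
      using power_nat_ceiling_le[of "a*b" C l] C ab l1 by (simp add: Suc_le_eq)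
    then have RJ2: "real ((a*b) ^ (2 * J2)) \<le> R" using elim(1) RB(1) by linarith
    define \<epsilon> where "\<epsilon> = exp (- (\<eta>/2) * (\<delta> * real J2))"
    define g where "g \<theta> = \<epsilon> * exp (- (\<eta>/2) * phase_defect Q \<theta>)" for \<theta>
    have g_ge: "exp (- \<eta> * phase_defect Q \<theta>) \<le> g \<theta>"
      if "\<bar>\<theta>\<bar> \<le> 1/2" "1 / (2*R) < \<bar>\<theta>\<bar>" for \<theta>
    proof -
      have "phase_defect Q \<theta> \<ge> \<delta> * real J2" unfolding Q_def \<delta>_def
        using phase_defect_smoothing_ge[OF ab _ RB(3) RJ2 that] J1 J12 by simp
      then have "(\<eta>/2) * (\<delta> * real J2) \<le> (\<eta>/2) * phase_defect Q \<theta>"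
        using \<eta> by (intro mult_left_mono) auto
      then show ?thesis unfolding g_def \<epsilon>_def by (simp add: exp_add[symmetric])
    qed
    define P where "P = real (a^2)"
    have P: "P \<ge> 2" using ab self_le_power[of a 2] by (simp add: P_def del: of_nat_power)
    have q: "real (b ^ (2*J1)) > 0" using ab by simp
    have "\<exists>\<kappa>. R / real (b ^ (2*J1)) < P ^ \<kappa>" by (rule real_arch_pow) (use P in simp)
    then obtain \<kappa>0 where \<kappa>0: "R / real (b ^ (2*J1)) < P ^ \<kappa>0" by blast
    \<comment> \<open>Short enough for the chain to stay below \<open>R\<close> in all
      \<open>J1\<close> rows, and long enough for P ^ \<kappa> > R / b ^ (2 J1), which produces the
      factor 1 / R.\<close>
    define \<kappa> where "\<kappa> = (LEAST \<kappa>. R / real (b ^ (2*J1)) < P ^ \<kappa>)"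
    have \<kappa>: "R / real (b ^ (2*J1)) < P ^ \<kappa>" unfolding \<kappa>_def using \<kappa>0 by (rule LeastI)
    have \<kappa>le: "P ^ k * real (b ^ (2*J1)) \<le> R" if "k < \<kappa>" for k
    proof -
      have "\<not> R / real (b ^ (2*J1)) < P ^ k" using not_less_Least that unfolding \<kappa>_def by blast
      then show ?thesis using q by (simp add: field_simps)
    qed
    have mem: "real (a ^ (2*k) * b ^ (2*j+e)) \<le> R" if "k < \<kappa>" "j < J1" for k j
    proof -
      have "b ^ (2*j+e) \<le> b ^ (2*J1)" using that RB(3) ab by (intro power_increasing) auto
      then have "real (b ^ (2*j+e)) \<le> real (b ^ (2*J1))" by (simp only: of_nat_le_iff)
      then have "P ^ k * real (b ^ (2*j+e)) \<le> P ^ k * real (b ^ (2*J1))"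
        using P by (intro mult_left_mono) auto
      then show ?thesis using \<kappa>le[OF that(1)] by (simp add: P_def power_mult)
    qed
    \<comment> \<open>The ratio P = a^2 is at least 4 > e, so a chain below exp l has at most l + 1
      terms.\<close>
    have \<kappa>l: "real \<kappa> \<le> l + 1"
    proof (cases \<kappa>)
      case (Suc k)
      have b1: "real (b ^ (2*J1)) \<ge> 1" using ab by simp
      have "P ^ k \<le> P ^ k * real (b ^ (2*J1))" using P b1 by (simp add: mult_le_cancel_left1)
      then have "P ^ k \<le> exp l" using \<kappa>le[of k] Suc RB(2) by simp
      moreover have "4 ^ k \<le> P ^ k" using ab power_mono[of 2 a 2] by (intro power_mono) (auto simp: P_def simp flip: of_nat_power)
      moreover have "exp (real k) \<le> 4 ^ k"
      proof -
        have "exp (real k) = exp 1 ^ k" by (simp add: exp_of_nat_mult[symmetric])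
        also have "\<dots> \<le> 4 ^ k" using exp_le by (intro power_mono) auto
        finally show ?thesis .
      qed
      ultimately have "exp (real k) \<le> exp l" by linarith
      then show ?thesis using Suc by simp
    qed (use l1 in simp)
    have small: "P * exp (- (real J1 * (\<eta>/2)) * (1 - cos (pi / P))) \<le> a2 / l^2"
    proof -
      have "2 * ln l = C1 * ln l * (\<eta>/2) * \<delta>" using \<eta> \<delta> by (simp add: C1_def field_simps)
      also have "\<dots> \<le> real J1 * (\<eta>/2) * (1 - cos (pi / P))"
        using J1ge \<eta> \<delta> \<delta>a l1 C1 by (intro mult_mono) (auto simp: P_def)
      finally have "exp (- (real J1 * (\<eta>/2)) * (1 - cos (pi / P))) \<le> exp (- (2 * ln l))" by simp
      also have "\<dots> = 1 / l^2" using l1 exp_double[of "ln l"] by (simp add: exp_minus inverse_eq_divide)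
      finally have "P * exp (- (real J1 * (\<eta>/2)) * (1 - cos (pi / P))) \<le> P * (1 / l^2)"
        using P by (intro mult_left_mono) auto
      then show ?thesis by (simp add: P_def a2_def)
    qed
    have "integral {-1/2..1/2} (\<lambda>\<theta>. exp (- (\<eta>/2) * phase_defect Q \<theta>))
       \<le> real J1 * ((1 + P * exp (- (real J1 * (\<eta>/2)) * (1 - cos (pi / P)))) / P) ^ \<kappa>"
      unfolding Q_def P_def
      by (rule integral_exp_defect_smoothing_le) (use ab J1 J12 \<eta> mem in auto)
    also have "\<dots> \<le> real J1 * ((1 + a2 / l^2) / P) ^ \<kappa>"
      using small P by (intro mult_left_mono power_mono divide_right_mono) (auto intro!: divide_nonneg_pos add_nonneg_nonneg)
    also have "\<dots> = real J1 * (1 + a2 / l^2) ^ \<kappa> / P ^ \<kappa>" by (simp add: power_divide)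
    also have "\<dots> \<le> real J1 * 3 / (R / real (b ^ (2*J1)))"
    proof (rule frac_le)
      have "(1 + a2 / l^2) ^ \<kappa> \<le> exp (a2 / l^2) ^ \<kappa>"
        using pos by (intro power_mono) auto
      also have "\<dots> = exp (real \<kappa> * (a2 / l^2))" by (rule exp_of_nat_mult[symmetric])
      also have "real \<kappa> * (a2 / l^2) \<le> (l + 1) * (a2 / l^2)"
        using \<kappa>l pos by (intro mult_right_mono) auto
      also have "\<dots> \<le> 1" using elim(2) by simp
      finally have "(1 + a2 / l^2) ^ \<kappa> \<le> 3" using exp_le by simp
      then show "real J1 * (1 + a2 / l^2) ^ \<kappa> \<le> real J1 * 3" by (intro mult_left_mono) auto
    qed (use \<kappa> q R in auto)
    also have "\<dots> = real J1 * 3 * real (b ^ (2*J1)) / R" by simp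
    also have "\<dots> \<le> l * 3 * (real b ^ 2 * l powr E) / R"
      using power_nat_ceiling_le[of b C1 l] ab C1 l1 J1le elim(3) R unfolding J1_def[symmetric] E_def
      by (intro divide_right_mono mult_mono) auto
    also have "\<dots> \<le> l * l * l powr E / R"
    proof -
      have "l * (3 * real b ^ 2) * l powr E \<le> l * l * l powr E"
        using elim(4) l1 by (intro mult_right_mono mult_left_mono) auto
      then show ?thesis using R by (intro divide_right_mono) (auto simp: mult_ac)
    qed
    also have "\<dots> = l powr (2 + E) / R"
      using l1 by (simp add: powr_add powr_realpow power2_eq_square)
    finally have int: "integral {-1/2..1/2} (\<lambda>\<theta>. exp (- (\<eta>/2) * phase_defect Q \<theta>)) \<le> l powr (2 + E) / R" .
    have "\<epsilon> \<le> exp (- (real B + 2 + E) * ln l)"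
    proof -
      have "(real B + 2 + E) * ln l \<le> \<eta> * \<delta> * C / 2 * ln l" using C\<delta> l1 by (intro mult_right_mono) auto
      also have "\<dots> = \<eta> * \<delta> / 2 * (C * ln l)" by simp
      also have "\<dots> \<le> \<eta> * \<delta> / 2 * real J2" using J2ge \<eta> \<delta> by (intro mult_left_mono) auto
      finally have "- (\<eta>/2) * (\<delta> * real J2) \<le> - (real B + 2 + E) * ln l"
        by (simp add: algebra_simps)
      then show ?thesis by (simp add: \<epsilon>_def)
    qed
    also have "\<dots> = l powr (- (real B + 2 + E))" using l1 by (simp add: powr_def)
    finally have \<epsilon>: "\<epsilon> \<le> l powr (- (real B + 2 + E))" .
    have "integral {-1/2..1/2} g = \<epsilon> * integral {-1/2..1/2} (\<lambda>\<theta>. exp (- (\<eta>/2) * phase_defect Q \<theta>))"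
      unfolding g_def by (rule integral_mult_right)
    also have "\<dots> \<le> l powr (- (real B + 2 + E)) * (l powr (2 + E) / R)"
      using int \<epsilon> by (intro mult_mono integral_nonneg) 
        (auto intro!: integrable_continuous_real continuous_intros)
    also have "\<dots> = l powr (- real B) / R"
      by (simp add: powr_add[symmetric])
    also have "\<dots> = 1 / (l ^ B * R)" using l1 by (simp add: powr_minus powr_realpow field_simps)
    finally have "integral {-1/2..1/2} g \<le> 1 / (l ^ B * R)" .
    moreover have "continuous_on UNIV g" unfolding g_def by (intro continuous_intros)
    moreover have "g \<theta> \<ge> 0" for \<theta> by (simp add: g_def \<epsilon>_def)
    ultimately show "\<exists>g. tail_majorant \<eta> (smoothing_set a b e (nat \<lceil>C * ln l\<rceil>) R) R (1 / (l ^ B * R)) g"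
      using g_ge unfolding Q_def J2_def tail_majorant_def by blast
    qed
  qed
  then show ?thesis using C(2) by blast
qed

section \<open>Independent digits\<close>

text \<open>Values off \<open>U\<close> are pinned to 0, so that configurations on different index
  sets share one type and a representation is literally such a configuration.\<close>

definition digit_configs :: "nat \<Rightarrow> nat set \<Rightarrow> (nat \<Rightarrow> nat) set" where
  "digit_configs d U = {a. \<forall>x. (x \<in> U \<longrightarrow> a x < d) \<and> (x \<notin> U \<longrightarrow> a x = 0)}"

lemma finite_digit_configs: "finite U \<Longrightarrow> finite (digit_configs d U)"
  using finite_PiE_dflt[of U "\<lambda>_. {..<d}" 0]
  by (auto simp: digit_configs_def PiE_dflt_def elim: finite_subset[rotated])

lemma sum_digit_configs_union:
  fixes G :: "(nat \<Rightarrow> nat) \<Rightarrow> 'b::comm_monoid_add"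
  assumes "U \<inter> V = {}"
  shows "(\<Sum>a\<in>digit_configs d (U \<union> V). G a) =
         (\<Sum>b\<in>digit_configs d U. \<Sum>c\<in>digit_configs d V. G (\<lambda>x. if x \<in> U then b x else c x))"
proof -
  let ?m = "\<lambda>(b, c) x. if x \<in> U then b x else c x :: nat"
  let ?r = "\<lambda>a. (\<lambda>x. if x \<in> U then a x else 0, \<lambda>x. if x \<in> V then a x else 0 :: nat)"
  have "bij_betw ?m (digit_configs d U \<times> digit_configs d V) (digit_configs d (U \<union> V))"
    by (rule bij_betw_byWitness[where f' = ?r])
      (use assms in \<open>auto simp: digit_configs_def fun_eq_iff disjoint_iff split: if_splits\<close>)
  from sum.reindex_bij_betw[OF this, of G, symmetric] show ?thesis
    by (simp add: sum.cartesian_product case_prod_unfold)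
qed

lemma sum_digit_configs_singleton:
  fixes G :: "(nat \<Rightarrow> nat) \<Rightarrow> 'b::comm_monoid_add"
  shows "(\<Sum>a\<in>digit_configs d {h}. G a) = (\<Sum>k<d. G ((\<lambda>_. 0)(h := k)))"
proof -
  have "bij_betw (\<lambda>k. (\<lambda>_. 0)(h := k)) {..<d} (digit_configs d {h})"
    by (rule bij_betw_byWitness[where f' = "\<lambda>a. a h"]) (auto simp: digit_configs_def fun_eq_iff)
  from sum.reindex_bij_betw[OF this, of G] show ?thesis by simp
qed

lemma sum_prod_digit_configs:
  fixes u :: "nat \<Rightarrow> nat \<Rightarrow> 'b::comm_semiring_1"
  assumes "finite U"
  shows "(\<Sum>a\<in>digit_configs d U. \<Prod>h\<in>U. u h (a h)) = (\<Prod>h\<in>U. \<Sum>k<d. u h k)"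
  using assms
proof (induction U)
  case empty
  have "digit_configs d {} = {\<lambda>_. 0}" by (auto simp: digit_configs_def)
  then show ?case by simp
next
  case (insert x U)
  have "(\<Sum>a\<in>digit_configs d (insert x U). \<Prod>h\<in>insert x U. u h (a h)) =
      (\<Sum>b\<in>digit_configs d {x}. \<Sum>c\<in>digit_configs d U. \<Prod>h\<in>insert x U. u h (if h \<in> {x} then b h else c h))"
    using sum_digit_configs_union[of "{x}" U "\<lambda>a. \<Prod>h\<in>insert x U. u h (a h)" d] insert(2) by simp
  also have "\<dots> = (\<Sum>b\<in>digit_configs d {x}. \<Sum>c\<in>digit_configs d U. u x (b x) * (\<Prod>h\<in>U. u h (c h)))"
  proof (intro sum.cong refl)
    fix b c
    have "(\<Prod>h\<in>U. u h (if h \<in> {x} then b h else c h)) = (\<Prod>h\<in>U. u h (c h))"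
      using insert(2) by (intro prod.cong) auto
    then show "(\<Prod>h\<in>insert x U. u h (if h \<in> {x} then b h else c h)) = u x (b x) * (\<Prod>h\<in>U. u h (c h))"
      using insert(1,2) by simp
  qed
  also have "\<dots> = (\<Sum>k<d. u x k) * (\<Prod>h\<in>U. \<Sum>k<d. u h k)"
    by (simp add: sum_digit_configs_singleton sum_distrib_left[symmetric] sum_distrib_right[symmetric] insert(3))
  finally show ?case using insert(1,2) by simp
qed

text \<open>Plays the part of measurability with respect to the digits on \<open>U\<close>, so that
  independence needs no sigma-algebras.\<close>

definition depends_on :: "nat set \<Rightarrow> ((nat \<Rightarrow> nat) \<Rightarrow> 'b) \<Rightarrow> bool" where
  "depends_on U f \<longleftrightarrow> (\<forall>a b. (\<forall>h\<in>U. a h = b h) \<longrightarrow> f a = f b)"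

lemma depends_onD: "depends_on U f \<Longrightarrow> (\<And>h. h \<in> U \<Longrightarrow> a h = b h) \<Longrightarrow> f a = f b"
  unfolding depends_on_def by blast

lemma depends_on_mono: "depends_on U f \<Longrightarrow> U \<subseteq> V \<Longrightarrow> depends_on V f"
  unfolding depends_on_def by blast

lemma depends_on_comp: "depends_on U f \<Longrightarrow> depends_on U (\<lambda>a. g (f a))"
  unfolding depends_on_def by metis

lemma depends_on_comp2: "depends_on U f \<Longrightarrow> depends_on U f' \<Longrightarrow> depends_on U (\<lambda>a. g (f a) (f' a))"
  unfolding depends_on_def by metis

lemma depends_on_const: "depends_on U (\<lambda>a. c)"
  unfolding depends_on_def by blast

lemma depends_on_sum: "V \<subseteq> U \<Longrightarrow> depends_on U (\<lambda>a. \<Sum>h\<in>V. g h (a h))"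
  unfolding depends_on_def by (auto intro!: sum.cong)

lemma depends_on_prod: "V \<subseteq> U \<Longrightarrow> depends_on U (\<lambda>a. \<Prod>h\<in>V. g h (a h))"
  unfolding depends_on_def by (auto intro!: prod.cong)

definition rep_value :: "nat set \<Rightarrow> (nat \<Rightarrow> nat) \<Rightarrow> nat" where
  "rep_value U a = (\<Sum>h\<in>U. a h * h)"

lemma depends_on_rep_value: "V \<subseteq> U \<Longrightarrow> depends_on U (rep_value V)"
  unfolding rep_value_def by (rule depends_on_sum)

lemma has_integral_cis_int:
  "((\<lambda>\<theta>. cis (2 * pi * \<theta> * of_int k)) has_integral of_bool (k = 0)) {-1/2..1/2::real}"
proof (cases "k = 0")
  case True
  then show ?thesis using has_integral_const_real[of "1::complex" "-1/2" "1/2"] by (simp add: one_complex.code)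
next
  case False
  let ?F = "\<lambda>\<theta>::real. cis (2 * pi * \<theta> * of_int k) / (\<i> * (2 * pi * of_int k))"
  have "((\<lambda>\<theta>. cis (2 * pi * \<theta> * of_int k)) has_integral (?F (1/2) - ?F (-1/2))) {-1/2..1/2}"
  proof (rule fundamental_theorem_of_calculus)
    fix x :: real
    have eq: "cis (2 * pi * \<theta> * of_int k) = exp (\<i> * (2 * pi * of_int k) * of_real \<theta>)" for \<theta>
      by (simp add: cis_conv_exp mult_ac)
    have "((\<lambda>z. exp (\<i> * (2 * pi * of_int k) * z)) has_field_derivative
        (\<i> * (2 * pi * of_int k)) * exp (\<i> * (2 * pi * of_int k) * of_real x)) (at (of_real x))"
      by (auto intro!: derivative_eq_intros)
    from has_vector_derivative_real_field[OF this]
    have "((\<lambda>\<theta>. cis (2 * pi * \<theta> * of_int k)) has_vector_derivative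
        (\<i> * (2 * pi * of_int k)) * cis (2 * pi * x * of_int k)) (at x within {-1/2..1/2})"
      unfolding eq by simp
    then have "(?F has_vector_derivative ((\<i> * (2 * pi * of_int k)) * cis (2 * pi * x * of_int k)) / (\<i> * (2 * pi * of_int k))) (at x within {-1/2..1/2})"
      by (rule has_vector_derivative_divide)
    then show "(?F has_vector_derivative cis (2 * pi * x * of_int k)) (at x within {-1/2..1/2})"
      using False by (simp add: scaleR_conv_of_real field_simps)
  qed simp
  moreover have "?F (1/2) = ?F (-1/2)"
  proof -
    have "cis (2 * pi * (1/2) * of_int k) = cis (2 * pi * (-1/2) * of_int k) * cis (2 * pi * of_int k)"
      unfolding cis_mult by (simp add: algebra_simps)
    also have "cis (2 * pi * of_int k) = 1" by (rule cis_multiple_2pi) simp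
    also have "cis (2 * pi * (-1/2) * of_int k) * 1 = cis (2 * pi * (-1/2) * of_int k)" by (rule mult_1_right)
    finally show ?thesis by simp
  qed
  ultimately show ?thesis using False by simp
qed

lemma norm_cis_diff_1_le: "norm (cis x - 1) \<le> \<bar>x\<bar>"
  using iexp_approx1[of x 0] by (simp add: cis_conv_exp)

text \<open>A product probability on finitely many digits. Its expectation \<open>Ex\<close> is a
  finite weighted sum with values in any real normed field, so that real moments and complex
  characteristic functions share one calculus and exchanging \<open>Ex\<close> with an integral is
  finite additivity.\<close>

locale digit_product =
  fixes d :: nat and H :: "nat set" and w :: "nat \<Rightarrow> nat \<Rightarrow> real"
  assumes finite_H: "finite H" and w_nonneg: "\<And>h k. w h k \<ge> 0"
    and w_sum: "\<And>h. (\<Sum>k<d. w h k) = 1"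
begin

definition weight :: "nat set \<Rightarrow> (nat \<Rightarrow> nat) \<Rightarrow> real" where
  "weight U a = (\<Prod>h\<in>U. w h (a h))"

definition Ex :: "((nat \<Rightarrow> nat) \<Rightarrow> 'b::real_normed_field) \<Rightarrow> 'b" where
  "Ex F = (\<Sum>a\<in>digit_configs d H. weight H a *\<^sub>R F a)"

definition Ex1 :: "nat \<Rightarrow> (nat \<Rightarrow> 'b::real_normed_field) \<Rightarrow> 'b" where
  "Ex1 h g = (\<Sum>k<d. w h k *\<^sub>R g k)"

lemma weight_nonneg: "weight U a \<ge> 0"
  unfolding weight_def by (rule prod_nonneg) (simp add: w_nonneg)

lemma sum_weight: "finite U \<Longrightarrow> (\<Sum>a\<in>digit_configs d U. weight U a) = 1"
  unfolding weight_def by (subst sum_prod_digit_configs) (auto simp: w_sum)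

lemma weight_union:
  "finite U \<Longrightarrow> finite V \<Longrightarrow> U \<inter> V = {} \<Longrightarrow>
    weight (U \<union> V) (\<lambda>x. if x \<in> U then b x else c x) = weight U b * weight V c"
  unfolding weight_def
  by (subst prod.union_disjoint) (auto intro!: arg_cong2[where f = "(*)"] prod.cong)

lemma Ex_split:
  assumes "U \<subseteq> H"
  shows "Ex F = (\<Sum>b\<in>digit_configs d U. \<Sum>c\<in>digit_configs d (H - U).
           (weight U b * weight (H - U) c) *\<^sub>R F (\<lambda>x. if x \<in> U then b x else c x))"
proof -
  have H: "U \<union> (H - U) = H" "finite U" "finite (H - U)" "U \<inter> (H - U) = {}"
    using assms finite_H by (auto intro: finite_subset)
  show ?thesis
    unfolding Ex_def using sum_digit_configs_union[OF H(4), of "\<lambda>a. weight H a *\<^sub>R F a" d]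
      weight_union[OF H(2,3,4)] H(1) by simp
qed

lemma Ex_restrict:
  assumes "depends_on U f" "U \<subseteq> H"
  shows "Ex f = (\<Sum>b\<in>digit_configs d U. weight U b *\<^sub>R f b)"
proof -
  have "f (\<lambda>x. if x \<in> U then b x else c x) = f b" for b c
    by (rule depends_onD[OF assms(1)]) simp
  then show ?thesis
    using sum_weight[of "H - U"] finite_H
    by (simp add: Ex_split[OF assms(2)] scaleR_left.sum[symmetric] sum_distrib_left[symmetric])
qed

lemma Ex_mult_indep:
  assumes f: "depends_on U f" and g: "depends_on V g" and UV: "U \<subseteq> H" "V \<subseteq> H" "U \<inter> V = {}"
  shows "Ex (\<lambda>a. f a * g a) = Ex f * Ex g"
proof -
  have g': "depends_on (H - U) g" by (rule depends_on_mono[OF g]) (use UV in auto)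
  have fm: "f (\<lambda>x. if x \<in> U then b x else c x) = f b" for b c
    by (rule depends_onD[OF f]) simp
  have gm: "g (\<lambda>x. if x \<in> U then b x else c x) = g c" for b c
    by (rule depends_onD[OF g']) simp
  have "Ex (\<lambda>a. f a * g a) = (\<Sum>b\<in>digit_configs d U. weight U b *\<^sub>R f b) *
      (\<Sum>c\<in>digit_configs d (H - U). weight (H - U) c *\<^sub>R g c)"
    by (simp add: Ex_split[OF UV(1)] fm gm sum_product mult_ac)
  then show ?thesis using Ex_restrict[OF f UV(1)] Ex_restrict[OF g'] by simp
qed

lemma Ex_prod:
  assumes "U \<subseteq> H"
  shows "Ex (\<lambda>a. \<Prod>h\<in>U. g h (a h)) = (\<Prod>h\<in>U. Ex1 h (g h))"
proof -
  have fU: "finite U" using assms finite_H by (rule finite_subset)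
  have "Ex (\<lambda>a. \<Prod>h\<in>U. g h (a h)) = (\<Sum>b\<in>digit_configs d U. \<Prod>h\<in>U. w h (b h) *\<^sub>R g h (b h))"
    by (simp add: Ex_restrict[OF depends_on_prod[OF subset_refl] assms] weight_def
        scaleR_conv_of_real prod.distrib)
  also have "\<dots> = (\<Prod>h\<in>U. Ex1 h (g h))"
    unfolding Ex1_def by (rule sum_prod_digit_configs[OF fU])
  finally show ?thesis .
qed

lemma Ex_single: "h \<in> H \<Longrightarrow> Ex (\<lambda>a. g (a h)) = Ex1 h g"
  using Ex_prod[of "{h}" "\<lambda>_. g"] by simp

lemma Ex_add: "Ex (\<lambda>a. f a + g a) = Ex f + Ex g"
  by (simp add: Ex_def scaleR_add_right sum.distrib)

lemma Ex_diff: "Ex (\<lambda>a. f a - g a) = Ex f - Ex g"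
  by (simp add: Ex_def scaleR_diff_right sum_subtractf)

lemma Ex_cmult: "Ex (\<lambda>a. c * f a) = c * Ex f"
  by (simp add: Ex_def sum_distrib_left)

lemma Ex_const: "Ex (\<lambda>a. c) = c"
  using sum_weight[OF finite_H] by (simp add: Ex_def scaleR_left.sum[symmetric])

lemma Ex_sum: "Ex (\<lambda>a. \<Sum>i\<in>I. f i a) = (\<Sum>i\<in>I. Ex (f i))"
  unfolding Ex_def by (simp add: scaleR_right.sum sum.swap[of _ I])

lemma Ex_mono:
  fixes f g :: "(nat \<Rightarrow> nat) \<Rightarrow> real"
  assumes "\<And>a. a \<in> digit_configs d H \<Longrightarrow> f a \<le> g a"
  shows "Ex f \<le> Ex g"
  unfolding Ex_def by (rule sum_mono) (use assms weight_nonneg in \<open>auto intro: mult_left_mono\<close>)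

lemma Ex_nonneg:
  fixes f :: "(nat \<Rightarrow> nat) \<Rightarrow> real"
  assumes "\<And>a. f a \<ge> 0"
  shows "Ex f \<ge> 0"
  unfolding Ex_def by (rule sum_nonneg) (use assms weight_nonneg in auto)

lemma norm_Ex_le: "norm (Ex f) \<le> Ex (\<lambda>a. norm (f a))"
  unfolding Ex_def by (rule order_trans[OF norm_sum]) (simp add: weight_nonneg)

lemma norm_Ex_le_const:
  assumes "\<And>a. a \<in> digit_configs d H \<Longrightarrow> norm (f a) \<le> B"
  shows "norm (Ex f) \<le> B"
  using norm_Ex_le[of f] Ex_mono[of "\<lambda>a. norm (f a)" "\<lambda>_. B"] assms Ex_const[of B] by simp

lemma of_real_Ex: "(of_real (Ex f) :: complex) = Ex (\<lambda>a. of_real (f a))"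
  by (simp add: Ex_def scaleR_conv_of_real)

lemma of_real_Ex1: "(of_real (Ex1 h f) :: complex) = Ex1 h (\<lambda>a. of_real (f a))"
  by (simp add: Ex1_def scaleR_conv_of_real)

lemma Ex1_add: "Ex1 h (\<lambda>k. f k + g k) = Ex1 h f + Ex1 h g"
  by (simp add: Ex1_def scaleR_add_right sum.distrib)

lemma Ex1_diff: "Ex1 h (\<lambda>k. f k - g k) = Ex1 h f - Ex1 h g"
  by (simp add: Ex1_def scaleR_diff_right sum_subtractf)

lemma Ex1_cmult: "Ex1 h (\<lambda>k. c * f k) = c * Ex1 h f"
  by (simp add: Ex1_def sum_distrib_left)

lemma Ex1_const: "Ex1 h (\<lambda>k. c) = c"
  using w_sum[of h] by (simp add: Ex1_def scaleR_left.sum[symmetric])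

lemma Ex1_mono:
  fixes f g :: "nat \<Rightarrow> real"
  assumes "\<And>k. k < d \<Longrightarrow> f k \<le> g k"
  shows "Ex1 h f \<le> Ex1 h g"
  unfolding Ex1_def by (rule sum_mono) (use assms w_nonneg in \<open>auto intro: mult_left_mono\<close>)

lemma norm_Ex1_le: "norm (Ex1 h f) \<le> Ex1 h (\<lambda>k. norm (f k))"
  unfolding Ex1_def by (rule order_trans[OF norm_sum]) (simp add: w_nonneg)

lemma Ex_cis_rep_value:
  assumes "U \<subseteq> H"
  shows "Ex (\<lambda>a. cis (2 * pi * \<theta> * real (rep_value U a))) =
         (\<Prod>h\<in>U. Ex1 h (\<lambda>k. cis (2 * pi * (real h * \<theta>) * real k)))"
proof -
  have fU: "finite U" using assms finite_H by (rule finite_subset)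
  have cis_sum: "cis (\<Sum>h\<in>U. f h) = (\<Prod>h\<in>U. cis (f h))" for f
    using fU by (induction U) (auto simp: cis_mult[symmetric])
  have "cis (2 * pi * \<theta> * real (rep_value U a)) = (\<Prod>h\<in>U. cis (2 * pi * (real h * \<theta>) * real (a h)))" for a
    by (simp add: rep_value_def sum_distrib_left cis_sum[symmetric] mult_ac)
  then show ?thesis using Ex_prod[OF assms] by simp
qed

text \<open>Orthogonality of the characters of the circle picks out the event that the value is
  \<open>n\<close>.\<close>

lemma fourier_inversion:
  fixes F :: "(nat \<Rightarrow> nat) \<Rightarrow> complex"
  shows "((\<lambda>\<theta>. Ex (\<lambda>a. F a * cis (2 * pi * \<theta> * (real (rep_value H a) - real n))))
           has_integral Ex (\<lambda>a. if rep_value H a = n then F a else 0)) {-1/2..1/2}"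
proof -
  have eq: "(if rep_value H a = n then F a else 0) = F a * of_bool (int (rep_value H a) - int n = 0)" for a
    by simp
  have "((\<lambda>\<theta>. weight H a *\<^sub>R (F a * cis (2 * pi * \<theta> * (real (rep_value H a) - real n))))
      has_integral weight H a *\<^sub>R (if rep_value H a = n then F a else 0)) {-1/2..1/2}" for a
    unfolding eq
    using has_integral_cmul[OF has_integral_mult_right[OF has_integral_cis_int[of "int (rep_value H a) - int n"]]] by simp
  then show ?thesis unfolding Ex_def
    by (intro has_integral_sum finite_digit_configs finite_H)
qed

end

section \<open>Fourier inversion and a local limit bound\<close>

lemma norm_exp_minus_linear_le:
  fixes t :: real assumes "t \<ge> 0" shows "\<bar>exp (- t) - (1 - t)\<bar> \<le> t^2"
proof -
  have 1: "1 - t \<le> exp (- t)" using exp_ge_add_one_self[of "- t"] by simp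
  have "exp (- t) * (1 + t) \<le> exp (-t) * exp t" by (intro mult_left_mono) (use exp_ge_add_one_self[of t] in auto)
  then have "exp (- t) * (1 + t) \<le> 1" by (simp add: exp_minus)
  then have "exp (- t) \<le> 1 / (1 + t)" using assms by (simp add: field_simps)
  also have "\<dots> \<le> 1 - t + t^2"
  proof -
    have "(1 - t + t^2) * (1 + t) = 1 + t^3" by (simp add: algebra_simps power2_eq_square power3_eq_cube)
    then have "1 \<le> (1 - t + t^2) * (1 + t)" using assms by simp
    then show ?thesis using assms by (simp add: pos_divide_le_eq)
  qed
  finally show ?thesis using 1 by simp
qed

lemma norm_cis_quadratic_le:
  fixes y :: real
  shows "norm (cis y - (1 + \<i> * of_real y - of_real (y^2 / 2))) \<le> \<bar>y\<bar>^3"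
proof -
  have "(\<Sum>k\<le>2. (\<i> * complex_of_real y)^k / fact k) = 1 + \<i> * of_real y - of_real (y^2 / 2)"
  proof -
    have "(\<Sum>k\<le>2. f k) = f 0 + f 1 + f 2" for f :: "nat \<Rightarrow> complex" by (simp add: numeral_2_eq_2)
    moreover have "(\<i> * complex_of_real y)^2 = - of_real (y^2)" by (simp add: power_mult_distrib)
    ultimately show ?thesis by simp
  qed
  then have "norm (cis y - (1 + \<i> * of_real y - of_real (y^2 / 2))) \<le> \<bar>y\<bar>^3 / 6"
    using iexp_approx1[of y 2] by (simp add: cis_conv_exp numeral_3_eq_3 fact_numeral)
  also have "\<dots> \<le> \<bar>y\<bar>^3" by simp
  finally show ?thesis .
qed

text \<open>Stands in for Gaussian integrals: exp (- x) \<le> 1 / (1 + x) turns Gaussian bounds into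
  functions with an arctangent primitive.\<close>

lemma integral_inverse_quadratic_le:
  fixes k :: real assumes "k > 0"
  shows "integral {-1/2..1/2} (\<lambda>\<theta>. 1 / (1 + (k * \<theta>)^2)) \<le> pi / k"
proof -
  have "((\<lambda>\<theta>. 1 / (1 + (k * \<theta>)^2)) has_integral (arctan (k * (1/2)) / k - arctan (k * (-1/2)) / k)) {-1/2..1/2}"
  proof (rule fundamental_theorem_of_calculus)
    show "((\<lambda>\<theta>. arctan (k * \<theta>) / k) has_vector_derivative 1 / (1 + (k * x)^2)) (at x within {-1/2..1/2})" for x
      unfolding has_real_derivative_iff_has_vector_derivative[symmetric]
      using assms by (auto intro!: derivative_eq_intros simp: inverse_eq_divide)
  qed simp
  then have "integral {-1/2..1/2} (\<lambda>\<theta>. 1 / (1 + (k * \<theta>)^2)) = (arctan (k * (1/2)) - arctan (k * (-1/2))) / k"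
    by (simp add: integral_unique diff_divide_distrib)
  also have "\<dots> \<le> pi / k"
    using assms arctan_bounded[of "k * (1/2)"] arctan_bounded[of "k * (-1/2)"]
    by (intro divide_right_mono) auto
  finally show ?thesis .
qed

lemma exp_minus_le_inverse: "x \<ge> 0 \<Longrightarrow> exp (- x) \<le> 1 / (1 + x)" for x :: real
  using exp_ge_add_one_self[of x] by (simp add: exp_minus field_simps)

section \<open>Conditioning on the value by means of independent smoothing digits\<close>

context digit_product
begin

text \<open>Multiplied over \<open>Q\<close> at the frequencies 2 \<pi> h \<theta>, these bounds
  produce the phase defect in the exponent.\<close>

definition char_decay :: "real \<Rightarrow> nat set \<Rightarrow> bool" where
  "char_decay \<eta> Q \<longleftrightarrow> (\<forall>h\<in>Q. \<forall>x. norm (Ex1 h (\<lambda>k. cis (x * real k))) \<le> exp (- \<eta> * (1 - cos x)))"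

lemma norm_Ex_cis_le:
  assumes "Q \<subseteq> H" "char_decay \<eta> Q"
  shows "norm (Ex (\<lambda>a. cis (2 * pi * \<theta> * real (rep_value Q a)))) \<le> exp (- \<eta> * phase_defect Q \<theta>)"
proof -
  have fQ: "finite Q" using assms(1) finite_H by (rule finite_subset)
  have "norm (Ex (\<lambda>a. cis (2 * pi * \<theta> * real (rep_value Q a)))) =
      (\<Prod>h\<in>Q. norm (Ex1 h (\<lambda>k. cis (2 * pi * (real h * \<theta>) * real k))))"
    unfolding Ex_cis_rep_value[OF assms(1)] by (rule prod_norm[symmetric])
  also have "\<dots> \<le> (\<Prod>h\<in>Q. exp (- \<eta> * (1 - cos (2 * pi * (real h * \<theta>)))))"
    by (rule prod_mono) (use assms(2) in \<open>auto simp: char_decay_def\<close>)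
  also have "\<dots> = exp (- \<eta> * phase_defect Q \<theta>)"
    unfolding phase_defect_def sum_distrib_left by (rule exp_sum[OF fQ, symmetric])
  finally show ?thesis .
qed

lemma rep_value_split:
  assumes "Q \<subseteq> H" shows "rep_value H a = rep_value (H - Q) a + rep_value Q a"
  unfolding rep_value_def using sum.subset_diff[OF assms finite_H] by simp

lemma Ex_cis_factor:
  fixes F :: "(nat \<Rightarrow> nat) \<Rightarrow> complex"
  assumes "Q \<subseteq> H" "depends_on (H - Q) F"
  shows "Ex (\<lambda>a. F a * cis (2 * pi * \<theta> * (real (rep_value H a) - real n))) =
     Ex (\<lambda>a. F a * cis (2 * pi * \<theta> * (real (rep_value (H - Q) a) - real n))) *
     Ex (\<lambda>a. cis (2 * pi * \<theta> * real (rep_value Q a)))"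
proof -
  have "F a * cis (2 * pi * \<theta> * (real (rep_value H a) - real n)) =
      (F a * cis (2 * pi * \<theta> * (real (rep_value (H - Q) a) - real n))) * cis (2 * pi * \<theta> * real (rep_value Q a))" for a
    unfolding rep_value_split[OF assms(1)] by (simp add: mult.assoc cis_mult algebra_simps)
  moreover have "depends_on (H - Q) (\<lambda>a. F a * cis (2 * pi * \<theta> * (real (rep_value (H - Q) a) - real n)))"
    by (intro depends_on_comp2[OF assms(2), where g = "(*)"]
        depends_on_comp[OF depends_on_rep_value, where g = "\<lambda>v. cis (2 * pi * \<theta> * (real v - real n))"] order_refl)
  moreover have "depends_on Q (\<lambda>a. cis (2 * pi * \<theta> * real (rep_value Q a)))"
    by (intro depends_on_comp[OF depends_on_rep_value, where g = "\<lambda>v. cis (2 * pi * \<theta> * real v)"] order_refl)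
  ultimately show ?thesis
    using Ex_mult_indep[of "H - Q" _ Q] assms(1) by (simp only:) auto
qed

text \<open>\<open>F\<close> ignores the digits on \<open>Q\<close>, so their characteristic
  function splits off in the inversion integral, and the rest is at most Ex F because F \<ge> 0.
  Divided by the hitting probability, the integral bounds the density of the conditioned law of the
  digits on \<open>V\<close>.\<close>

lemma Ex_restricted_le:
  fixes F :: "(nat \<Rightarrow> nat) \<Rightarrow> real"
  assumes F: "\<And>a. F a \<ge> 0" "depends_on V F" and VQ: "V \<subseteq> H" "Q \<subseteq> H" "V \<inter> Q = {}"
    and decay: "char_decay \<eta> Q"
  shows "Ex (\<lambda>a. if rep_value H a = n then F a else 0)
          \<le> Ex F * integral {-1/2..1/2} (\<lambda>\<theta>. exp (- \<eta> * phase_defect Q \<theta>))"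
proof -
  let ?F = "\<lambda>a. complex_of_real (F a)"
  have dep: "depends_on (H - Q) ?F"
    by (rule depends_on_mono[OF depends_on_comp[OF F(2)]]) (use VQ in auto)
  note inv = fourier_inversion[of ?F n]
  have bd: "norm (Ex (\<lambda>a. ?F a * cis (2 * pi * \<theta> * (real (rep_value H a) - real n))))
      \<le> Ex F * exp (- \<eta> * phase_defect Q \<theta>)" for \<theta>
  proof -
    have "norm (Ex (\<lambda>a. ?F a * cis (2 * pi * \<theta> * (real (rep_value (H - Q) a) - real n)))) \<le> Ex F"
      by (rule order_trans[OF norm_Ex_le]) (simp add: norm_mult F(1))
    then show ?thesis
      unfolding Ex_cis_factor[OF VQ(2) dep] norm_mult
      using norm_Ex_cis_le[OF VQ(2) decay, of \<theta>] by (intro mult_mono) (auto intro: Ex_nonneg F(1))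
  qed
  have "complex_of_real (Ex (\<lambda>a. if rep_value H a = n then F a else 0)) =
      Ex (\<lambda>a. if rep_value H a = n then ?F a else 0)"
    unfolding of_real_Ex by (rule arg_cong[where f = Ex]) auto
  also have "\<dots> = integral {-1/2..1/2} (\<lambda>\<theta>. Ex (\<lambda>a. ?F a * cis (2 * pi * \<theta> * (real (rep_value H a) - real n))))"
    using inv by (simp add: integral_unique)
  also have "norm \<dots> \<le> integral {-1/2..1/2} (\<lambda>\<theta>. Ex F * exp (- \<eta> * phase_defect Q \<theta>))"
    by (rule integral_norm_bound_integral)
      (use inv bd in \<open>auto intro!: integrable_continuous_real continuous_intros simp: integrable_on_def\<close>)
  finally show ?thesis by simp
qed

text \<open>In the inversion integral \<open>f\<close> interacts with everything else only through
  the phase of the value on \<open>U\<close>. This phase is within 4 \<pi> K |\<theta>| of its mean,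
  so the covariance is small near 0; elsewhere the decay from \<open>Q\<close> takes over, against
  the trivial bound 2.\<close>

lemma Ex_indicator_indep:
  fixes f g :: "(nat \<Rightarrow> nat) \<Rightarrow> complex"
  assumes f: "depends_on U f" "\<And>a. a \<in> digit_configs d H \<Longrightarrow> norm (f a) \<le> Bf"
    and g: "depends_on V g" "\<And>a. a \<in> digit_configs d H \<Longrightarrow> norm (g a) \<le> Bg"
    and sub: "U \<subseteq> H" "V \<subseteq> H" "Q \<subseteq> H" and disj: "U \<inter> V = {}" "U \<inter> Q = {}" "V \<inter> Q = {}"
    and decay: "char_decay \<eta> Q"
    and K: "\<And>a. a \<in> digit_configs d H \<Longrightarrow> real (rep_value U a) \<le> K"
  shows "norm (Ex (\<lambda>a. if rep_value H a = n then f a * g a else 0) -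
               Ex f * Ex (\<lambda>a. if rep_value H a = n then g a else 0))
        \<le> Bf * Bg * integral {-1/2..1/2} (\<lambda>\<theta>. min 2 (4 * pi * K * \<bar>\<theta>\<bar>) * exp (- \<eta> * phase_defect Q \<theta>))"
proof -
  let ?e = "\<lambda>W \<theta> a. cis (2 * pi * \<theta> * real (rep_value W a))"
  let ?W = "H - Q - U"
  have ne: "digit_configs d H \<noteq> {}" using sum_weight[OF finite_H] by auto
  have B0: "Bf \<ge> 0" "Bg \<ge> 0" using f(2) g(2) ne by (meson all_not_in_conv norm_ge_zero order_trans)+
  have K0: "K \<ge> 0" using K ne by (meson all_not_in_conv of_nat_0_le_iff order_trans)
  have dU: "depends_on (H - Q) f" by (rule depends_on_mono[OF f(1)]) (use sub disj in auto)
  have dV: "depends_on (H - Q) g" by (rule depends_on_mono[OF g(1)]) (use sub disj in auto)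
  have dV': "depends_on ?W g" by (rule depends_on_mono[OF g(1)]) (use sub disj in auto)
  have dfg: "depends_on (H - Q) (\<lambda>a. f a * g a)"
    by (rule depends_on_comp2[OF dU dV, where g = "(*)"])
  have split: "rep_value (H - Q) a = rep_value ?W a + rep_value U a" for a
  proof -
    have "U \<subseteq> H - Q" "finite (H - Q)" using sub disj finite_H by auto
    from sum.subset_diff[OF this] show ?thesis unfolding rep_value_def by simp
  qed
  let ?G = "\<lambda>\<theta> a. g a * cis (2 * pi * \<theta> * (real (rep_value ?W a) - real n))"
  have dG: "depends_on ?W (?G \<theta>)" for \<theta>
    by (intro depends_on_comp2[OF dV', where g = "(*)"]
        depends_on_comp[OF depends_on_rep_value, where g = "\<lambda>v. cis (2 * pi * \<theta> * (real v - real n))"] order_refl)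
  have dE: "depends_on U (?e U \<theta>)" for \<theta>
    by (intro depends_on_comp[OF depends_on_rep_value, where g = "\<lambda>v. cis (2 * pi * \<theta> * real v)"] order_refl)
  have dfE: "depends_on U (\<lambda>a. f a * ?e U \<theta> a)" for \<theta>
    by (rule depends_on_comp2[OF f(1) dE, where g = "(*)"])
  have UW: "U \<subseteq> H" "?W \<subseteq> H" "U \<inter> ?W = {}" using sub by auto
  define \<Phi>1 where "\<Phi>1 \<theta> = Ex (\<lambda>a. f a * g a * cis (2 * pi * \<theta> * (real (rep_value H a) - real n)))" for \<theta>
  define \<Phi>2 where "\<Phi>2 \<theta> = Ex (\<lambda>a. g a * cis (2 * pi * \<theta> * (real (rep_value H a) - real n)))" for \<theta>
  have \<Phi>1: "\<Phi>1 \<theta> = Ex (\<lambda>a. f a * ?e U \<theta> a) * Ex (?G \<theta>) * Ex (?e Q \<theta>)" for \<theta>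
  proof -
    have "f a * g a * cis (2 * pi * \<theta> * (real (rep_value (H - Q) a) - real n)) = (f a * ?e U \<theta> a) * ?G \<theta> a" for a
    proof -
      have "cis (2 * pi * \<theta> * (real (rep_value (H - Q) a) - real n)) =
          ?e U \<theta> a * cis (2 * pi * \<theta> * (real (rep_value ?W a) - real n))"
        unfolding split cis_mult by (simp add: algebra_simps)
      then show ?thesis by simp
    qed
    then show ?thesis unfolding \<Phi>1_def Ex_cis_factor[OF sub(3) dfg]
      by (simp only: Ex_mult_indep[OF dfE dG UW])
  qed
  have \<Phi>2: "\<Phi>2 \<theta> = Ex (?e U \<theta>) * Ex (?G \<theta>) * Ex (?e Q \<theta>)" for \<theta>
  proof -
    have "g a * cis (2 * pi * \<theta> * (real (rep_value (H - Q) a) - real n)) = ?e U \<theta> a * ?G \<theta> a" for a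
    proof -
      have "cis (2 * pi * \<theta> * (real (rep_value (H - Q) a) - real n)) =
          ?e U \<theta> a * cis (2 * pi * \<theta> * (real (rep_value ?W a) - real n))"
        unfolding split cis_mult by (simp add: algebra_simps)
      then show ?thesis by simp
    qed
    then show ?thesis unfolding \<Phi>2_def Ex_cis_factor[OF sub(3) dV]
      by (simp only: Ex_mult_indep[OF dE dG UW])
  qed
  \<comment> \<open>Subtracting Ex f times the mean phase amounts to centring the phase inside the
    expectation.\<close>
  have cov: "norm (Ex (\<lambda>a. f a * ?e U \<theta> a) - Ex f * Ex (?e U \<theta>)) \<le> Bf * min 2 (4 * pi * K * \<bar>\<theta>\<bar>)" for \<theta>
  proof -
    define c where "c = Ex (?e U \<theta>)"
    have "Ex (\<lambda>a. f a * ?e U \<theta> a) - Ex f * c = Ex (\<lambda>a. f a * (?e U \<theta> a - c))"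
      by (simp add: right_diff_distrib Ex_diff mult.commute[of _ c] Ex_cmult)
    also have "norm \<dots> \<le> Bf * min 2 (4 * pi * K * \<bar>\<theta>\<bar>)"
    proof (rule norm_Ex_le_const)
      fix a assume a: "a \<in> digit_configs d H"
      have e1: "norm (?e U \<theta> b - 1) \<le> 2 * pi * K * \<bar>\<theta>\<bar>" if "b \<in> digit_configs d H" for b
      proof -
        have "norm (?e U \<theta> b - 1) \<le> \<bar>2 * pi * \<theta> * real (rep_value U b)\<bar>" by (rule norm_cis_diff_1_le)
        also have "\<dots> = 2 * pi * \<bar>\<theta>\<bar> * real (rep_value U b)" by (simp add: abs_mult)
        also have "\<dots> \<le> 2 * pi * \<bar>\<theta>\<bar> * K" using K[OF that] by (intro mult_left_mono) auto
        finally show ?thesis by (simp add: mult_ac)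
      qed
      have "c - 1 = Ex (\<lambda>a. ?e U \<theta> a - 1)" by (simp add: c_def Ex_diff Ex_const)
      then have c1: "norm (c - 1) \<le> 2 * pi * K * \<bar>\<theta>\<bar>" using norm_Ex_le_const[of "\<lambda>a. ?e U \<theta> a - 1"] e1 by simp
      have c2: "norm c \<le> 1" unfolding c_def by (rule norm_Ex_le_const) simp
      have "norm (?e U \<theta> a - c) \<le> norm (?e U \<theta> a - 1) + norm (c - 1)"
        using norm_triangle_ineq4[of "?e U \<theta> a - 1" "c - 1"] by simp
      then have "norm (?e U \<theta> a - c) \<le> 4 * pi * K * \<bar>\<theta>\<bar>" using e1[OF a] c1 by simp
      moreover have "norm (?e U \<theta> a - c) \<le> 2" using norm_triangle_ineq4[of "?e U \<theta> a" c] c2 by simp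
      ultimately show "norm (f a * (?e U \<theta> a - c)) \<le> Bf * min 2 (4 * pi * K * \<bar>\<theta>\<bar>)"
        unfolding norm_mult using f(2)[OF a] B0 by (intro mult_mono) auto
    qed
    finally show ?thesis unfolding c_def .
  qed
  have bd: "norm (\<Phi>1 \<theta> - Ex f * \<Phi>2 \<theta>) \<le> Bf * Bg * (min 2 (4 * pi * K * \<bar>\<theta>\<bar>) * exp (- \<eta> * phase_defect Q \<theta>))" for \<theta>
  proof -
    have "norm (Ex (?G \<theta>)) \<le> Bg" by (rule norm_Ex_le_const) (simp add: norm_mult g(2))
    have "\<Phi>1 \<theta> - Ex f * \<Phi>2 \<theta> = (Ex (\<lambda>a. f a * ?e U \<theta> a) - Ex f * Ex (?e U \<theta>)) * Ex (?G \<theta>) * Ex (?e Q \<theta>)"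
      unfolding \<Phi>1 \<Phi>2 by (simp add: algebra_simps)
    also have "norm \<dots> \<le> (Bf * min 2 (4 * pi * K * \<bar>\<theta>\<bar>)) * Bg * exp (- \<eta> * phase_defect Q \<theta>)"
      unfolding norm_mult using cov[of \<theta>] \<open>norm (Ex (?G \<theta>)) \<le> Bg\<close> norm_Ex_cis_le[OF sub(3) decay, of \<theta>] B0 K0
      by (intro mult_mono mult_nonneg_nonneg) auto
    finally show ?thesis by (simp add: mult_ac)
  qed
  have i1: "(\<Phi>1 has_integral Ex (\<lambda>a. if rep_value H a = n then f a * g a else 0)) {-1/2..1/2}"
    unfolding \<Phi>1_def[abs_def] by (rule fourier_inversion)
  have i2: "(\<Phi>2 has_integral Ex (\<lambda>a. if rep_value H a = n then g a else 0)) {-1/2..1/2}"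
    unfolding \<Phi>2_def[abs_def] by (rule fourier_inversion)
  have i12: "((\<lambda>\<theta>. \<Phi>1 \<theta> - Ex f * \<Phi>2 \<theta>) has_integral
     (Ex (\<lambda>a. if rep_value H a = n then f a * g a else 0) -
      Ex f * Ex (\<lambda>a. if rep_value H a = n then g a else 0))) {-1/2..1/2}"
    by (intro has_integral_diff i1 has_integral_mult_right i2)
  have "norm (integral {-1/2..1/2} (\<lambda>\<theta>. \<Phi>1 \<theta> - Ex f * \<Phi>2 \<theta>))
      \<le> integral {-1/2..1/2} (\<lambda>\<theta>. Bf * Bg * (min 2 (4 * pi * K * \<bar>\<theta>\<bar>) * exp (- \<eta> * phase_defect Q \<theta>)))"
    by (rule integral_norm_bound_integral)
      (use i12 bd in \<open>auto intro!: integrable_continuous_real continuous_intros simp: integrable_on_def\<close>)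
  then show ?thesis unfolding integral_unique[OF i12] by simp
qed

section \<open>Moments of single digits, Gaussian comparison and a local limit bound\<close>

definition mu :: "nat \<Rightarrow> real" where "mu h = Ex1 h real"
definition var1 :: "nat \<Rightarrow> real" where "var1 h = Ex1 h (\<lambda>k. (real k - mu h)^2)"

lemma Ex_centered_square:
  assumes "V \<subseteq> H"
  shows "Ex (\<lambda>a. (\<Sum>h\<in>V. real (a h) - mu h)^2) = (\<Sum>h\<in>V. var1 h)"
proof -
  have "finite V" using assms finite_H by (rule finite_subset)
  then show ?thesis using assms
  proof (induction V)
    case empty
    then show ?case by (simp add: Ex_const)
  next
    case (insert x V)
    let ?S = "\<lambda>a. \<Sum>h\<in>V. real (a h) - mu h"
    have x: "x \<in> H" using insert by auto
    have d1: "depends_on {x} (\<lambda>a. real (a x) - mu x)" by (simp add: depends_on_def)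
    have d2: "depends_on V ?S" by (rule depends_on_sum[where g = "\<lambda>h k. real k - mu h"]) simp
    have "Ex (\<lambda>a. (real (a x) - mu x) * ?S a) = Ex (\<lambda>a. real (a x) - mu x) * Ex ?S"
      by (rule Ex_mult_indep[OF d1 d2]) (use insert in auto)
    also have "Ex (\<lambda>a. real (a x) - mu x) = 0"
      using Ex_single[OF x, of real] by (simp add: Ex_diff Ex_const mu_def)
    finally have cross: "Ex (\<lambda>a. (real (a x) - mu x) * ?S a) = 0" by simp
    have "(\<Sum>h\<in>insert x V. real (a h) - mu h)^2 = (real (a x) - mu x)^2 + (2 * ((real (a x) - mu x) * ?S a) + (?S a)^2)" for a
      using insert(1,2) by (simp add: power2_eq_square algebra_simps)
    then have "Ex (\<lambda>a. (\<Sum>h\<in>insert x V. real (a h) - mu h)^2) =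
        Ex (\<lambda>a. (real (a x) - mu x)^2) + (2 * 0 + Ex (\<lambda>a. (?S a)^2))"
      by (simp only: Ex_add Ex_cmult cross)
    also have "Ex (\<lambda>a. (real (a x) - mu x)^2) = var1 x"
      unfolding var1_def using Ex_single[OF x, of "\<lambda>k. (real k - mu x)^2"] by simp
    finally show ?case using insert by simp
  qed
qed

text \<open>Both sides are compared with the quadratic Taylor polynomial, whose linear term vanishes
  because the digit is centred.\<close>

lemma norm_Ex1_cis_diff_le:
  "norm (Ex1 h (\<lambda>k. cis (x * (real k - mu h))) - of_real (exp (- (x^2 * var1 h / 2))))
     \<le> \<bar>x\<bar>^3 * Ex1 h (\<lambda>k. \<bar>real k - mu h\<bar>^3) + x^4 * (var1 h)^2"
proof -
  let ?y = "\<lambda>k. x * (real k - mu h)"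
  let ?q = "\<lambda>k. 1 + \<i> * of_real (?y k) - of_real ((?y k)^2 / 2) :: complex"
  have v: "var1 h \<ge> 0" unfolding var1_def
    using Ex1_mono[of "\<lambda>_. 0" "\<lambda>k. (real k - mu h)^2" h] by (simp add: Ex1_const)
  have ap: "norm (cis (?y k) - ?q k) \<le> \<bar>x\<bar>^3 * \<bar>real k - mu h\<bar>^3" for k
  proof -
    have "norm (cis (?y k) - ?q k) \<le> \<bar>?y k\<bar>^3" by (rule norm_cis_quadratic_le)
    also have "\<dots> = \<bar>x\<bar>^3 * \<bar>real k - mu h\<bar>^3" by (simp add: abs_mult power_mult_distrib)
    finally show ?thesis .
  qed
  have "norm (Ex1 h (\<lambda>k. cis (?y k)) - Ex1 h ?q) \<le> Ex1 h (\<lambda>k. norm (cis (?y k) - ?q k))"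
    using norm_Ex1_le[of h "\<lambda>k. cis (?y k) - ?q k"] by (simp add: Ex1_diff)
  also have "\<dots> \<le> Ex1 h (\<lambda>k. \<bar>x\<bar>^3 * \<bar>real k - mu h\<bar>^3)" by (rule Ex1_mono) (rule ap)
  finally have 1: "norm (Ex1 h (\<lambda>k. cis (?y k)) - Ex1 h ?q) \<le> \<bar>x\<bar>^3 * Ex1 h (\<lambda>k. \<bar>real k - mu h\<bar>^3)"
    by (simp only: Ex1_cmult)
  have lin: "Ex1 h ?y = 0"
    by (simp add: Ex1_cmult Ex1_diff Ex1_const) (simp add: mu_def)
  have quad: "Ex1 h (\<lambda>k. (?y k)^2 / 2) = x^2 * var1 h / 2"
    using Ex1_cmult[of h "x^2/2" "\<lambda>k. (real k - mu h)^2"] by (simp add: var1_def power_mult_distrib)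
  have q: "Ex1 h ?q = of_real (1 - x^2 * var1 h / 2)"
    using arg_cong[OF lin, of complex_of_real] arg_cong[OF quad, of complex_of_real]
    unfolding of_real_Ex1 by (simp only: Ex1_diff Ex1_add Ex1_const Ex1_cmult) simp
  have "norm (Ex1 h ?q - of_real (exp (- (x^2 * var1 h / 2)))) = \<bar>exp (- (x^2 * var1 h / 2)) - (1 - x^2 * var1 h / 2)\<bar>"
    unfolding q of_real_diff[symmetric] norm_of_real by (simp add: abs_minus_commute)
  also have "\<dots> \<le> (x^2 * var1 h / 2)^2" by (rule norm_exp_minus_linear_le) (use v in simp)
  also have "\<dots> \<le> x^4 * (var1 h)^2" by (simp add: power_mult_distrib power_divide)
  finally show ?thesis using 1 norm_triangle_ineq[of "Ex1 h (\<lambda>k. cis (?y k)) - Ex1 h ?q" "Ex1 h ?q - of_real (exp (- (x^2 * var1 h / 2)))"]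
    by simp
qed

text \<open>In a product of factors of modulus at most 1 the factors can be exchanged one at a time,
  and the errors add up. Allowing a frequency for each \<open>h\<close> covers both the represented
  value and the digit sum.\<close>

lemma norm_Ex_cis_gauss_le:
  fixes x :: "nat \<Rightarrow> real"
  assumes "U \<subseteq> H"
  shows "norm (Ex (\<lambda>a. cis (\<Sum>h\<in>U. x h * (real (a h) - mu h))) - of_real (exp (- (\<Sum>h\<in>U. (x h)^2 * var1 h) / 2)))
    \<le> (\<Sum>h\<in>U. \<bar>x h\<bar>^3 * Ex1 h (\<lambda>k. \<bar>real k - mu h\<bar>^3) + (x h)^4 * (var1 h)^2)"
proof -
  have fU: "finite U" using assms finite_H by (rule finite_subset)
  have v: "var1 h \<ge> 0" for h unfolding var1_def
    using Ex1_mono[of "\<lambda>_. 0" "\<lambda>k. (real k - mu h)^2" h] by (simp add: Ex1_const)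
  have cis_sum: "cis (\<Sum>h\<in>U. f h) = (\<Prod>h\<in>U. cis (f h))" for f
    using fU by (induction U) (auto simp: cis_mult[symmetric])
  have e1: "Ex (\<lambda>a. cis (\<Sum>h\<in>U. x h * (real (a h) - mu h))) = (\<Prod>h\<in>U. Ex1 h (\<lambda>k. cis (x h * (real k - mu h))))"
    unfolding cis_sum by (rule Ex_prod[OF assms])
  have "exp (- (\<Sum>h\<in>U. (x h)^2 * var1 h) / 2) = (\<Prod>h\<in>U. exp (- ((x h)^2 * var1 h / 2)))"
    using fU by (simp add: exp_sum[symmetric] sum_negf sum_divide_distrib)
  then have e2: "complex_of_real (exp (- (\<Sum>h\<in>U. (x h)^2 * var1 h) / 2)) = (\<Prod>h\<in>U. of_real (exp (- ((x h)^2 * var1 h / 2))))"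
    by simp
  show ?thesis unfolding e1 e2
  proof (rule order_trans[OF norm_prod_diff])
    show "norm (Ex1 i (\<lambda>k. cis (x i * (real k - mu i)))) \<le> 1" for i
      by (rule order_trans[OF norm_Ex1_le]) (simp add: Ex1_const)
    show "norm (complex_of_real (exp (- ((x i)^2 * var1 i / 2)))) \<le> 1" for i
      unfolding norm_of_real using v[of i] by simp
  qed (intro sum_mono norm_Ex1_cis_diff_le)
qed

text \<open>The inversion integral is bounded below through a minorant \<open>L\<close> composed of
  functions on the whole interval, so that it need not be cut at A / s. Up to A / s the integrand is
  Gaussian within \<delta>; beyond it, half of the Gaussian decay gives the small constant exp (- c
  A^2 / 2) and half gives integrability.\<close>

lemma local_limit_lower_bound:
  fixes s A c C3 \<delta> :: real
  assumes n: "real n = (\<Sum>h\<in>H. real h * mu h)"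
    and s: "s \<ge> 2" and A: "A > 0" and c: "c > 0" "c \<le> C3" and \<delta>: "\<delta> \<ge> 0"
    and moments: "\<And>\<theta>. \<bar>\<theta>\<bar> \<le> A / s \<Longrightarrow>
      (\<Sum>h\<in>H. \<bar>2 * pi * \<theta> * real h\<bar>^3 * Ex1 h (\<lambda>k. \<bar>real k - mu h\<bar>^3) + (2 * pi * \<theta> * real h)^4 * (var1 h)^2) \<le> \<delta>"
    and var: "2 * pi^2 * (\<Sum>h\<in>H. (real h)^2 * var1 h) \<le> C3 * s^2"
    and g: "continuous_on UNIV g" "\<And>\<theta>. g \<theta> \<ge> 0"
    and bound: "\<And>\<theta>. \<bar>\<theta>\<bar> \<le> 1/2 \<Longrightarrow>
      norm (Ex (\<lambda>a. cis (2 * pi * \<theta> * real (rep_value H a)))) \<le> exp (- c * (s * \<theta>)^2) + g \<theta>"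
  shows "Ex (\<lambda>a. if rep_value H a = n then 1 else 0) \<ge>
     (2 * exp (- C3) - 2 * pi * \<delta> * A - 2 * pi * exp (- c * A^2 / 2) / sqrt (c / 2)) / s - integral {-1/2..1/2} g"
proof -
  define \<psi> where "\<psi> \<theta> = Ex (\<lambda>a. cis (2 * pi * \<theta> * (real (rep_value H a) - real n)))" for \<theta>
  define p where "p = Ex (\<lambda>a. if rep_value H a = n then 1 else (0::real))"
  \<comment> \<open>In the centre 1 / (1 + (s \<theta> / A)^2) is at least 1/2, whence the
    coefficient 2 \<delta>. Outside, the factor 2 of the other rational term pays both for the
    negative part of \<psi> and for the leading Gaussian, which obeys the same bound since c \<le>
    C3.\<close>
  define L where "L \<theta> = exp (- C3 * (s * \<theta>)^2) - (2 * \<delta>) * (1 / (1 + (s / A * \<theta>)^2))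
      - (2 * exp (- c * A^2 / 2)) * (1 / (1 + (sqrt (c/2) * s * \<theta>)^2)) - g \<theta>" for \<theta>
  have s0: "s > 0" using s by simp
  have "(\<psi> has_integral of_real p) {-1/2..1/2}"
  proof -
    have "of_real p = Ex (\<lambda>a. if rep_value H a = n then 1 else (0::complex))"
      unfolding p_def of_real_Ex by (rule arg_cong[where f = Ex]) auto
    then show ?thesis using fourier_inversion[of "\<lambda>_. 1" n] by (simp add: \<psi>_def[abs_def])
  qed
  from has_integral_linear[OF this bounded_linear_Re]
  have Re_int: "((\<lambda>\<theta>. Re (\<psi> \<theta>)) has_integral p) {-1/2..1/2}" by (simp add: o_def)
  have norm_\<psi>: "norm (\<psi> \<theta>) = norm (Ex (\<lambda>a. cis (2 * pi * \<theta> * real (rep_value H a))))" for \<theta>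
  proof -
    have "cis (2 * pi * \<theta> * (real (rep_value H a) - real n)) = cis (- (2 * pi * \<theta> * real n)) * cis (2 * pi * \<theta> * real (rep_value H a))" for a
      unfolding cis_mult by (simp add: algebra_simps)
    then have "\<psi> \<theta> = cis (- (2 * pi * \<theta> * real n)) * Ex (\<lambda>a. cis (2 * pi * \<theta> * real (rep_value H a)))"
      unfolding \<psi>_def by (simp only: Ex_cmult)
    then show ?thesis by (simp add: norm_mult)
  qed
  have L_le: "L \<theta> \<le> Re (\<psi> \<theta>)" if "\<bar>\<theta>\<bar> \<le> 1/2" for \<theta>
  proof (cases "\<bar>\<theta>\<bar> \<le> A / s")
    case True
    have eq: "2 * pi * \<theta> * (real (rep_value H a) - real n) = (\<Sum>h\<in>H. (2 * pi * \<theta> * real h) * (real (a h) - mu h))" for a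
      unfolding n rep_value_def by (simp add: sum_distrib_left right_diff_distrib sum_subtractf algebra_simps)
    have "norm (\<psi> \<theta> - of_real (exp (- (\<Sum>h\<in>H. (2 * pi * \<theta> * real h)^2 * var1 h) / 2))) \<le> \<delta>"
      unfolding \<psi>_def eq by (rule order_trans[OF norm_Ex_cis_gauss_le[OF order_refl] moments[OF True]])
    then have "\<bar>Re (\<psi> \<theta> - of_real (exp (- (\<Sum>h\<in>H. (2 * pi * \<theta> * real h)^2 * var1 h) / 2)))\<bar> \<le> \<delta>"
      using abs_Re_le_cmod order_trans by blast
    then have "Re (\<psi> \<theta>) \<ge> exp (- (\<Sum>h\<in>H. (2 * pi * \<theta> * real h)^2 * var1 h) / 2) - \<delta>" by simp
    moreover have "(\<Sum>h\<in>H. (2 * pi * \<theta> * real h)^2 * var1 h) / 2 = \<theta>^2 * (2 * pi^2 * (\<Sum>h\<in>H. (real h)^2 * var1 h))"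
      by (simp add: sum_distrib_left sum_divide_distrib power_mult_distrib mult_ac)
    moreover have "\<theta>^2 * (2 * pi^2 * (\<Sum>h\<in>H. (real h)^2 * var1 h)) \<le> \<theta>^2 * (C3 * s^2)"
      by (rule mult_left_mono[OF var]) simp
    ultimately have 1: "Re (\<psi> \<theta>) \<ge> exp (- C3 * (s * \<theta>)^2) - \<delta>"
      by (smt (verit) exp_le_cancel_iff minus_divide_left mult.commute mult_minus_left power_mult_distrib mult.left_commute)
    have "\<bar>s / A * \<theta>\<bar> \<le> 1" using True A s0 by (simp add: abs_mult field_simps)
    then have "(s / A * \<theta>)^2 \<le> 1" by (simp add: abs_square_le_1)
    then have "1 / (1 + (s / A * \<theta>)^2) \<ge> 1/2" by (simp add: field_simps add_pos_nonneg)
    then have "(2 * \<delta>) * (1 / (1 + (s / A * \<theta>)^2)) \<ge> (2 * \<delta>) * (1/2)" using \<delta> by (intro mult_left_mono) auto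
    moreover have "(2 * exp (- c * A^2 / 2)) * (1 / (1 + (sqrt (c/2) * s * \<theta>)^2)) \<ge> 0" by (simp add: add_nonneg_nonneg)
    ultimately show ?thesis using 1 g(2)[of \<theta>] unfolding L_def by linarith
  next
    case False
    then have "A < s * \<bar>\<theta>\<bar>" using s0 by (simp add: field_simps)
    then have "A^2 \<le> (s * \<bar>\<theta>\<bar>)^2" using A by (intro power_mono) auto
    then have sA: "A^2 \<le> (s * \<theta>)^2" by (simp add: power_mult_distrib)
    have cc: "(sqrt (c/2) * s * \<theta>)^2 = c / 2 * (s * \<theta>)^2"
      using c by (simp add: power_mult_distrib)
    have "exp (- c * (s * \<theta>)^2) = exp (- (c * (s * \<theta>)^2 / 2)) * exp (- (c / 2 * (s * \<theta>)^2))"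
      by (simp add: exp_add[symmetric])
    also have "\<dots> \<le> exp (- c * A^2 / 2) * (1 / (1 + c / 2 * (s * \<theta>)^2))"
    proof (rule mult_mono)
      show "exp (- (c * (s * \<theta>)^2 / 2)) \<le> exp (- c * A^2 / 2)" using sA c by simp
      show "exp (- (c / 2 * (s * \<theta>)^2)) \<le> 1 / (1 + c / 2 * (s * \<theta>)^2)"
        by (rule exp_minus_le_inverse) (use c in simp)
    qed auto
    finally have e: "exp (- c * (s * \<theta>)^2) \<le> exp (- c * A^2 / 2) * (1 / (1 + (sqrt (c/2) * s * \<theta>)^2))" unfolding cc .
    have "exp (- C3 * (s * \<theta>)^2) \<le> exp (- c * (s * \<theta>)^2)" using c by (simp add: mult_right_mono)
    moreover have "Re (\<psi> \<theta>) \<ge> - norm (\<psi> \<theta>)" using abs_Re_le_cmod[of "\<psi> \<theta>"] by linarith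
    moreover have "(2 * \<delta>) * (1 / (1 + (s / A * \<theta>)^2)) \<ge> 0" using \<delta> by (simp add: add_nonneg_nonneg)
    ultimately show ?thesis using e bound[OF that] unfolding L_def norm_\<psi> by linarith
  qed
  have cont: "continuous_on {-1/2..1/2} (\<lambda>\<theta>. 1 / (1 + (k * \<theta>)^2))" for k :: real
    by (intro continuous_intros) (auto simp: add_pos_nonneg less_imp_neq[symmetric])
  have int1: "(\<lambda>\<theta>. exp (- C3 * (s * \<theta>)^2)) integrable_on {a..b}" for a b
    by (intro integrable_continuous_real continuous_intros)
  have int2: "(\<lambda>\<theta>. 1 / (1 + (k * \<theta>)^2)) integrable_on {-1/2..1/2}" for k :: real
    by (rule integrable_continuous_real[OF cont])
  have int3: "g integrable_on {-1/2..1/2}"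
    by (rule integrable_continuous_real) (rule continuous_on_subset[OF g(1)], simp)
  have int2': "(\<lambda>\<theta>. r * (1 / (1 + (k * \<theta>)^2))) integrable_on {-1/2..1/2}" for k r :: real
    by (intro integrable_on_mult_right int2)
  have Lint: "L integrable_on {-1/2..1/2}"
    unfolding L_def by (intro integrable_diff int1 int2' int3)
  have "integral {-1/2..1/2} L = integral {-1/2..1/2} (\<lambda>\<theta>. exp (- C3 * (s * \<theta>)^2))
      - (2 * \<delta>) * integral {-1/2..1/2} (\<lambda>\<theta>. 1 / (1 + (s / A * \<theta>)^2))
      - (2 * exp (- c * A^2 / 2)) * integral {-1/2..1/2} (\<lambda>\<theta>. 1 / (1 + (sqrt (c/2) * s * \<theta>)^2))
      - integral {-1/2..1/2} g"
    unfolding L_def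
    by (subst integral_diff integral_diff[OF integrable_diff], (intro integrable_diff int1 int2' int3)+)+
       (simp only: integral_mult_right)
  \<comment> \<open>Only |\<theta>| \<le> 1 / s is used, where the integrand is at least exp (- C3);
    s \<ge> 2 keeps this range inside the interval.\<close>
  moreover have "2 * exp (- C3) / s \<le> integral {-1/2..1/2} (\<lambda>\<theta>. exp (- C3 * (s * \<theta>)^2))"
  proof -
    have C3: "C3 > 0" using c by simp
    have s1: "1 / s \<le> 1/2" using s by (simp add: field_simps)
    have "2 * exp (- C3) / s = integral {-1/s..1/s} (\<lambda>\<theta>. exp (- C3))" using s0 by simp
    also have "\<dots> \<le> integral {-1/s..1/s} (\<lambda>\<theta>. exp (- C3 * (s * \<theta>)^2))"
    proof (rule integral_le[OF _ int1])
      fix \<theta> :: real assume "\<theta> \<in> {-1/s..1/s}"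
      then have "\<bar>\<theta>\<bar> \<le> 1 / s" by auto
      then have "\<bar>s * \<theta>\<bar> \<le> 1" using s0 by (simp add: abs_mult field_simps)
      then have "(s * \<theta>)^2 \<le> 1" by (simp add: abs_square_le_1)
      then show "exp (- C3) \<le> exp (- C3 * (s * \<theta>)^2)" using C3 by (simp add: mult_le_cancel_left1)
    qed auto
    also have "\<dots> \<le> integral {-1/2..1/2} (\<lambda>\<theta>. exp (- C3 * (s * \<theta>)^2))"
      by (rule integral_subset_le[OF _ int1 int1]) (use s1 in auto)
    finally show ?thesis .
  qed
  moreover have "(2 * \<delta>) * integral {-1/2..1/2} (\<lambda>\<theta>. 1 / (1 + (s / A * \<theta>)^2)) \<le> (2 * \<delta>) * (pi / (s / A))"
    by (intro mult_left_mono integral_inverse_quadratic_le) (use s0 A \<delta> in auto)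
  moreover have "(2 * exp (- c * A^2 / 2)) * integral {-1/2..1/2} (\<lambda>\<theta>. 1 / (1 + (sqrt (c/2) * s * \<theta>)^2))
      \<le> (2 * exp (- c * A^2 / 2)) * (pi / (sqrt (c/2) * s))"
    by (intro mult_left_mono integral_inverse_quadratic_le) (use s0 c in auto)
  ultimately have "integral {-1/2..1/2} L \<ge> 2 * exp (- C3) / s - (2 * \<delta>) * (pi / (s / A))
      - (2 * exp (- c * A^2 / 2)) * (pi / (sqrt (c/2) * s)) - integral {-1/2..1/2} g" by linarith
  also have "2 * exp (- C3) / s - (2 * \<delta>) * (pi / (s / A)) - (2 * exp (- c * A^2 / 2)) * (pi / (sqrt (c/2) * s)) =
      (2 * exp (- C3) - 2 * pi * \<delta> * A - 2 * pi * exp (- c * A^2 / 2) / sqrt (c / 2)) / s"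
    by (simp add: diff_divide_distrib mult_ac)
  finally have "integral {-1/2..1/2} L \<ge> \<dots> - integral {-1/2..1/2} g" .
  moreover have "integral {-1/2..1/2} L \<le> p"
    by (rule has_integral_le[OF integrable_integral[OF Lint] Re_int]) (auto intro!: L_le simp: abs_le_iff)
  ultimately show ?thesis unfolding p_def by linarith
qed

end

section \<open>Tilted digits\<close>

definition tilt :: "nat \<Rightarrow> real \<Rightarrow> nat \<Rightarrow> real" where
  "tilt d t k = exp (- t * real k) / (\<Sum>j<d. exp (- t * real j))"

lemma tilt_normalizer_ge_1:
  assumes "d \<ge> 1" shows "(\<Sum>j<d. exp (- t * real j)) \<ge> 1"
  using member_le_sum[of 0 "{..<d}" "\<lambda>j. exp (- t * real j)"] assms by simp

lemma tilt_nonneg: "tilt d t k \<ge> 0"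
  unfolding tilt_def by (intro divide_nonneg_nonneg sum_nonneg) auto

lemma sum_tilt: "d \<ge> 1 \<Longrightarrow> (\<Sum>k<d. tilt d t k) = 1"
  unfolding tilt_def sum_divide_distrib[symmetric]
  using tilt_normalizer_ge_1[of d t] by simp

lemma digit_product_tilt:
  "d \<ge> 1 \<Longrightarrow> finite H \<Longrightarrow> digit_product d H (\<lambda>h. tilt d (r * real h))"
  by unfold_locales (auto simp: tilt_nonneg sum_tilt)

lemma tilt_le: "d \<ge> 1 \<Longrightarrow> tilt d t k \<le> exp (- t * real k)"
  unfolding tilt_def using tilt_normalizer_ge_1[of d t] by (simp add: divide_le_eq mult_le_cancel_left1)

lemma tilt_le_exp:
  assumes "d \<ge> 1" "t \<ge> 0" "k \<ge> 1" shows "tilt d t k \<le> exp (- t)"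
  by (rule order_trans[OF tilt_le[OF assms(1)]]) (use assms in \<open>simp add: mult_le_cancel_left1\<close>)

lemma tilt_ge:
  assumes "d \<ge> 1" "0 \<le> t" "t \<le> 1" "k \<le> 1" shows "tilt d t k \<ge> 1 / (3 * real d)"
proof -
  have "(\<Sum>j<d. exp (- t * real j)) \<le> (\<Sum>j<d. 1)" by (rule sum_mono) (use assms in auto)
  then have Z: "(\<Sum>j<d. exp (- t * real j)) \<le> real d" by simp
  have "1/3 \<le> exp (- 1 :: real)" using exp_le by (simp add: exp_minus field_simps)
  also have "t * real k \<le> 1 * 1" using assms by (intro mult_mono) auto
  then have "exp (- 1) \<le> exp (- t * real k)" by simp
  finally have "(1/3) / real d \<le> exp (- t * real k) / (\<Sum>j<d. exp (- t * real j))"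
    using Z tilt_normalizer_ge_1[OF assms(1), of t] by (intro frac_le) auto
  then show ?thesis by (simp add: tilt_def)
qed

text \<open>The squared modulus is exactly (u + v)^2 - 2 u v (1 - cos x), and u + v \<le> 1 allows
  completing this to the square of the right-hand side.\<close>

lemma norm_two_point_cis_le:
  fixes u v x :: real
  assumes "u \<ge> 0" "v \<ge> 0" "u + v \<le> 1"
  shows "norm (of_real u + of_real v * cis x) \<le> u + v - u * v * (1 - cos x)"
proof -
  have "(norm (of_real u + of_real v * cis x))^2 = (u + v * cos x)^2 + (v * sin x)^2"
    by (simp add: cmod_power2)
  also have "\<dots> = u^2 + 2 * u * v * cos x + v^2 * ((cos x)^2 + (sin x)^2)"
    by (simp only: power2_eq_square ring_distribs) (simp add: algebra_simps)
  also have "\<dots> = (u + v)^2 - 2 * (u * v * (1 - cos x))"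
    by (simp add: power2_eq_square algebra_simps)
  also have "\<dots> \<le> (u + v)^2 - 2 * (u + v) * (u * v * (1 - cos x)) + (u * v * (1 - cos x))^2"
  proof -
    have "(u + v) * (u * v * (1 - cos x)) \<le> 1 * (u * v * (1 - cos x))"
      using assms by (intro mult_right_mono) auto
    then show ?thesis using zero_le_power2[of "u * v * (1 - cos x)"] by linarith
  qed
  also have "\<dots> = (u + v - u * v * (1 - cos x))^2" by (simp add: power2_eq_square algebra_simps)
  finally have "(norm (of_real u + of_real v * cis x))^2 \<le> (u + v - u * v * (1 - cos x))^2" .
  moreover have "0 \<le> u + v - u * v * (1 - cos x)"
  proof -
    have "u * v * (1 - cos x) \<le> u * v * 2" using assms cos_ge_minus_one[of x] by (intro mult_left_mono) auto
    moreover have "u * v \<le> u * 1" "v * u \<le> v * 1" by (rule mult_left_mono; use assms in simp)+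
    ultimately show ?thesis by (simp add: mult.commute)
  qed
  ultimately show ?thesis by (rule power2_le_imp_le)
qed

text \<open>The digits 0 and 1 each retain mass at least 1 / (3 d) and supply all the decay that is
  used; the other digits are bounded by their total mass. The constant is the product of the two
  masses.\<close>

lemma norm_tilt_char_le:
  assumes d: "d \<ge> 2" and t: "0 \<le> t" "t \<le> 1"
  shows "norm (\<Sum>k<d. tilt d t k *\<^sub>R cis (x * real k)) \<le> exp (- (1 / (9 * real d ^ 2)) * (1 - cos x))"
proof -
  have d1: "d \<ge> 1" using d by simp
  let ?u = "tilt d t 0" and ?v = "tilt d t 1"
  have split: "{..<d} = {0, 1} \<union> {2..<d}" using d by auto
  have rest: "(\<Sum>k<d. f k) = f 0 + f 1 + (\<Sum>k\<in>{2..<d}. f k)" for f :: "nat \<Rightarrow> 'c::comm_monoid_add"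
    unfolding split by (subst sum.union_disjoint) auto
  have r: "(\<Sum>k\<in>{2..<d}. tilt d t k) = 1 - ?u - ?v"
    using rest[of "tilt d t"] sum_tilt[OF d1, of t] by simp
  then have uv: "?u + ?v \<le> 1" using sum_nonneg[of "{2..<d}" "tilt d t"] tilt_nonneg by simp
  have "norm (\<Sum>k<d. tilt d t k *\<^sub>R cis (x * real k)) \<le> norm (of_real ?u + of_real ?v * cis x) +
      norm (\<Sum>k\<in>{2..<d}. tilt d t k *\<^sub>R cis (x * real k))"
    unfolding rest by (rule order_trans[OF norm_triangle_ineq]) (simp add: scaleR_conv_of_real)
  also have "norm (\<Sum>k\<in>{2..<d}. tilt d t k *\<^sub>R cis (x * real k)) \<le> 1 - ?u - ?v"
    unfolding r[symmetric] by (rule order_trans[OF norm_sum]) (simp add: tilt_nonneg)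
  also have "norm (of_real ?u + of_real ?v * cis x) \<le> ?u + ?v - ?u * ?v * (1 - cos x)"
    by (rule norm_two_point_cis_le) (use tilt_nonneg uv in auto)
  finally have "norm (\<Sum>k<d. tilt d t k *\<^sub>R cis (x * real k)) \<le> 1 + (- (?u * ?v * (1 - cos x)))" by simp
  also have "\<dots> \<le> exp (- (?u * ?v * (1 - cos x)))" by (rule exp_ge_add_one_self)
  also have "\<dots> \<le> exp (- (1 / (9 * real d ^ 2)) * (1 - cos x))"
  proof -
    have "1 / (3 * real d) * (1 / (3 * real d)) \<le> ?u * ?v"
      by (rule mult_mono) (use tilt_ge[OF d1 t] tilt_nonneg in auto)
    then have "1 / (9 * real d ^ 2) \<le> ?u * ?v" by (simp add: power2_eq_square)
    then have "1 / (9 * real d ^ 2) * (1 - cos x) \<le> ?u * ?v * (1 - cos x)" by (rule mult_right_mono) simp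
    then show ?thesis by simp
  qed
  finally show ?thesis .
qed

text \<open>The condition \<open>f 0 = 0\<close> removes the only digit that remains likely for
  large \<open>t\<close>; hence moments of the digit at \<open>h\<close> decay like exp (- r
  h).\<close>

lemma sum_tilt_le:
  fixes f :: "nat \<Rightarrow> real"
  assumes d: "d \<ge> 1" and t: "t \<ge> 0" and f: "f 0 = 0" "\<And>k. k < d \<Longrightarrow> 0 \<le> f k" "\<And>k. k < d \<Longrightarrow> f k \<le> B"
  shows "(\<Sum>k<d. tilt d t k * f k) \<le> real d * B * exp (- t)"
proof -
  have B: "B \<ge> 0" using f(1) f(3)[of 0] d by simp
  have "(\<Sum>k<d. tilt d t k * f k) \<le> (\<Sum>k<d. exp (- t) * B)"
  proof (rule sum_mono)
    fix k assume k: "k \<in> {..<d}"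
    show "tilt d t k * f k \<le> exp (- t) * B"
    proof (cases "k = 0")
      case True then show ?thesis using f B by simp
    next
      case False
      then show ?thesis using k f B tilt_le_exp[OF d t, of k] tilt_nonneg by (intro mult_mono) auto
    qed
  qed
  then show ?thesis by (simp add: mult_ac)
qed

text \<open>To first order in \<open>t\<close> the tilt is invisible: digits far below the scale 1 /
  r are nearly uniform, which is where the constants (d - 1) / 2 and (d^2 - 1) / 12 come
  from.\<close>

lemma abs_sum_tilt_diff_le:
  fixes f :: "nat \<Rightarrow> real"
  assumes d: "d \<ge> 1" and t: "t \<ge> 0" and f: "\<And>k. k < d \<Longrightarrow> \<bar>f k\<bar> \<le> B"
  shows "\<bar>(\<Sum>k<d. tilt d t k * f k) - (\<Sum>k<d. f k) / real d\<bar> \<le> t * real d ^ 2 * B"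
proof -
  let ?Z = "\<Sum>j<d. exp (- t * real j)"
  have Z: "?Z \<ge> 1" by (rule tilt_normalizer_ge_1[OF d])
  have w: "\<bar>tilt d t k - 1 / real d\<bar> \<le> t * real d" if k: "k < d" for k
  proof -
    have e: "1 - t * real d \<le> exp (- t * real j) \<and> exp (- t * real j) \<le> 1" if "j < d" for j
    proof -
      have "1 - t * real d \<le> 1 + (- t * real j)" using that t by (simp add: mult_left_mono)
      also have "\<dots> \<le> exp (- t * real j)" by (rule exp_ge_add_one_self)
      finally show ?thesis using t by simp
    qed
    have "real d * exp (- t * real k) - ?Z = (\<Sum>j<d. exp (- t * real k) - exp (- t * real j))"
      by (simp add: sum_subtractf)
    also have "\<bar>\<dots>\<bar> \<le> (\<Sum>j<d. t * real d)"
    proof (rule order_trans[OF sum_abs], rule sum_mono)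
      fix j assume "j \<in> {..<d}"
      then show "\<bar>exp (- t * real k) - exp (- t * real j)\<bar> \<le> t * real d"
        using e[OF k] e[of j] unfolding lessThan_iff by linarith
    qed
    finally have 1: "\<bar>real d * exp (- t * real k) - ?Z\<bar> \<le> real d * (t * real d)" by simp
    have "tilt d t k - 1 / real d = (real d * exp (- t * real k) - ?Z) / (real d * ?Z)"
      using d Z unfolding tilt_def by (simp add: field_simps)
    then have "\<bar>tilt d t k - 1 / real d\<bar> = \<bar>real d * exp (- t * real k) - ?Z\<bar> / (real d * ?Z)"
      using d Z by (simp add: abs_mult)
    also have "\<dots> \<le> real d * (t * real d) / (real d * 1)"
      by (rule frac_le) (use 1 d Z t in auto)
    finally show ?thesis using d by simp
  qed
  have B: "B \<ge> 0" using f[of 0] d by simp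
  have "(\<Sum>k<d. tilt d t k * f k) - (\<Sum>k<d. f k) / real d = (\<Sum>k<d. (tilt d t k - 1 / real d) * f k)"
    by (simp add: left_diff_distrib sum_subtractf sum_divide_distrib)
  also have "\<bar>\<dots>\<bar> \<le> (\<Sum>k<d. (t * real d) * B)"
    by (rule order_trans[OF sum_abs]) (rule sum_mono, use w f t B in \<open>auto simp: abs_mult intro!: mult_mono\<close>)
  finally show ?thesis by (simp add: power2_eq_square mult_ac)
qed

lemma sum_real_lessThan: "(\<Sum>k<d. real k) = real d * (real d - 1) / 2"
  by (induction d) (auto simp: field_simps)

lemma sum_real_square_lessThan: "(\<Sum>k<d. (real k)^2) = real d * (real d - 1) * (2 * real d - 1) / 6"
  by (induction d) (auto simp: field_simps power2_eq_square)

locale tilted_product =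
  fixes d :: nat and H :: "nat set" and r :: real
  assumes d2: "d \<ge> 2" and finH: "finite H" and r_nonneg: "r \<ge> 0"
begin

sublocale digit_product d H "\<lambda>h. tilt d (r * real h)"
  by (rule digit_product_tilt) (use d2 finH in auto)

lemma char_decay_tilt:
  assumes "\<And>h. h \<in> Q \<Longrightarrow> r * real h \<le> 1"
  shows "char_decay (1 / (9 * real d ^ 2)) Q"
  unfolding char_decay_def Ex1_def using norm_tilt_char_le[OF d2, of "r * real _"] assms r_nonneg by simp

lemma mu_nonneg: "mu h \<ge> 0"
  unfolding mu_def Ex1_def by (auto intro!: sum_nonneg simp: tilt_nonneg)

lemma mu_le_d: "mu h \<le> real d"
  using Ex1_mono[of real "\<lambda>_. real d" h] by (simp add: mu_def Ex1_const)

lemma mu_le: "mu h \<le> real d ^ 2 * exp (- (r * real h))"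
  using sum_tilt_le[of d "r * real h" real "real d"] d2 r_nonneg
  by (simp add: mu_def Ex1_def power2_eq_square)

lemma mu_ge:
  assumes "r * real h \<le> 1" shows "mu h \<ge> 1 / (3 * real d)"
proof -
  have "1 / (3 * real d) \<le> tilt d (r * real h) 1 * real 1"
    using tilt_ge[of d "r * real h" 1] d2 r_nonneg assms by simp
  also have "\<dots> \<le> mu h" unfolding mu_def Ex1_def
    using member_le_sum[of 1 "{..<d}" "\<lambda>k. tilt d (r * real h) k * real k"] d2 by (auto simp: tilt_nonneg)
  finally show ?thesis .
qed

lemma abs_centered_le: "k < d \<Longrightarrow> \<bar>real k - mu h\<bar> \<le> real d"
  using mu_nonneg[of h] mu_le_d[of h] by (auto simp: abs_le_iff)

lemma var1_nonneg: "var1 h \<ge> 0"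
  unfolding var1_def Ex1_def by (auto intro!: sum_nonneg simp: tilt_nonneg)

lemma var1_eq: "var1 h = Ex1 h (\<lambda>k. (real k)^2) - (mu h)^2"
proof -
  have "(real k - mu h)^2 = (real k)^2 - (2 * mu h) * real k + (mu h)^2" for k
    by (simp add: power2_eq_square algebra_simps)
  then have "var1 h = Ex1 h (\<lambda>k. (real k)^2) - (2 * mu h) * mu h + (mu h)^2"
    unfolding var1_def by (simp only: Ex1_add Ex1_diff Ex1_cmult Ex1_const mu_def[symmetric])
  then show ?thesis by (simp add: power2_eq_square)
qed

lemma var1_le: "var1 h \<le> real d ^ 3 * exp (- (r * real h))"
proof -
  have "Ex1 h (\<lambda>k. (real k)^2) \<le> real d * real d ^ 2 * exp (- (r * real h))"
    unfolding Ex1_def real_scaleR_def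
    by (rule sum_tilt_le) (use d2 r_nonneg in \<open>auto intro!: power_mono\<close>)
  moreover have "real d * real d ^ 2 = real d ^ 3" by (simp add: power3_eq_cube power2_eq_square)
  ultimately have "Ex1 h (\<lambda>k. (real k)^2) \<le> real d ^ 3 * exp (- (r * real h))" by simp
  then show ?thesis unfolding var1_eq using zero_le_power2[of "mu h"] by linarith
qed

lemma var1_le_d: "var1 h \<le> real d ^ 2"
proof -
  have "var1 h \<le> Ex1 h (\<lambda>_. real d ^ 2)" unfolding var1_def
    by (rule Ex1_mono) (use abs_centered_le in \<open>auto simp: abs_le_square_iff[symmetric]\<close>)
  then show ?thesis by (simp add: Ex1_const)
qed

lemma var1_square_le: "(var1 h)^2 \<le> real d ^ 5 * exp (- (r * real h))"
proof -
  have "var1 h * var1 h \<le> real d ^ 2 * (real d ^ 3 * exp (- (r * real h)))"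
    by (rule mult_mono) (use var1_le var1_le_d var1_nonneg in auto)
  then show ?thesis by (simp add: power2_eq_square eval_nat_numeral mult_ac)
qed

lemma third_moment_le: "Ex1 h (\<lambda>k. \<bar>real k - mu h\<bar>^3) \<le> real d * var1 h"
proof -
  have "Ex1 h (\<lambda>k. \<bar>real k - mu h\<bar>^3) \<le> Ex1 h (\<lambda>k. real d * (real k - mu h)^2)"
  proof (rule Ex1_mono)
    fix k assume "k < d"
    have "\<bar>real k - mu h\<bar>^3 = \<bar>real k - mu h\<bar> * (real k - mu h)^2"
      by (simp add: power3_eq_cube power2_eq_square abs_mult_self_eq mult.assoc)
    also have "\<dots> \<le> real d * (real k - mu h)^2"
      by (rule mult_right_mono) (use abs_centered_le \<open>k < d\<close> in auto)
    finally show "\<bar>real k - mu h\<bar>^3 \<le> real d * (real k - mu h)^2" .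
  qed
  then show ?thesis by (simp only: Ex1_cmult var1_def)
qed

lemma mu_approx: "\<bar>mu h - (real d - 1) / 2\<bar> \<le> r * real h * real d ^ 3"
  using abs_sum_tilt_diff_le[of d "r * real h" real "real d"] d2 r_nonneg
  by (simp add: mu_def Ex1_def sum_real_lessThan power2_eq_square power3_eq_cube mult_ac)

text \<open>The factor 3 consists of 1 from the second moment and 2 from the square of the
  mean.\<close>

lemma var1_approx: "\<bar>var1 h - (real d - 1) * (real d + 1) / 12\<bar> \<le> 3 * (r * real h) * real d ^ 4"
proof -
  have "\<bar>Ex1 h (\<lambda>k. (real k)^2) - (real d - 1) * (2 * real d - 1) / 6\<bar> \<le> (r * real h) * real d ^ 2 * (real d ^ 2)"
  proof -
    have "(\<Sum>k<d. (real k)^2) / real d = (real d - 1) * (2 * real d - 1) / 6"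
      using d2 by (simp add: sum_real_square_lessThan)
    moreover have "\<bar>(\<Sum>k<d. tilt d (r * real h) k * (real k)^2) - (\<Sum>k<d. (real k)^2) / real d\<bar>
        \<le> (r * real h) * real d ^ 2 * (real d ^ 2)"
      by (rule abs_sum_tilt_diff_le) (use d2 r_nonneg in \<open>auto intro!: power_mono\<close>)
    ultimately show ?thesis by (simp only: Ex1_def real_scaleR_def)
  qed
  moreover have "\<bar>(mu h)^2 - ((real d - 1) / 2)^2\<bar> \<le> (r * real h * real d ^ 3) * (2 * real d)"
  proof -
    have "(mu h)^2 - ((real d - 1) / 2)^2 = (mu h - (real d - 1) / 2) * (mu h + (real d - 1) / 2)"
      by (simp add: power2_eq_square algebra_simps)
    moreover have "\<bar>mu h + (real d - 1) / 2\<bar> \<le> 2 * real d"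
      using mu_nonneg[of h] mu_le_d[of h] d2 by (simp add: field_simps)
    ultimately show ?thesis
      using mu_approx[of h] r_nonneg by (auto simp: abs_mult intro!: mult_mono)
  qed
  moreover have "(real d - 1) * (2 * real d - 1) / 6 - ((real d - 1) / 2)^2 = (real d - 1) * (real d + 1) / 12"
    by (simp add: power2_eq_square field_simps)
  moreover have "(r * real h) * real d ^ 2 * (real d ^ 2) = (r * real h) * real d ^ 4"
      "(r * real h * real d ^ 3) * (2 * real d) = 2 * ((r * real h) * real d ^ 4)"
      "3 * (r * real h) * real d ^ 4 = 3 * ((r * real h) * real d ^ 4)"
    by (simp_all add: eval_nat_numeral)
  ultimately show ?thesis unfolding var1_eq by linarith
qed

end

section \<open>Counting lattice points in a simplex\<close>

text \<open>The two sides of the mean value theorem for powers, used as a discrete substitute for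
  integration when a simplex is sliced.\<close>

lemma power_diff_le_mult:
  fixes u v :: real
  assumes "0 \<le> v" "v \<le> u"
  shows "u ^ Suc m - v ^ Suc m \<le> real (Suc m) * (u - v) * u ^ m"
    and "real (Suc m) * (u - v) * v ^ m \<le> u ^ Suc m - v ^ Suc m"
proof (induction m)
  case (Suc m)
  {
    case 1
    have "u ^ Suc (Suc m) - v ^ Suc (Suc m) = u * (u ^ Suc m - v ^ Suc m) + (u - v) * v ^ Suc m"
      by (simp add: algebra_simps)
    also have "\<dots> \<le> u * (real (Suc m) * (u - v) * u ^ m) + (u - v) * u ^ Suc m"
      using Suc(1) assms by (intro add_mono mult_left_mono power_mono) auto
    finally show ?case by (simp add: algebra_simps)
  next
    case 2
    have "real (Suc (Suc m)) * (u - v) * v ^ Suc m = v * (real (Suc m) * (u - v) * v ^ m) + (u - v) * v ^ Suc m"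
      by (simp add: algebra_simps)
    also have "\<dots> \<le> v * (u ^ Suc m - v ^ Suc m) + (u - v) * u ^ Suc m"
      using Suc(2) assms by (intro add_mono mult_left_mono power_mono) auto
    also have "\<dots> = u ^ Suc (Suc m) - v ^ Suc (Suc m)" by (simp add: algebra_simps)
    finally show ?case .
  }
qed auto

definition simplex_points :: "(nat \<Rightarrow> real) \<Rightarrow> nat \<Rightarrow> real \<Rightarrow> (nat \<Rightarrow> nat) set" where
  "simplex_points w m y = {\<alpha>. (\<forall>i\<ge>m. \<alpha> i = 0) \<and> (\<Sum>i<m. real (\<alpha> i) * w i) \<le> y}"

lemma simplex_points_0: "y \<ge> 0 \<Longrightarrow> simplex_points w 0 y = {\<lambda>_. 0}"
  by (auto simp: simplex_points_def)

lemma simplex_points_Suc: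
  assumes w: "w m > 0" "\<And>i. i < m \<Longrightarrow> w i > 0"
  shows "simplex_points w (Suc m) y =
    (\<Union>k\<in>{k. real k * w m \<le> y}. (\<lambda>\<alpha>. \<alpha>(m := k)) ` simplex_points w m (y - real k * w m))"
proof (intro equalityI subsetI)
  fix \<alpha> assume \<alpha>: "\<alpha> \<in> simplex_points w (Suc m) y"
  have sum: "(\<Sum>i<m. real ((\<alpha>(m := 0)) i) * w i) = (\<Sum>i<m. real (\<alpha> i) * w i)"
    by (intro sum.cong) auto
  have nn: "(\<Sum>i<m. real (\<alpha> i) * w i) \<ge> 0"
    using w(2) by (intro sum_nonneg mult_nonneg_nonneg) (auto dest: less_imp_le)
  have "\<alpha>(m := 0) \<in> simplex_points w m (y - real (\<alpha> m) * w m)"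
    using \<alpha> sum unfolding simplex_points_def by (auto simp: le_less_Suc_eq Suc_le_eq)
  moreover have "\<alpha> = (\<alpha>(m := 0))(m := \<alpha> m)" by simp
  moreover have "real (\<alpha> m) * w m \<le> y" using \<alpha> nn by (simp add: simplex_points_def)
  ultimately show "\<alpha> \<in> (\<Union>k\<in>{k. real k * w m \<le> y}. (\<lambda>\<alpha>. \<alpha>(m := k)) ` simplex_points w m (y - real k * w m))"
    by blast
next
  fix \<beta> assume "\<beta> \<in> (\<Union>k\<in>{k. real k * w m \<le> y}. (\<lambda>\<alpha>. \<alpha>(m := k)) ` simplex_points w m (y - real k * w m))"
  then obtain k \<alpha> where k: "\<beta> = \<alpha>(m := k)" "\<alpha> \<in> simplex_points w m (y - real k * w m)" by blast
  have "(\<Sum>i<m. real (\<beta> i) * w i) = (\<Sum>i<m. real (\<alpha> i) * w i)"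
    unfolding k(1) by (intro sum.cong) auto
  then show "\<beta> \<in> simplex_points w (Suc m) y" using k by (auto simp: simplex_points_def)
qed

text \<open>Slicing by the last coordinate gives a simplex of lower dimension for each of its
  values, and telescoping (m + 1)-st powers replaces the integral over the slices. The lower bound
  is the volume; the upper bound is the volume after enlarging \<open>y\<close> by the sum of the
  weights.\<close>

lemma card_simplex_points:
  assumes "\<And>i. i < m \<Longrightarrow> w i > 0" "y \<ge> 0"
  shows "finite (simplex_points w m y)
    \<and> y ^ m / (fact m * (\<Prod>i<m. w i)) \<le> real (card (simplex_points w m y))
    \<and> real (card (simplex_points w m y)) \<le> (y + (\<Sum>i<m. w i)) ^ m / (fact m * (\<Prod>i<m. w i))"
  using assms
proof (induction m arbitrary: y)
  case 0
  then show ?case by (simp add: simplex_points_0)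
next
  case (Suc m)
  define v where "v = w m"
  have v: "v > 0" using Suc.prems by (simp add: v_def)
  define K where "K = nat \<lfloor>y / v\<rfloor>"
  define W where "W = (\<Sum>i<m. w i)"
  define c where "c = fact m * (\<Prod>i<m. w i)"
  have W: "W \<ge> 0" unfolding W_def by (rule sum_nonneg) (use Suc.prems in \<open>auto intro: less_imp_le\<close>)
  have c: "c > 0" unfolding c_def by (intro mult_pos_pos prod_pos) (use Suc.prems in auto)
  have K_iff: "real k * v \<le> y \<longleftrightarrow> k \<le> K" for k
  proof -
    have "real k * v \<le> y \<longleftrightarrow> real k \<le> y / v" using v by (simp add: field_simps)
    also have "\<dots> \<longleftrightarrow> k \<le> K" unfolding K_def using Suc.prems(2) v by (simp add: le_nat_floor le_nat_iff le_floor_iff)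
    finally show ?thesis .
  qed
  have set: "simplex_points w (Suc m) y =
      (\<Union>k\<in>{..K}. (\<lambda>\<alpha>. \<alpha>(m := k)) ` simplex_points w m (y - real k * v))"
    unfolding v_def by (subst simplex_points_Suc) (use Suc.prems K_iff in \<open>auto simp: v_def\<close>)
  have nn: "y - real k * v \<ge> 0" if "k \<le> K" for k using K_iff that by simp
  have IH: "finite (simplex_points w m (y - real k * v))"
      "(y - real k * v) ^ m / c \<le> real (card (simplex_points w m (y - real k * v)))"
      "real (card (simplex_points w m (y - real k * v))) \<le> (y - real k * v + W) ^ m / c" if "k \<le> K" for k
    using Suc.IH[OF _ nn[OF that]] Suc.prems(1) unfolding W_def c_def by auto
  have "card (simplex_points w (Suc m) y) = (\<Sum>k\<le>K. card ((\<lambda>\<alpha>. \<alpha>(m := k)) ` simplex_points w m (y - real k * v)))"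
    unfolding set
  proof (rule card_UN_disjoint)
    have "\<alpha>(m := k) \<noteq> \<beta>(m := j)" if "k \<noteq> j" for k j and \<alpha> \<beta> :: "nat \<Rightarrow> nat"
      using that by (metis fun_upd_same)
    then show "\<forall>k\<in>{..K}. \<forall>j\<in>{..K}. k \<noteq> j \<longrightarrow> (\<lambda>\<alpha>. \<alpha>(m := k)) ` simplex_points w m (y - real k * v) \<inter>
        (\<lambda>\<alpha>. \<alpha>(m := j)) ` simplex_points w m (y - real j * v) = {}" by blast
  qed (use IH(1) in auto)
  also have "\<dots> = (\<Sum>k\<le>K. card (simplex_points w m (y - real k * v)))"
  proof (intro sum.cong refl card_image inj_onI)
    fix k \<alpha> \<beta> assume "\<alpha> \<in> simplex_points w m (y - real k * v)" "\<beta> \<in> simplex_points w m (y - real k * v)"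
      and eq: "\<alpha>(m := k) = \<beta>(m := k)"
    then have "\<alpha> m = \<beta> m" by (simp add: simplex_points_def)
    then show "\<alpha> = \<beta>" using eq by (metis fun_upd_triv fun_upd_upd)
  qed
  finally have card: "real (card (simplex_points w (Suc m) y)) = (\<Sum>k\<le>K. real (card (simplex_points w m (y - real k * v))))"
    by simp
  have cs: "fact (Suc m) * (\<Prod>i<Suc m. w i) = real (Suc m) * v * c" by (simp add: c_def v_def)
  have pos: "real (Suc m) * v * c > 0" using v c by simp
  have "y ^ Suc m / (real (Suc m) * v * c) \<le> real (card (simplex_points w (Suc m) y))"
  proof -
    \<comment> \<open>Cutting off at 0 makes the telescope end in 0 although y - (K + 1) v is
      negative.\<close>
    define g where "g k = (max (y - real k * v) 0) ^ Suc m" for k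
    have step: "g k - g (Suc k) \<le> real (Suc m) * v * (y - real k * v) ^ m" if "k \<le> K" for k
    proof -
      let ?u = "y - real k * v" and ?z = "max (y - real (Suc k) * v) 0"
      have u: "?u \<ge> 0" using nn that by simp
      have z: "0 \<le> ?z" "?z \<le> ?u" "?u - ?z \<le> v" using u v by (auto simp: algebra_simps)
      have "g k - g (Suc k) = ?u ^ Suc m - ?z ^ Suc m" using u by (simp add: g_def max_absorb1)
      also have "\<dots> \<le> real (Suc m) * (?u - ?z) * ?u ^ m" by (rule power_diff_le_mult) (use z in auto)
      also have "\<dots> \<le> real (Suc m) * v * ?u ^ m" by (intro mult_right_mono mult_left_mono) (use z u in auto)
      finally show ?thesis .
    qed
    have "\<not> real (Suc K) * v \<le> y" using K_iff[of "Suc K"] by simp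
    then have gK: "g (Suc K) = 0" by (simp add: g_def)
    have "y ^ Suc m = g 0 - g (Suc K)" using Suc.prems(2) gK by (simp add: g_def)
    also have "\<dots> = (\<Sum>k\<le>K. g k - g (Suc k))" by (rule sum_telescope[symmetric])
    also have "\<dots> \<le> (\<Sum>k\<le>K. (real (Suc m) * v * c) * real (card (simplex_points w m (y - real k * v))))"
    proof (rule sum_mono)
      fix k assume k: "k \<in> {..K}"
      have "(y - real k * v) ^ m \<le> c * real (card (simplex_points w m (y - real k * v)))"
        using IH(2)[of k] k c by (simp add: field_simps)
      then have "real (Suc m) * v * (y - real k * v) ^ m \<le> real (Suc m) * v * (c * real (card (simplex_points w m (y - real k * v))))"
        using v by (intro mult_left_mono) auto
      then show "g k - g (Suc k) \<le> (real (Suc m) * v * c) * real (card (simplex_points w m (y - real k * v)))"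
        using step[of k] k unfolding mult.assoc atMost_iff by linarith
    qed
    also have "\<dots> = (real (Suc m) * v * c) * real (card (simplex_points w (Suc m) y))"
      unfolding card by (rule sum_distrib_left[symmetric])
    finally show ?thesis using pos by (simp add: divide_le_eq mult.commute)
  qed
  moreover have "real (card (simplex_points w (Suc m) y)) \<le> (y + (W + v)) ^ Suc m / (real (Suc m) * v * c)"
  proof -
    \<comment> \<open>The shift \<open>W\<close> comes from the lower dimension, the extra
      \<open>v\<close> from using the lower mean value bound on a step of length
      \<open>v\<close>.\<close>
    define g where "g k = (y - real k * v + W + v) ^ Suc m" for k
    have "(real (Suc m) * v * c) * real (card (simplex_points w (Suc m) y)) =
        (\<Sum>k\<le>K. (real (Suc m) * v * c) * real (card (simplex_points w m (y - real k * v))))"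
      unfolding card by (rule sum_distrib_left)
    also have "\<dots> \<le> (\<Sum>k\<le>K. g k - g (Suc k))"
    proof (rule sum_mono)
      fix k assume k: "k \<in> {..K}"
      let ?z = "y - real k * v + W"
      have z: "?z \<ge> 0" using nn[of k] k W by simp
      have "c * real (card (simplex_points w m (y - real k * v))) \<le> ?z ^ m"
        using IH(3)[of k] k c by (simp add: field_simps)
      then have "real (Suc m) * v * (c * real (card (simplex_points w m (y - real k * v)))) \<le> real (Suc m) * v * ?z ^ m"
        using v by (intro mult_left_mono) auto
      also have "\<dots> \<le> (?z + v) ^ Suc m - ?z ^ Suc m"
        using power_diff_le_mult(2)[of ?z "?z + v" m] z v by simp
      also have "\<dots> = g k - g (Suc k)" by (simp add: g_def algebra_simps)
      finally show "(real (Suc m) * v * c) * real (card (simplex_points w m (y - real k * v))) \<le> g k - g (Suc k)"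
        by (simp add: mult.assoc)
    qed
    also have "\<dots> = g 0 - g (Suc K)" by (rule sum_telescope)
    also have "\<dots> \<le> g 0"
    proof -
      have "y - real (Suc K) * v + W + v \<ge> 0" using nn[of K] W by (simp add: algebra_simps)
      then show ?thesis unfolding g_def by (simp only: zero_le_power diff_le_eq le_add_same_cancel1)
    qed
    finally show ?thesis using pos by (simp add: le_divide_eq g_def mult.commute algebra_simps)
  qed
  moreover have "finite (simplex_points w (Suc m) y)" unfolding set using IH(1) by auto
  ultimately show ?case unfolding cs by (simp add: W_def v_def)
qed

text \<open>Along a progression with ratio at least 2 the tent min x (1 / x) rises geometrically up
  to 1 and then falls geometrically, so that its sum is bounded independently of length and starting
  point.\<close>

lemma sum_tent_geometric_le:
  fixes y b :: real
  assumes "y > 0" "b \<ge> 2"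
  shows "(\<Sum>k<K. min (y * b ^ k) (1 / (y * b ^ k))) \<le> 4"
proof -
  have big: "(\<Sum>k<K. min (y * b ^ k) (1 / (y * b ^ k))) \<le> 2" if "y \<ge> 1" for K and y :: real
  proof -
    have "(\<Sum>k<K. min (y * b ^ k) (1 / (y * b ^ k))) \<le> (\<Sum>k<K. (1/2) ^ k)"
    proof (rule sum_mono)
      fix k
      have "1 * 2 ^ k \<le> y * b ^ k" using that assms by (intro mult_mono power_mono) auto
      then have "1 / (y * b ^ k) \<le> 1 / (1 * 2 ^ k)" using that assms by (intro divide_left_mono) auto
      then show "min (y * b ^ k) (1 / (y * b ^ k)) \<le> (1/2) ^ k" by (simp add: power_divide min.coboundedI2)
    qed
    also have "\<dots> \<le> 2" by (subst geometric_sum) (auto simp: field_simps)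
    finally show ?thesis .
  qed
  \<comment> \<open>The term - y is what the induction needs: the first summand is at most y and the
    next starting point is at least 2 y. Once that point exceeds 1, the bound 2 \<le> 4 - 2 y takes
    over.\<close>
  have small: "(\<Sum>k<K. min (y * b ^ k) (1 / (y * b ^ k))) \<le> 4 - y" if "0 < y" "y \<le> 1" for y
    using that
  proof (induction K arbitrary: y)
    case (Suc K)
    have "(\<Sum>k<Suc K. min (y * b ^ k) (1 / (y * b ^ k))) =
        min y (1 / y) + (\<Sum>k<K. min ((y * b) * b ^ k) (1 / ((y * b) * b ^ k)))"
      by (simp add: sum.lessThan_Suc_shift mult.assoc del: sum.lessThan_Suc)
    also have "\<dots> \<le> y + (4 - 2 * y)"
    proof (rule add_mono)
      have "y * 2 \<le> y * b" using Suc.prems assms by (intro mult_left_mono) auto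
      moreover have "0 < y * b" using Suc.prems assms by simp
      ultimately show "(\<Sum>k<K. min ((y * b) * b ^ k) (1 / ((y * b) * b ^ k))) \<le> 4 - 2 * y"
        using Suc.IH[of "y * b"] big[of "y * b" K] Suc.prems by linarith
    qed simp
    finally show ?case by simp
  qed simp
  show ?thesis using small[of y] big[of y K] assms by linarith
qed

text \<open>Brings exponential moments into the form that can be summed along progressions: q \<ge>
  1 gives the decay at 0, the exponential gives the decay at infinity.\<close>

lemma power_times_exp_le_tent:
  fixes x :: real
  assumes "x > 0" "q \<ge> 1"
  shows "x ^ q * exp (- x) \<le> fact (Suc q) * min x (1 / x)"
proof -
  have e: "x ^ j * exp (- x) \<le> fact j" for j
  proof -
    have "x ^ j / fact j \<le> exp x"
      using sum_le_suminf[OF sums_summable[OF exp_converges[of x]], of "{j}"] assms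
      unfolding sums_unique[OF exp_converges, symmetric] by (simp add: field_simps)
    then show ?thesis by (simp add: exp_minus field_simps)
  qed
  obtain q' where q: "q = Suc q'" using assms by (cases q) auto
  have "x ^ q * exp (- x) = x * (x ^ q' * exp (- x))" by (simp add: q)
  also have "\<dots> \<le> x * fact q'" using e assms by (intro mult_left_mono) auto
  also have "\<dots> \<le> x * fact (Suc q)" using assms by (intro mult_left_mono fact_mono) (auto simp: q)
  finally have 1: "x ^ q * exp (- x) \<le> fact (Suc q) * x" by (simp add: mult.commute)
  have "x ^ q * exp (- x) = (x ^ Suc q * exp (- x)) / x" using assms by simp
  also have "\<dots> \<le> fact (Suc q) / x" by (rule divide_right_mono[OF e]) (use assms in simp)
  finally show ?thesis using 1 by (simp add: min_def)
qed

section \<open>The multi-base set\<close>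

locale multi_base =
  fixes d m :: nat and p :: "nat \<Rightarrow> nat"
  assumes d2: "d \<ge> 2" and m2: "m \<ge> 2" and p0: "1 < p 0"
    and p_mono: "\<And>i j. i < j \<Longrightarrow> j < m \<Longrightarrow> p i < p j"
    and p_coprime: "\<And>i j. i < m \<Longrightarrow> j < m \<Longrightarrow> i \<noteq> j \<Longrightarrow> coprime (p i) (p j)"
begin

lemma p_ge2: "i < m \<Longrightarrow> p i \<ge> 2"
  using p0 p_mono[of 0 i] by (cases "i = 0") auto

lemma p_pos: "i < m \<Longrightarrow> p i > 0"
  using p_ge2[of i] by simp

definition val :: "(nat \<Rightarrow> nat) \<Rightarrow> nat" where "val \<alpha> = (\<Prod>i<m. p i ^ \<alpha> i)"

lemma val_pos: "val \<alpha> > 0"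
  unfolding val_def by (rule prod_pos) (use p_pos in auto)

lemma val_inject: assumes "val \<alpha> = val \<beta>" "i < m" shows "\<alpha> i = \<beta> i"
proof -
  have le: "\<alpha> i \<le> \<beta> i" if "val \<alpha> = val \<beta>" for \<alpha> \<beta>
  proof -
    have "p i ^ \<alpha> i dvd val \<alpha>" unfolding val_def
      using assms(2) by (intro dvd_prodI) auto
    then have "p i ^ \<alpha> i dvd val \<beta>" using that by simp
    moreover have "val \<beta> = p i ^ \<beta> i * (\<Prod>j\<in>{..<m} - {i}. p j ^ \<beta> j)"
      unfolding val_def using assms(2) by (intro prod.remove) auto
    moreover have "coprime (p i ^ \<alpha> i) (\<Prod>j\<in>{..<m} - {i}. p j ^ \<beta> j)"
      by (rule prod_coprime_right) (use p_coprime assms(2) in auto)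
    ultimately have "p i ^ \<alpha> i dvd p i ^ \<beta> i" by (simp add: coprime_dvd_mult_left_iff)
    then show ?thesis using p_ge2[OF assms(2)] by (intro power_dvd_imp_le) auto
  qed
  show ?thesis using le[OF assms(1)] le[OF assms(1)[symmetric]] by simp
qed

lemma mb_S_eq: "mb_S p m = range val"
  unfolding mb_S_def val_def by auto

definition H :: "nat \<Rightarrow> nat set" where "H n = {h \<in> mb_S p m. h \<le> n}"

lemma finite_H: "finite (H n)" unfolding H_def by (rule finite_subset[of _ "{..n}"]) auto

lemma H_pos: "h \<in> H n \<Longrightarrow> h > 0"
  using val_pos by (auto simp: H_def mb_S_eq)

text \<open>Only the first two exponents enter because the smoothing sets are built from the first
  two bases alone.\<close>

definition parity_class :: "nat \<Rightarrow> nat set" where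
  "parity_class e = {val \<alpha> | \<alpha>. (\<alpha> 0 + \<alpha> 1) mod 2 = e}"

lemma parity_class_disjoint: "e \<noteq> e' \<Longrightarrow> parity_class e \<inter> parity_class e' = {}"
proof (rule equals0I)
  fix h assume ne: "e \<noteq> e'" and "h \<in> parity_class e \<inter> parity_class e'"
  then obtain \<alpha> \<beta> where "val \<alpha> = val \<beta>" "(\<alpha> 0 + \<alpha> 1) mod 2 = e" "(\<beta> 0 + \<beta> 1) mod 2 = e'"
    by (auto simp: parity_class_def)
  then show False using val_inject[of \<alpha> \<beta> 0] val_inject[of \<alpha> \<beta> 1] m2 ne by simp
qed

lemma mb_S_parity: "mb_S p m = parity_class 0 \<union> parity_class 1"
  unfolding mb_S_eq parity_class_def by auto

lemma parity_class_subset: "parity_class e \<subseteq> mb_S p m"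
  unfolding mb_S_eq parity_class_def by auto

lemma val_two: "val (\<lambda>i. if i = 0 then x else if i = 1 then y else 0) = p 0 ^ x * p 1 ^ y"
proof -
  have split: "{..<m} = {0, 1} \<union> {2..<m}" using m2 by auto
  show ?thesis unfolding val_def split by (subst prod.union_disjoint) auto
qed

lemma smoothing_set_subset:
  assumes "e \<le> 1" shows "smoothing_set (p 0) (p 1) e J R \<subseteq> parity_class e"
proof
  fix h assume "h \<in> smoothing_set (p 0) (p 1) e J R"
  then obtain k j where "h = p 0 ^ (2*k) * p 1 ^ (2*j+e) \<or> h = p 0 ^ (2*j+e) * p 1 ^ (2*k)"
    by (auto simp: smoothing_set_def mult.commute)
  then obtain x y where h: "h = p 0 ^ x * p 1 ^ y" and xy: "(x + y) mod 2 = e"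
    using assms by (elim disjE) (force simp: mod_less)+
  let ?\<alpha> = "\<lambda>i::nat. if i = 0 then x else if i = 1 then y else 0"
  have "(?\<alpha> 0 + ?\<alpha> 1) mod 2 = e" using xy by simp
  then show "h \<in> parity_class e" unfolding parity_class_def h val_two[symmetric] by blast
qed

text \<open>The part prime to \<open>p 0\<close>: fixing it cuts the multi-base set into geometric
  progressions with ratio \<open>p 0\<close>.\<close>

definition tail_val :: "(nat \<Rightarrow> nat) \<Rightarrow> nat" where "tail_val \<alpha> = (\<Prod>i\<in>{1..<m}. p i ^ \<alpha> i)"

lemma val_eq: "val \<alpha> = tail_val \<alpha> * p 0 ^ \<alpha> 0"
proof -
  have "{..<m} = insert 0 {1..<m}" using m2 by auto
  then show ?thesis unfolding val_def tail_val_def by simp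
qed

lemma tail_val_pos: "tail_val \<alpha> > 0"
  unfolding tail_val_def by (rule prod_pos) (use p_pos in auto)

definition tails :: "nat \<Rightarrow> nat set" where "tails n = {c. c \<le> n \<and> c \<in> range tail_val}"

lemma ln_ge_1: "n \<ge> 3 \<Longrightarrow> ln (real n) \<ge> 1"
  using exp_le by (subst ln_ge_iff) auto

text \<open>Each of the m - 1 remaining exponents is at most ln n / ln 2, and 3 ln n is a convenient
  bound for one more than that.\<close>

lemma card_tails_le:
  assumes "n \<ge> 3" shows "finite (tails n)" "real (card (tails n)) \<le> (3 * ln (real n)) ^ (m - 1)"
proof -
  define K where "K = nat \<lfloor>ln (real n) / ln 2\<rfloor>"
  have l: "ln (real n) \<ge> 1" using ln_ge_1[OF assms] .
  have ln2: "ln 2 \<ge> (2/3 :: real)" by (rule ln2_ge_two_thirds)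
  have sub: "tails n \<subseteq> tail_val ` (PiE {1..<m} (\<lambda>_. {..K}))"
  proof
    fix c assume c: "c \<in> tails n"
    then obtain \<alpha> where \<alpha>: "c = tail_val \<alpha>" "c \<le> n" by (auto simp: tails_def)
    have "\<alpha> i \<le> K" if i: "i \<in> {1..<m}" for i
    proof -
      have "p i ^ \<alpha> i dvd c" unfolding \<alpha>(1) tail_val_def using i by (intro dvd_prodI) auto
      then have "p i ^ \<alpha> i \<le> c" using tail_val_pos \<alpha> by (intro dvd_imp_le) auto
      moreover have "2 ^ \<alpha> i \<le> p i ^ \<alpha> i" using p_ge2[of i] i by (intro power_mono) auto
      ultimately have "2 ^ \<alpha> i \<le> n" using \<alpha>(2) by linarith
      then have "(2::real) ^ \<alpha> i \<le> real n" by (metis of_nat_le_iff of_nat_numeral of_nat_power)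
      then have "ln ((2::real) ^ \<alpha> i) \<le> ln (real n)" using assms by (subst ln_le_cancel_iff) auto
      then have "real (\<alpha> i) \<le> ln (real n) / ln 2" by (simp add: ln_realpow field_simps)
      then show ?thesis unfolding K_def by (simp add: le_nat_floor)
    qed
    then have "restrict \<alpha> {1..<m} \<in> PiE {1..<m} (\<lambda>_. {..K})" by auto
    moreover have "c = tail_val (restrict \<alpha> {1..<m})" unfolding \<alpha>(1) tail_val_def by (intro prod.cong) auto
    ultimately show "c \<in> tail_val ` (PiE {1..<m} (\<lambda>_. {..K}))" by blast
  qed
  have fin: "finite (PiE {1..<m} (\<lambda>_. {..K}))" by (intro finite_PiE) auto
  show "finite (tails n)" using sub fin by (meson finite_imageI finite_subset)
  have "card (tails n) \<le> card (PiE {1..<m} (\<lambda>_. {..K}))"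
    using card_mono[OF finite_imageI[OF fin] sub] card_image_le[OF fin, of tail_val] by linarith
  also have "\<dots> = (K + 1) ^ (m - 1)" by (simp add: card_PiE)
  finally have "real (card (tails n)) \<le> real (K + 1) ^ (m - 1)" by (metis of_nat_le_iff of_nat_power)
  also have "\<dots> \<le> (3 * ln (real n)) ^ (m - 1)"
  proof (rule power_mono)
    have "real K \<le> ln (real n) / ln 2" unfolding K_def using l by (intro of_nat_floor) auto
    also have "\<dots> \<le> ln (real n) / (2/3)" using ln2 l by (intro divide_left_mono) auto
    finally show "real (K + 1) \<le> 3 * ln (real n)" using l by simp
  qed simp
  finally show "real (card (tails n)) \<le> (3 * ln (real n)) ^ (m - 1)" .
qed

text \<open>Reduces sums over the multi-base elements up to \<open>n\<close> to a single
  progression, at the price of the number of progressions. In the upper bounds this is the source of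
  the power (ln n) ^ (m - 1).\<close>

lemma sum_H_le:
  fixes G :: "real \<Rightarrow> real"
  assumes n: "n \<ge> 3" and G: "\<And>x. G x \<ge> 0"
    and B: "\<And>c K. c > 0 \<Longrightarrow> (\<Sum>k<K. G (real c * real (p 0) ^ k)) \<le> B"
  shows "(\<Sum>h\<in>H n. G (real h)) \<le> (3 * ln (real n)) ^ (m - 1) * B"
proof -
  let ?f = "\<lambda>(c, k). c * p 0 ^ k"
  have B0: "B \<ge> 0" using B[of 1 0] by simp
  have sub: "H n \<subseteq> ?f ` (tails n \<times> {..<n})"
  proof
    fix h assume "h \<in> H n"
    then obtain \<alpha> where \<alpha>: "h = val \<alpha>" "h \<le> n" by (auto simp: H_def mb_S_eq)
    have h: "h = tail_val \<alpha> * p 0 ^ \<alpha> 0" using \<alpha> val_eq by simp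
    have "p 0 ^ \<alpha> 0 > 0" using p0 by simp
    then have "tail_val \<alpha> \<le> h" unfolding h using mult_le_mono2[of 1 "p 0 ^ \<alpha> 0" "tail_val \<alpha>"] by linarith
    moreover have "\<alpha> 0 < n"
    proof -
      have "\<alpha> 0 < 2 ^ \<alpha> 0" by (rule less_exp)
      also have "\<dots> \<le> p 0 ^ \<alpha> 0" using p0 by (intro power_mono) auto
      also have "\<dots> \<le> h" unfolding h using tail_val_pos[of \<alpha>] by simp
      finally show ?thesis using \<alpha> by simp
    qed
    ultimately have "(tail_val \<alpha>, \<alpha> 0) \<in> tails n \<times> {..<n}" using \<alpha>(2) by (simp add: tails_def)
    then show "h \<in> ?f ` (tails n \<times> {..<n})" by (rule rev_image_eqI) (simp add: h)
  qed
  have fin: "finite (tails n \<times> {..<n})" using card_tails_le(1)[OF n] by simp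
  have "(\<Sum>h\<in>H n. G (real h)) \<le> (\<Sum>h\<in>?f ` (tails n \<times> {..<n}). G (real h))"
    by (rule sum_mono2[OF finite_imageI[OF fin] sub]) (use G in auto)
  also have "\<dots> \<le> (\<Sum>x\<in>tails n \<times> {..<n}. G (real (?f x)))"
    using sum_image_le[OF fin, of "\<lambda>h. G (real h)" ?f] G by (simp add: o_def)
  also have "\<dots> = (\<Sum>c\<in>tails n. \<Sum>k<n. G (real c * real (p 0) ^ k))"
    by (simp add: sum.cartesian_product case_prod_unfold)
  also have "\<dots> \<le> (\<Sum>c\<in>tails n. B)"
    by (intro sum_mono B) (use tail_val_pos in \<open>auto simp: tails_def\<close>)
  also have "\<dots> \<le> (3 * ln (real n)) ^ (m - 1) * B"
    using card_tails_le(2)[OF n] B0 by (simp add: mult_right_mono)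
  finally show ?thesis .
qed

lemma sum_H_exp_le:
  assumes n: "n \<ge> 3" and R: "R > 0" and q: "q \<ge> 1"
  shows "(\<Sum>h\<in>H n. real h ^ q * exp (- (real h / R))) \<le> (4 * fact (Suc q) * 3 ^ (m - 1)) * ln (real n) ^ (m - 1) * R ^ q"
proof -
  have p02: "real (p 0) \<ge> 2" using p0 by simp
  define G where "G x = fact (Suc q) * min \<bar>x / R\<bar> (1 / \<bar>x / R\<bar>)" for x :: real
  have "(\<Sum>h\<in>H n. real h ^ q * exp (- (real h / R))) \<le> (\<Sum>h\<in>H n. R ^ q * G (real h))"
  proof (rule sum_mono)
    fix h assume "h \<in> H n"
    then have h: "h > 0" by (rule H_pos)
    have "(real h / R) ^ q * exp (- (real h / R)) \<le> G (real h)"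
      using power_times_exp_le_tent[of "real h / R" q] h R q by (simp add: G_def)
    then have "R ^ q * ((real h / R) ^ q * exp (- (real h / R))) \<le> R ^ q * G (real h)"
      using R by (intro mult_left_mono) auto
    then show "real h ^ q * exp (- (real h / R)) \<le> R ^ q * G (real h)" using R by (simp add: power_divide)
  qed
  also have "\<dots> = R ^ q * (\<Sum>h\<in>H n. G (real h))" by (rule sum_distrib_left[symmetric])
  also have "\<dots> \<le> R ^ q * ((3 * ln (real n)) ^ (m - 1) * (fact (Suc q) * 4))"
  proof (intro mult_left_mono sum_H_le[OF n])
    show "G x \<ge> 0" for x by (simp add: G_def)
    fix c K :: nat assume c: "c > 0"
    have "(\<Sum>k<K. G (real c * real (p 0) ^ k)) =
        fact (Suc q) * (\<Sum>k<K. min (real c / R * real (p 0) ^ k) (1 / (real c / R * real (p 0) ^ k)))"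
      using R by (simp add: G_def sum_distrib_left)
    also have "\<dots> \<le> fact (Suc q) * 4"
      using c R p02 by (intro mult_left_mono sum_tent_geometric_le) auto
    finally show "(\<Sum>k<K. G (real c * real (p 0) ^ k)) \<le> fact (Suc q) * 4" .
  qed (use R in auto)
  finally show ?thesis by (simp add: power_mult_distrib mult_ac)
qed

text \<open>A progression with ratio at least 2 has at most 1 + 2 ln (n / M) terms between
  \<open>M\<close> and \<open>n\<close>. With n / M a power of ln n, this is the origin of the
  factor ln ln n in the error terms.\<close>

lemma card_H_above_le:
  assumes n: "n \<ge> 3" and M: "0 < M" "M \<le> real n"
  shows "real (card {h \<in> H n. M < real h}) \<le> 3 ^ (m - 1) * ln (real n) ^ (m - 1) * (1 + 2 * ln (real n / M))"
proof -
  define G :: "real \<Rightarrow> real" where "G x = of_bool (M < x \<and> x \<le> real n)" for x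
  have "real (card {h \<in> H n. M < real h}) = (\<Sum>h\<in>H n. G (real h))"
  proof -
    have "(\<Sum>h\<in>H n. G (real h)) = (\<Sum>h\<in>H n. if M < real h then 1 else 0)"
      by (intro sum.cong) (auto simp: G_def H_def)
    also have "\<dots> = (\<Sum>h\<in>{h \<in> H n. M < real h}. 1)"
      by (rule sum.inter_filter[symmetric, OF finite_H])
    finally show ?thesis by simp
  qed
  also have "\<dots> \<le> (3 * ln (real n)) ^ (m - 1) * (1 + 2 * ln (real n / M))"
  proof (rule sum_H_le[OF n])
    show "G x \<ge> 0" for x by (simp add: G_def)
    fix c K :: nat assume c: "c > 0"
    define A where "A = {k. k < K \<and> M < real c * real (p 0) ^ k \<and> real c * real (p 0) ^ k \<le> real n}"
    have finA: "finite A" by (simp add: A_def)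
    have "(\<Sum>k<K. G (real c * real (p 0) ^ k)) = (\<Sum>k<K. if M < real c * real (p 0) ^ k \<and> real c * real (p 0) ^ k \<le> real n then 1 else 0)"
      by (intro sum.cong) (auto simp: G_def)
    also have "\<dots> = (\<Sum>k\<in>{k \<in> {..<K}. M < real c * real (p 0) ^ k \<and> real c * real (p 0) ^ k \<le> real n}. 1)"
      by (rule sum.inter_filter[symmetric]) simp
    also have "\<dots> = real (card A)" by (simp add: A_def)
    also have "\<dots> \<le> 1 + 2 * ln (real n / M)"
    proof (cases "A = {}")
      case True
      then show ?thesis using M by simp
    next
      case False
      define k0 where "k0 = Min A"
      have k0: "k0 \<in> A" using Min_in[OF finA False] by (simp add: k0_def)
      have nM: "real n / M \<ge> 1" using M by simp
      have "A \<subseteq> {k0..k0 + nat \<lfloor>2 * ln (real n / M)\<rfloor>}"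
      proof
        fix k assume k: "k \<in> A"
        have le: "k0 \<le> k" unfolding k0_def using finA k by simp
        have "2 ^ (k - k0) \<le> real (p 0) ^ (k - k0)" using p0 by (intro power_mono) auto
        also have "\<dots> = real c * real (p 0) ^ k / (real c * real (p 0) ^ k0)"
          using le c p0 by (simp add: power_diff)
        also have "\<dots> \<le> real n / M"
          using k k0 M by (intro frac_le) (auto simp: A_def)
        finally have "ln ((2::real) ^ (k - k0)) \<le> ln (real n / M)"
          using nM by (subst ln_le_cancel_iff) auto
        then have "real (k - k0) * ln 2 \<le> ln (real n / M)" by (simp add: ln_realpow)
        moreover have "real (k - k0) * (1/2) \<le> real (k - k0) * ln 2"
          using ln2_ge_two_thirds by (intro mult_left_mono) auto
        ultimately have "real (k - k0) \<le> 2 * ln (real n / M)" by simp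
        then have "k - k0 \<le> nat \<lfloor>2 * ln (real n / M)\<rfloor>" by (rule le_nat_floor)
        then show "k \<in> {k0..k0 + nat \<lfloor>2 * ln (real n / M)\<rfloor>}" using le by auto
      qed
      then have "card A \<le> card {k0..k0 + nat \<lfloor>2 * ln (real n / M)\<rfloor>}" by (intro card_mono) auto
      then have "real (card A) \<le> 1 + real (nat \<lfloor>2 * ln (real n / M)\<rfloor>)" by simp
      also have "real (nat \<lfloor>2 * ln (real n / M)\<rfloor>) \<le> 2 * ln (real n / M)" using nM by (intro of_nat_floor) simp
      finally show ?thesis by simp
    qed
    finally show "(\<Sum>k<K. G (real c * real (p 0) ^ k)) \<le> 1 + 2 * ln (real n / M)" .
  qed
  finally show ?thesis by (simp add: power_mult_distrib)
qed

text \<open>Let all exponents except that of \<open>p 0\<close> range up to a small multiple of ln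
  x. The tail is then at most sqrt x, and a window of ratio (p 0)^2 contains two consecutive powers
  of \<open>p 0\<close> times this tail; one of the two has the required parity.\<close>

lemma parity_class_count_lower:
  "\<exists>c>0. \<exists>x0\<ge>1. \<forall>x\<ge>x0. \<forall>e\<le>1.
     c * ln x ^ (m - 1) \<le> real (card {h \<in> parity_class e. x / real (p 0) ^ 2 < real h \<and> real h \<le> x})"
proof -
  define P where "P = (\<Prod>i<m. p i)"
  have pP: "p i \<le> P" if "i < m" for i unfolding P_def
    by (rule dvd_imp_le) (use that p_pos in \<open>auto intro!: dvd_prodI prod_pos\<close>)
  have P2: "P \<ge> 2" using pP[of 0] p_ge2[of 0] m2 by simp
  have lP: "ln (real P) > 0" using P2 by simp
  \<comment> \<open>Half of ln x shared among fewer than \<open>m\<close> exponents of bases at most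
    P.\<close>
  define c0 where "c0 = 1 / (2 * real m * ln (real P))"
  have c0: "c0 > 0" using lP m2 by (simp add: c0_def)
  \<comment> \<open>Makes p 0 \<le> sqrt x, so that the tail times \<open>p 0\<close> is still at
    most x and two consecutive exponents are admissible.\<close>
  define x0 where "x0 = real (p 0) ^ 2"
  have x01: "x0 \<ge> 1" using p0 by (simp add: x0_def)
  have "c0 ^ (m - 1) * ln x ^ (m - 1) \<le> real (card {h \<in> parity_class e. x / real (p 0) ^ 2 < real h \<and> real h \<le> x})"
    if x: "x \<ge> x0" and e: "e \<le> 1" for x :: real and e :: nat
  proof -
    have x1: "x \<ge> 1" using x x01 by simp
    define y where "y = c0 * ln x"
    have y: "y \<ge> 0" using c0 x1 by (simp add: y_def)
    define q where "q = nat \<lfloor>y\<rfloor>"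
    have qy: "real q \<le> y" unfolding q_def using y by (intro of_nat_floor)
    define F where "F = PiE {1..<m} (\<lambda>_. {..q})"
    have tl: "real (tail_val \<alpha>) * real (p 0) \<le> x" if \<alpha>: "\<alpha> \<in> F" for \<alpha>
    proof -
      have "tail_val \<alpha> \<le> (\<Prod>i\<in>{1..<m}. P ^ q)" unfolding tail_val_def
      proof (rule prod_mono)
        fix i assume i: "i \<in> {1..<m}"
        have "p i ^ \<alpha> i \<le> P ^ \<alpha> i" using pP i by (intro power_mono) auto
        also have "\<dots> \<le> P ^ q" using \<alpha> i P2 by (intro power_increasing) (auto simp: F_def)
        finally show "0 \<le> p i ^ \<alpha> i \<and> p i ^ \<alpha> i \<le> P ^ q" by simp
      qed
      then have "tail_val \<alpha> \<le> P ^ (q * (m - 1))" by (simp add: power_mult)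
      then have "real (tail_val \<alpha>) \<le> real P ^ (q * (m - 1))" by (metis of_nat_le_iff of_nat_power)
      also have "\<dots> = exp (real (q * (m - 1)) * ln (real P))" using P2 by (simp only: exp_of_nat_mult) simp
      also have "\<dots> \<le> exp (ln x / 2)"
      proof -
        have "real (q * (m - 1)) * ln (real P) \<le> (y * real m) * ln (real P)"
          using qy y lP by (intro mult_right_mono) (auto intro!: mult_mono)
        also have "\<dots> = ln x / 2" using lP m2 by (simp add: y_def c0_def)
        finally show ?thesis by simp
      qed
      also have "\<dots> = sqrt x" using x1 by (simp add: ln_sqrt[symmetric])
      finally have 1: "real (tail_val \<alpha>) \<le> sqrt x" .
      have "real (p 0) \<le> sqrt x" using x unfolding x0_def by (rule real_le_rsqrt)
      then have "real (tail_val \<alpha>) * real (p 0) \<le> sqrt x * sqrt x" using 1 x1 by (intro mult_mono) auto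
      then show ?thesis using x1 by simp
    qed
    have ex: "\<exists>k. (k + \<alpha> 1) mod 2 = e \<and> x / real (p 0) ^ 2 < real (tail_val \<alpha> * p 0 ^ k) \<and> real (tail_val \<alpha> * p 0 ^ k) \<le> x"
      if \<alpha>: "\<alpha> \<in> F" for \<alpha>
    proof -
      let ?t = "real (tail_val \<alpha>)"
      have t: "?t > 0" using tail_val_pos by simp
      have b: "real (p 0) > 1" using p0 by simp
      obtain k1 where k1: "x / ?t < real (p 0) ^ k1" using real_arch_pow[OF b] by blast
      define k2 where "k2 = (LEAST k. x / ?t < real (p 0) ^ k)"
      have k2: "x / ?t < real (p 0) ^ k2" unfolding k2_def using k1 by (rule LeastI)
      have lt: "?t * real (p 0) ^ k \<le> x" if "k < k2" for k
      proof -
        have "\<not> x / ?t < real (p 0) ^ k" using not_less_Least that unfolding k2_def by blast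
        then show ?thesis using t by (simp add: field_simps)
      qed
      have up: "x < ?t * real (p 0) ^ k2" using k2 t by (simp add: field_simps)
      have "k2 \<ge> 2"
      proof (rule ccontr)
        assume "\<not> k2 \<ge> 2"
        then have "real (p 0) ^ k2 \<le> real (p 0) ^ 1" using b by (intro power_increasing) auto
        then have "?t * real (p 0) ^ k2 \<le> ?t * real (p 0)" using t by simp
        then show False using up tl[OF \<alpha>] by simp
      qed
      then obtain j where j: "k2 = Suc (Suc j)" by (metis Suc_le_D numeral_2_eq_2 Suc_le_mono)
      have c1: "x / real (p 0) ^ 2 < ?t * real (p 0) ^ j"
        using up b unfolding j by (simp add: field_simps power2_eq_square)
      have c2: "x / real (p 0) ^ 2 < ?t * real (p 0) ^ Suc j"
      proof -
        have "?t * real (p 0) ^ j \<le> ?t * real (p 0) ^ Suc j" using b t by simp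
        then show ?thesis using c1 by simp
      qed
      have "(j + \<alpha> 1) mod 2 = e \<or> (Suc j + \<alpha> 1) mod 2 = e" using e by presburger
      then show ?thesis
      proof
        assume "(j + \<alpha> 1) mod 2 = e"
        then show ?thesis using c1 lt[of j] j by (intro exI[of _ j]) auto
      next
        assume "(Suc j + \<alpha> 1) mod 2 = e"
        then show ?thesis using c2 lt[of "Suc j"] j by (intro exI[of _ "Suc j"]) auto
      qed
    qed
    then obtain kk where kk: "\<And>\<alpha>. \<alpha> \<in> F \<Longrightarrow> (kk \<alpha> + \<alpha> 1) mod 2 = e \<and> x / real (p 0) ^ 2 < real (tail_val \<alpha> * p 0 ^ kk \<alpha>) \<and> real (tail_val \<alpha> * p 0 ^ kk \<alpha>) \<le> x"
      by metis
    define g where "g \<alpha> = \<alpha>(0 := kk \<alpha>)" for \<alpha>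
    have gv: "val (g \<alpha>) = tail_val \<alpha> * p 0 ^ kk \<alpha>" for \<alpha>
    proof -
      have "tail_val (g \<alpha>) = tail_val \<alpha>" unfolding tail_val_def g_def by (intro prod.cong) auto
      then show ?thesis by (simp add: val_eq g_def)
    qed
    have inj: "inj_on (\<lambda>\<alpha>. val (g \<alpha>)) F"
    proof (rule inj_onI)
      fix \<alpha> \<beta> assume ab: "\<alpha> \<in> F" "\<beta> \<in> F" "val (g \<alpha>) = val (g \<beta>)"
      show "\<alpha> = \<beta>"
      proof (rule PiE_ext[OF ab(1,2)[unfolded F_def]])
        fix i assume "i \<in> {1..<m}"
        then show "\<alpha> i = \<beta> i" using val_inject[OF ab(3), of i] by (simp add: g_def)
      qed
    qed
    have sub: "(\<lambda>\<alpha>. val (g \<alpha>)) ` F \<subseteq> {h \<in> parity_class e. x / real (p 0) ^ 2 < real h \<and> real h \<le> x}"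
    proof clarify
      fix \<alpha> assume "\<alpha> \<in> F"
      from kk[OF this] show "val (g \<alpha>) \<in> parity_class e \<and> x / real (p 0) ^ 2 < real (val (g \<alpha>)) \<and> real (val (g \<alpha>)) \<le> x"
        unfolding gv[symmetric] parity_class_def by (auto simp: g_def intro!: exI[of _ "g \<alpha>"])
    qed
    have fin: "finite {h \<in> parity_class e. x / real (p 0) ^ 2 < real h \<and> real h \<le> x}"
      by (rule finite_subset[OF _ finite_nat_real_le[of x]]) auto
    have "card F \<le> card {h \<in> parity_class e. x / real (p 0) ^ 2 < real h \<and> real h \<le> x}"
      using card_mono[OF fin sub] card_image[OF inj] by simp
    moreover have "card F = (q + 1) ^ (m - 1)" by (simp add: F_def card_PiE)
    moreover have "y ^ (m - 1) \<le> real (q + 1) ^ (m - 1)"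
    proof (rule power_mono)
      show "y \<le> real (q + 1)" unfolding q_def by linarith
    qed (rule y)
    moreover have "y ^ (m - 1) = c0 ^ (m - 1) * ln x ^ (m - 1)" by (simp add: y_def power_mult_distrib)
    ultimately show ?thesis by (metis of_nat_le_iff of_nat_power order_trans)
  qed
  then show ?thesis using c0 x01 by (meson zero_less_power)
qed

text \<open>Taking logarithms identifies \<open>H n\<close> with the lattice points of a simplex;
  the error is the difference between (l + W) ^ m and l ^ m.\<close>

lemma card_H_asymp:
  "\<exists>C\<ge>0. \<forall>n\<ge>3. \<bar>real (card (H n)) - ln (real n) ^ m / (fact m * (\<Prod>i<m. ln (real (p i))))\<bar> \<le> C * ln (real n) ^ (m - 1)"
proof -
  define w where "w i = ln (real (p i))" for i
  have w: "w i > 0" if "i < m" for i using p_ge2[OF that] by (simp add: w_def)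
  define W where "W = (\<Sum>i<m. w i)"
  have W: "W \<ge> 0" unfolding W_def by (rule sum_nonneg) (use w in \<open>auto intro: less_imp_le\<close>)
  define D where "D = fact m * (\<Prod>i<m. w i)"
  have D: "D > 0" unfolding D_def by (intro mult_pos_pos prod_pos) (use w in auto)
  define C where "C = real m * W * (1 + W) ^ (m - 1) / D"
  have C: "C \<ge> 0" using W D by (simp add: C_def)
  have "\<bar>real (card (H n)) - ln (real n) ^ m / D\<bar> \<le> C * ln (real n) ^ (m - 1)" if n: "n \<ge> 3" for n
  proof -
    let ?l = "ln (real n)"
    have l: "?l \<ge> 1" by (rule ln_ge_1[OF n])
    have lnval: "ln (real (val \<alpha>)) = (\<Sum>i<m. real (\<alpha> i) * w i)" for \<alpha>
      unfolding val_def of_nat_prod using p_pos by (subst ln_prod) (auto simp: w_def ln_realpow)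
    have iff: "(\<Sum>i<m. real (\<alpha> i) * w i) \<le> ?l \<longleftrightarrow> val \<alpha> \<le> n" for \<alpha>
      unfolding lnval[symmetric] using val_pos[of \<alpha>] n by (subst ln_le_cancel_iff) auto
    have "bij_betw val (simplex_points w m ?l) (H n)"
    proof (rule bij_betw_imageI)
      show "inj_on val (simplex_points w m ?l)"
      proof (rule inj_onI, rule ext)
        fix \<alpha> \<beta> i assume "\<alpha> \<in> simplex_points w m ?l" "\<beta> \<in> simplex_points w m ?l" "val \<alpha> = val \<beta>"
        then show "\<alpha> i = \<beta> i" using val_inject[of \<alpha> \<beta> i] by (cases "i < m") (auto simp: simplex_points_def)
      qed
      show "val ` simplex_points w m ?l = H n"
      proof (intro equalityI subsetI)
        fix h assume "h \<in> H n"
        then obtain \<alpha> where \<alpha>: "h = val \<alpha>" "val \<alpha> \<le> n" by (auto simp: H_def mb_S_eq)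
        let ?\<beta> = "\<lambda>i. if i < m then \<alpha> i else 0"
        have "val ?\<beta> = val \<alpha>" unfolding val_def by (intro prod.cong) auto
        then show "h \<in> val ` simplex_points w m ?l"
          using \<alpha> iff[of ?\<beta>] by (intro image_eqI[of _ _ ?\<beta>]) (auto simp: simplex_points_def)
      qed (use iff in \<open>auto simp: H_def mb_S_eq simplex_points_def\<close>)
    qed
    then have card: "card (H n) = card (simplex_points w m ?l)" by (simp add: bij_betw_same_card)
    have b: "?l ^ m / D \<le> real (card (H n))" "real (card (H n)) \<le> (?l + W) ^ m / D"
      unfolding card D_def W_def using card_simplex_points[of m w ?l] w l by auto
    have "(?l + W) ^ m - ?l ^ m \<le> real m * W * (?l + W) ^ (m - 1)"
      using power_diff_le_mult(1)[of ?l "?l + W" "m - 1"] l W m2 by simp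
    also have "\<dots> \<le> real m * W * ((1 + W) * ?l) ^ (m - 1)"
    proof (intro mult_left_mono power_mono)
      have "W * 1 \<le> W * ?l" using l W by (intro mult_left_mono) auto
      then show "?l + W \<le> (1 + W) * ?l" by (simp add: algebra_simps)
    qed (use l W in auto)
    finally have "((?l + W) ^ m - ?l ^ m) / D \<le> real m * W * ((1 + W) * ?l) ^ (m - 1) / D"
      using D by (intro divide_right_mono) auto
    also have "\<dots> = C * ?l ^ (m - 1)" by (simp add: C_def power_mult_distrib)
    finally show ?thesis using b by (simp add: diff_divide_distrib)
  qed
  then show ?thesis using C unfolding D_def w_def by blast
qed

end

section \<open>The saddle point\<close>

lemma one_minus_cos_ge:
  fixes y :: real assumes "\<bar>y\<bar> \<le> 1/4" shows "1 - cos y \<ge> y^2 / 4"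
proof -
  have "\<bar>Re (cis y - (1 + \<i> * of_real y - of_real (y^2 / 2)))\<bar> \<le> \<bar>y\<bar>^3"
    using abs_Re_le_cmod norm_cis_quadratic_le order_trans by blast
  then have "\<bar>cos y - 1 + y^2 / 2\<bar> \<le> \<bar>y\<bar>^3" by (simp add: algebra_simps)
  moreover have "\<bar>y\<bar>^3 \<le> y^2 / 4"
  proof -
    have "\<bar>y\<bar>^3 = \<bar>y\<bar> * y^2" by (simp add: power3_eq_cube power2_eq_square abs_mult_self_eq mult.assoc)
    also have "\<dots> \<le> 1/4 * y^2" by (rule mult_right_mono[OF assms]) simp
    finally show ?thesis by simp
  qed
  ultimately show ?thesis by linarith
qed

lemma filterlim_ln_nat: "filterlim (\<lambda>n. ln (real n)) at_top sequentially"
  by real_asymp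

context multi_base
begin

text \<open>In the central arc the elements just below R / 16 have phases so small that 1 - cos is
  quadratic in them. Each parity class contains at least of the order of l ^ (m - 1) such elements,
  whence Gaussian decay on the scale 1 / (R sqrt (l ^ (m - 1))).\<close>

lemma phase_defect_gauss:
  "\<exists>c>0. \<forall>\<^sub>F l in at_top. \<forall>R e \<theta>. exp (l/2) \<le> R \<longrightarrow> e \<le> 1 \<longrightarrow> \<bar>\<theta>\<bar> \<le> 1 / (2*R) \<longrightarrow>
     c * l ^ (m - 1) * (R * \<theta>)^2 \<le> phase_defect {h \<in> parity_class e. real h \<le> R} \<theta>"
  (is "\<exists>c>0. \<forall>\<^sub>F l in at_top. ?P c l")
proof -
  obtain c0 x0 where c0: "c0 > 0" and x0: "x0 \<ge> 1" and cnt: "\<And>x e. x \<ge> x0 \<Longrightarrow> e \<le> 1 \<Longrightarrow>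
     c0 * ln x ^ (m - 1) \<le> real (card {h \<in> parity_class e. x / real (p 0) ^ 2 < real h \<and> real h \<le> x})"
    using parity_class_count_lower by blast
  define k where "k = pi^2 / (256 * real (p 0) ^ 4)"
  have k: "k > 0" using p0 by (simp add: k_def)
  define c where "c = c0 * (1/4) ^ (m - 1) * k"
  have c: "c > 0" using c0 k by (simp add: c_def)
  have ev1: "\<forall>\<^sub>F l in at_top. exp (l/2) \<ge> 16 * x0" by real_asymp
  have ev2: "\<forall>\<^sub>F l in at_top. l / 4 \<ge> ln (16::real)" by real_asymp
  have ev3: "\<forall>\<^sub>F l in at_top. l \<ge> (0::real)" by (rule eventually_ge_at_top)
  have "\<forall>\<^sub>F l in at_top. ?P c l"
    using ev1 ev2 ev3
  proof eventually_elim
    case (elim l)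
    show ?case
    proof (intro allI impI)
      fix R \<theta> :: real and e :: nat
      assume R: "exp (l/2) \<le> R" and e: "e \<le> 1" and \<theta>: "\<bar>\<theta>\<bar> \<le> 1 / (2*R)"
      have R0: "R > 0" using R by (meson exp_gt_zero less_le_trans)
      \<comment> \<open>Gives 2 \<pi> h |\<theta>| \<le> \<pi> / 16 \<le> 1/4, the range of the
        quadratic lower bound for 1 - cos.\<close>
      define x where "x = R / 16"
      have x: "x \<ge> x0" "x > 0" using elim(1) R x0 by (auto simp: x_def)
      have "l / 2 \<le> ln R" using R R0 by (subst ln_ge_iff) auto
      then have lx: "l / 4 \<le> ln x" using elim(2) R0 by (simp add: x_def ln_div)
      define X where "X = {h \<in> parity_class e. x / real (p 0) ^ 2 < real h \<and> real h \<le> x}"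
      have finR: "finite {h \<in> parity_class e. real h \<le> R}"
        by (rule finite_subset[OF _ finite_nat_real_le[of R]]) auto
      have sub: "X \<subseteq> {h \<in> parity_class e. real h \<le> R}" using R0 by (auto simp: X_def x_def)
      have each: "k * (R * \<theta>)^2 \<le> 1 - cos (2 * pi * (real h * \<theta>))" if h: "h \<in> X" for h
      proof -
        have hx: "x / real (p 0) ^ 2 \<le> real h" "real h \<le> x" using h by (auto simp: X_def)
        have "\<bar>2 * pi * (real h * \<theta>)\<bar> = 2 * pi * (real h * \<bar>\<theta>\<bar>)" by (simp add: abs_mult)
        also have "\<dots> \<le> 2 * pi * (x * (1 / (2*R)))" using hx \<theta> x by (intro mult_left_mono mult_mono) auto
        also have "\<dots> = pi / 16" using R0 by (simp add: x_def)
        also have "\<dots> \<le> 1/4" using pi_less_4 by simp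
        finally have "(2 * pi * (real h * \<theta>))^2 / 4 \<le> 1 - cos (2 * pi * (real h * \<theta>))" by (rule one_minus_cos_ge)
        moreover have "k * (R * \<theta>)^2 \<le> (2 * pi * (real h * \<theta>))^2 / 4"
        proof -
          have "(x / real (p 0) ^ 2)^2 \<le> (real h)^2" using hx x by (intro power_mono) auto
          then have "pi^2 * \<theta>^2 * (x / real (p 0) ^ 2)^2 \<le> pi^2 * \<theta>^2 * (real h)^2" by (intro mult_left_mono) auto
          then show ?thesis by (simp add: k_def x_def power_mult_distrib power_divide mult_ac)
        qed
        ultimately show ?thesis by linarith
      qed
      have "c * l ^ (m - 1) * (R * \<theta>)^2 = (c0 * (l/4) ^ (m - 1)) * (k * (R * \<theta>)^2)"
        by (simp add: c_def power_divide)
      also have "\<dots> \<le> (c0 * ln x ^ (m - 1)) * (k * (R * \<theta>)^2)"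
        using lx elim(3) c0 k by (intro mult_right_mono mult_left_mono power_mono) auto
      also have "\<dots> \<le> real (card X) * (k * (R * \<theta>)^2)"
        using cnt[OF x(1) e] k unfolding X_def by (intro mult_right_mono) auto
      also have "\<dots> = (\<Sum>h\<in>X. k * (R * \<theta>)^2)" by simp
      also have "\<dots> \<le> phase_defect X \<theta>" unfolding phase_defect_def by (rule sum_mono[OF each])
      also have "\<dots> \<le> phase_defect {h \<in> parity_class e. real h \<le> R} \<theta>"
        by (rule phase_defect_mono[OF finR sub])
      finally show "c * l ^ (m - 1) * (R * \<theta>)^2 \<le> phase_defect {h \<in> parity_class e. real h \<le> R} \<theta>" .
    qed
  qed
  then show ?thesis using c by blast
qed

section \<open>Existence and size of the saddle point\<close>

definition mean_value :: "nat \<Rightarrow> real \<Rightarrow> real" where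
  "mean_value n r = (\<Sum>h\<in>H n. real h * (\<Sum>k<d. tilt d (r * real h) k * real k))"

lemma continuous_on_mean_value: "continuous_on A (mean_value n)"
proof -
  have "(\<Sum>j<d. exp (- (r * real h) * real j)) \<noteq> 0" for r h
    using tilt_normalizer_ge_1[of d "r * real h"] d2 by simp
  then show ?thesis unfolding mean_value_def tilt_def
    by (intro continuous_intros) auto
qed

lemma mean_value_le:
  assumes "n \<ge> 3" "r > 0"
  shows "mean_value n r \<le> (real d ^ 2 * (8 * 3 ^ (m - 1))) * ln (real n) ^ (m - 1) * (1 / r)"
proof -
  interpret tilted_product d "H n" r
    by unfold_locales (use d2 finite_H assms in auto)
  have "mean_value n r = (\<Sum>h\<in>H n. real h * mu h)" by (simp add: mean_value_def mu_def Ex1_def)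
  also have "\<dots> \<le> (\<Sum>h\<in>H n. real d ^ 2 * (real h ^ 1 * exp (- (real h / (1 / r)))))"
  proof (rule sum_mono)
    fix h
    have "real h * mu h \<le> real h * (real d ^ 2 * exp (- (r * real h)))" by (intro mult_left_mono mu_le) auto
    then show "real h * mu h \<le> real d ^ 2 * (real h ^ 1 * exp (- (real h / (1 / r))))" by (simp add: mult_ac)
  qed
  also have "\<dots> = real d ^ 2 * (\<Sum>h\<in>H n. real h ^ 1 * exp (- (real h / (1 / r))))"
    by (rule sum_distrib_left[symmetric])
  also have "\<dots> \<le> real d ^ 2 * ((4 * fact (Suc 1) * 3 ^ (m - 1)) * ln (real n) ^ (m - 1) * (1 / r) ^ 1)"
    by (intro mult_left_mono sum_H_exp_le) (use assms in auto)
  also have "\<dots> = (real d ^ 2 * (8 * 3 ^ (m - 1))) * ln (real n) ^ (m - 1) * (1 / r)"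
    by (simp add: numeral_2_eq_2)
  finally show ?thesis .
qed

text \<open>Intermediate value theorem between r = 1 / n and r = 1. At r = 1 the mean is at most a
  power of ln n. At r = 1 / n the elements of order \<open>n\<close> keep digit means bounded below,
  and their number grows, so the mean exceeds \<open>n\<close>. The bound of \<open>n\<close> in
  terms of 1 / r is the general bound for the mean, read at the saddle.\<close>

lemma saddle_exists:
  "\<exists>C>0. \<forall>\<^sub>F n in sequentially. \<exists>r>0. 1 / r \<le> real n \<and> real n \<le> C * ln (real n) ^ (m - 1) * (1 / r)
      \<and> mean_value n r = real n"
  (is "\<exists>C>0. \<forall>\<^sub>F n in sequentially. ?P C n")
proof -
  define C where "C = real d ^ 2 * (8 * 3 ^ (m - 1))"
  have C: "C > 0" using d2 by (simp add: C_def)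
  obtain c0 x0 where c0: "c0 > 0" and x0: "x0 \<ge> 1" and cnt: "\<And>x e. x \<ge> x0 \<Longrightarrow> e \<le> 1 \<Longrightarrow>
     c0 * ln x ^ (m - 1) \<le> real (card {h \<in> parity_class e. x / real (p 0) ^ 2 < real h \<and> real h \<le> x})"
    using parity_class_count_lower by blast
  define k where "k = c0 / (3 * real d * real (p 0) ^ 2)"
  have k: "k > 0" using c0 d2 p0 by (simp add: k_def)
  have m1: "m - 1 > 0" using m2 by simp
  have ev1: "\<forall>\<^sub>F n in sequentially. C * ln (real n) ^ (m - 1) \<le> real n" using C by real_asymp
  have ev2: "\<forall>\<^sub>F n in sequentially. k * ln (real n) \<ge> 1" using k by real_asymp
  have ev3: "\<forall>\<^sub>F n in sequentially. real n \<ge> max x0 3" by real_asymp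
  have "\<forall>\<^sub>F n in sequentially. ?P C n"
    using ev1 ev2 ev3
  proof eventually_elim
    case (elim n)
    have n3: "n \<ge> 3" using elim(3) by simp
    have l: "ln (real n) \<ge> 1" by (rule ln_ge_1[OF n3])
    have hi: "mean_value n 1 \<le> real n" using mean_value_le[OF n3, of 1] elim(1) by (simp add: C_def)
    have lo: "mean_value n (1 / real n) \<ge> real n"
    proof -
      interpret tilted_product d "H n" "1 / real n"
        by unfold_locales (use d2 finite_H in auto)
      define X where "X = {h \<in> parity_class 0. real n / real (p 0) ^ 2 < real h \<and> real h \<le> real n}"
      have X: "X \<subseteq> H n" using parity_class_subset by (auto simp: X_def H_def)
      have "real n \<le> k * ln (real n) * real n" using elim(2) by (simp add: mult_le_cancel_right1)
      also have "\<dots> \<le> k * ln (real n) ^ (m - 1) * real n"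
        using l k m1 by (intro mult_right_mono mult_left_mono self_le_power) auto
      also have "\<dots> = (c0 * ln (real n) ^ (m - 1)) * (real n / real (p 0) ^ 2 * (1 / (3 * real d)))"
        by (simp add: k_def)
      also have "\<dots> \<le> real (card X) * (real n / real (p 0) ^ 2 * (1 / (3 * real d)))"
        using cnt[of "real n" 0] elim(3) unfolding X_def by (intro mult_right_mono) auto
      also have "\<dots> = (\<Sum>h\<in>X. real n / real (p 0) ^ 2 * (1 / (3 * real d)))" by simp
      also have "\<dots> \<le> (\<Sum>h\<in>X. real h * mu h)"
      proof (rule sum_mono)
        fix h assume h: "h \<in> X"
        have "1 / real n * real h \<le> 1" using h n3 by (simp add: X_def)
        from mu_ge[OF this] show "real n / real (p 0) ^ 2 * (1 / (3 * real d)) \<le> real h * mu h"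
          using h by (intro mult_mono) (auto simp: X_def)
      qed
      also have "\<dots> \<le> (\<Sum>h\<in>H n. real h * mu h)"
        by (rule sum_mono2[OF finH X]) (rule mult_nonneg_nonneg[OF of_nat_0_le_iff mu_nonneg])
      also have "\<dots> = mean_value n (1 / real n)" unfolding mean_value_def mu_def Ex1_def by (simp only: real_scaleR_def)
      finally show ?thesis .
    qed
    have "1 / real n \<le> 1" using n3 by simp
    from IVT2'[OF hi lo this continuous_on_mean_value]
    obtain r where r: "1 / real n \<le> r" "mean_value n r = real n" by auto
    have r0: "r > 0" using r(1) n3 by (meson less_le_trans of_nat_0_less_iff zero_less_divide_1_iff zero_less_numeral order_less_le_trans)
    have "1 / r \<le> real n" using r(1) r0 n3 by (simp add: field_simps)
    then show ?case using r r0 mean_value_le[OF n3 r0] unfolding C_def by auto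
  qed
  then show ?thesis using C by blast
qed

section \<open>Majorants for the characteristic function of the value\<close>

definition eta :: real where "eta = 1 / (9 * real d ^ 2)"

lemma eta_pos: "eta > 0" using d2 by (simp add: eta_def)

definition class_upto :: "nat \<Rightarrow> real \<Rightarrow> nat set" where
  "class_upto e R = {h \<in> parity_class e. real h \<le> R}"

definition smoothing :: "real \<Rightarrow> real \<Rightarrow> real \<Rightarrow> nat \<Rightarrow> nat set" where
  "smoothing C l R e = smoothing_set (p 0) (p 1) e (nat \<lceil>C * ln l\<rceil>) R"

text \<open>The order of magnitude of the standard deviation of the value when 1 / r = R.\<close>

definition scale :: "real \<Rightarrow> real \<Rightarrow> real" where "scale l R = sqrt (l ^ (m - 1)) * R"

text \<open>\<open>g\<close> will be the tail majorant of the smoothing set: passing to the whole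
  parity class adds Gaussian decay in the central arc and can only improve the bound outside
  it.\<close>

definition gauss_majorant :: "real \<Rightarrow> real \<Rightarrow> real \<Rightarrow> nat \<Rightarrow> (real \<Rightarrow> real) \<Rightarrow> bool" where
  "gauss_majorant c l R e g \<longleftrightarrow> (\<forall>\<theta>. \<bar>\<theta>\<bar> \<le> 1/2 \<longrightarrow>
     exp (- eta * phase_defect (class_upto e R) \<theta>) \<le> exp (- c * (scale l R * \<theta>)^2) + g \<theta>)"

lemma smoothing_bounds:
  "\<exists>C2>0. \<exists>c>0. \<forall>\<^sub>F l in at_top. \<forall>R e. exp (l/2) \<le> R \<longrightarrow> R \<le> exp l \<longrightarrow> e \<le> 1 \<longrightarrow>
    (\<exists>g. tail_majorant eta (smoothing C2 l R e) R (1 / (l ^ (5*m) * R)) g \<and> gauss_majorant c l R e g)"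
  (is "\<exists>C2>0. \<exists>c>0. \<forall>\<^sub>F l in at_top. ?P C2 c l")
proof -
  have ab: "p 0 \<ge> 2" "p 1 \<ge> 2" "coprime (p 0) (p 1)" using p_ge2[of 0] p_ge2[of 1] p_coprime[of 0 1] m2 by auto
  obtain C2 where C2: "C2 > 0" and ev1: "\<forall>\<^sub>F l in at_top. \<forall>R e. exp (l/2) \<le> R \<longrightarrow> R \<le> exp l \<longrightarrow> e \<le> 1 \<longrightarrow>
    (\<exists>g. tail_majorant eta (smoothing C2 l R e) R (1 / (l ^ (5*m) * R)) g)"
    using smoothing_tail[OF ab eta_pos, of "5*m"] unfolding smoothing_def by blast
  obtain c0 where c0: "c0 > 0" and ev2: "\<forall>\<^sub>F l in at_top. \<forall>R e \<theta>. exp (l/2) \<le> R \<longrightarrow> e \<le> 1 \<longrightarrow> \<bar>\<theta>\<bar> \<le> 1 / (2*R) \<longrightarrow>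
     c0 * l ^ (m - 1) * (R * \<theta>)^2 \<le> phase_defect {h \<in> parity_class e. real h \<le> R} \<theta>"
    using phase_defect_gauss by blast
  define c where "c = eta * c0"
  have c: "c > 0" using c0 eta_pos by (simp add: c_def)
  have "\<forall>\<^sub>F l in at_top. ?P C2 c l"
    using ev1 ev2 eventually_ge_at_top[of 0]
  proof eventually_elim
    case (elim l)
    show ?case
    proof (intro allI impI)
      fix R :: real and e :: nat
      assume R: "exp (l/2) \<le> R" "R \<le> exp l" and e: "e \<le> 1"
      let ?Q = "smoothing C2 l R e"
      let ?E = "{h \<in> parity_class e. real h \<le> R}"
      obtain g where g: "tail_majorant eta ?Q R (1 / (l ^ (5*m) * R)) g" using elim(1) R e by blast
      then have g_nonneg: "g \<theta> \<ge> 0"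
        and g_ge: "\<bar>\<theta>\<bar> \<le> 1/2 \<Longrightarrow> 1 / (2*R) < \<bar>\<theta>\<bar> \<Longrightarrow> exp (- eta * phase_defect ?Q \<theta>) \<le> g \<theta>" for \<theta>
        unfolding tail_majorant_def by blast+
      have finE: "finite ?E" by (rule finite_subset[OF _ finite_nat_real_le[of R]]) auto
      have "real h \<le> R" if "h \<in> ?Q" for h using that by (simp add: smoothing_def smoothing_set_def)
      then have QE: "?Q \<subseteq> ?E" using smoothing_set_subset[OF e] unfolding smoothing_def by blast
      have "exp (- eta * phase_defect ?E \<theta>) \<le> exp (- c * (scale l R * \<theta>)^2) + g \<theta>" if "\<bar>\<theta>\<bar> \<le> 1/2" for \<theta>
      proof (cases "\<bar>\<theta>\<bar> \<le> 1 / (2*R)")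
        case True
        then have "c0 * l ^ (m - 1) * (R * \<theta>)^2 \<le> phase_defect ?E \<theta>" using elim(2) R e by blast
        then have "eta * (c0 * l ^ (m - 1) * (R * \<theta>)^2) \<le> eta * phase_defect ?E \<theta>"
          using eta_pos by (intro mult_left_mono) auto
        moreover have "eta * (c0 * l ^ (m - 1) * (R * \<theta>)^2) = c * (scale l R * \<theta>)^2"
          using elim(3) by (simp add: c_def scale_def power_mult_distrib)
        ultimately have "exp (- eta * phase_defect ?E \<theta>) \<le> exp (- c * (scale l R * \<theta>)^2)" by simp
        then show ?thesis using g_nonneg[of \<theta>] by linarith
      next
        case False
        have "eta * phase_defect ?Q \<theta> \<le> eta * phase_defect ?E \<theta>"
          using phase_defect_mono[OF finE QE] eta_pos by (intro mult_left_mono) auto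
        then have "exp (- eta * phase_defect ?E \<theta>) \<le> exp (- eta * phase_defect ?Q \<theta>)" by simp
        also have "\<dots> \<le> g \<theta>" using g_ge that False by simp
        finally show ?thesis by (simp add: add_increasing)
      qed
      then show "\<exists>g. tail_majorant eta ?Q R (1 / (l ^ (5*m) * R)) g \<and> gauss_majorant c l R e g"
        unfolding gauss_majorant_def class_upto_def
        using g by blast
    qed
  qed
  then show ?thesis using C2 c by blast
qed

end

context digit_product
begin

text \<open>The independent digits outside \<open>Q\<close> contribute a factor of modulus at most
  1.\<close>

lemma norm_Ex_cis_subset_le:
  assumes "Q \<subseteq> H" "char_decay \<eta> Q"
  shows "norm (Ex (\<lambda>a. cis (2 * pi * \<theta> * real (rep_value H a)))) \<le> exp (- \<eta> * phase_defect Q \<theta>)"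
proof -
  have "norm (Ex (\<lambda>a. cis (2 * pi * \<theta> * (real (rep_value (H - Q) a))))) \<le> 1"
    by (rule norm_Ex_le_const) simp
  then show ?thesis
    using Ex_cis_factor[OF assms(1) depends_on_const[of _ 1], of \<theta> 0] norm_Ex_cis_le[OF assms, of \<theta>]
    by (simp add: norm_mult) (meson mult_left_le_one_le norm_ge_zero order_trans)
qed

end

section \<open>The hitting probability and the Fourier bounds at the saddle point\<close>

context multi_base
begin

abbreviation tilted_Ex :: "nat \<Rightarrow> real \<Rightarrow> ((nat \<Rightarrow> nat) \<Rightarrow> 'b::real_normed_field) \<Rightarrow> 'b" where
  "tilted_Ex n r \<equiv> digit_product.Ex d (H n) (\<lambda>h. tilt d (r * real h))"

definition hit_prob :: "nat \<Rightarrow> real \<Rightarrow> real" where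
  "hit_prob n r = tilted_Ex n r (\<lambda>a. if rep_value (H n) a = n then 1 else 0)"

text \<open>\<open>C3\<close> comes from the variance; then A makes the Gaussian tail at most half
  of exp (- C3); then \<open>n\<close> is large enough for the moment error to be at most the same.
  Of the leading 2 exp (- C3) / s this leaves exp (- C3) / s, and the integral of \<open>g\<close>
  takes at most half of it.\<close>

lemma tilted_prob_lower:
  assumes c: "c > 0"
  shows "\<exists>C>0. \<forall>\<^sub>F n in sequentially. \<forall>r g Q. r > 0 \<longrightarrow> 2 \<le> 1 / r \<longrightarrow> 1 / r \<le> real n \<longrightarrow> mean_value n r = real n \<longrightarrow>
    tail_majorant eta Q (1 / r) (1 / (ln (real n) ^ (5*m) * (1 / r))) g \<longrightarrow> gauss_majorant c (ln (real n)) (1 / r) 0 g \<longrightarrow>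
    1 / (C * scale (ln (real n)) (1 / r)) \<le> hit_prob n r"
    (is "\<exists>C>0. \<forall>\<^sub>F n in sequentially. ?P C n")
proof -
  define k :: "nat \<Rightarrow> real" where "k q = 4 * fact (Suc q) * 3 ^ (m - 1)" for q
  have k: "k q > 0" for q by (simp add: k_def)
  define C3 where "C3 = max c (2 * pi^2 * real d ^ 3 * k 2)"
  have C3: "c \<le> C3" "2 * pi^2 * real d ^ 3 * k 2 \<le> C3" by (auto simp: C3_def)
  have "\<forall>\<^sub>F A in at_top. 2 * pi * exp (- c * A^2 / 2) / sqrt (c / 2) \<le> exp (- C3) / 2"
  proof -
    have "((\<lambda>A. 2 * pi * exp (- c * A^2 / 2) / sqrt (c / 2)) \<longlongrightarrow> 0) at_top" using c by real_asymp
    then have "\<forall>\<^sub>F A in at_top. 2 * pi * exp (- c * A^2 / 2) / sqrt (c / 2) < exp (- C3) / 2"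
      by (rule order_tendstoD) simp
    then show ?thesis by eventually_elim simp
  qed
  then have "\<forall>\<^sub>F A in at_top. 2 * pi * exp (- c * A^2 / 2) / sqrt (c / 2) \<le> exp (- C3) / 2 \<and> A > (0::real)"
    using eventually_gt_at_top[of 0] by eventually_elim simp
  from eventually_happens'[OF trivial_limit_at_top_linorder this]
  obtain A where A: "2 * pi * exp (- c * A^2 / 2) / sqrt (c / 2) \<le> exp (- C3) / 2" "A > 0"
    by blast
  \<comment> \<open>With L = l ^ (m - 1), the third and fourth moments are of order L R^3 and L R^4,
    against s^3 and s^4 with s = sqrt L * R. This leaves factors 1 / sqrt L and 1 / L.\<close>
  define KK where "KK = (2 * pi * A)^3 * real d ^ 4 * k 3 + (2 * pi * A)^4 * real d ^ 5 * k 4"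
  have KK: "KK \<ge> 0" using A less_imp_le[OF k] unfolding KK_def by (intro add_nonneg_nonneg mult_nonneg_nonneg) auto
  have ev1: "\<forall>\<^sub>F n in sequentially. sqrt (ln (real n)) \<ge> 4 * pi * A * KK * exp C3" by real_asymp
  have ev2: "\<forall>\<^sub>F n in sequentially. ln (real n) \<ge> 2 * exp C3" by real_asymp
  have "\<forall>\<^sub>F n in sequentially. ?P (2 * exp C3) n"
    using ev1 ev2 eventually_ge_at_top[of 3]
  proof eventually_elim
    case (elim n)
    show ?case
    proof (intro allI impI)
      fix r :: real and g :: "real \<Rightarrow> real" and Q
      assume r: "r > 0" "2 \<le> 1 / r" "1 / r \<le> real n" and mean: "mean_value n r = real n"
        and tail: "tail_majorant eta Q (1 / r) (1 / (ln (real n) ^ (5*m) * (1 / r))) g"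
        and gauss: "gauss_majorant c (ln (real n)) (1 / r) 0 g"
      have g: "continuous_on UNIV g" "\<forall>\<theta>. g \<theta> \<ge> 0" "integral {-1/2..1/2} g \<le> 1 / (ln (real n) ^ (5*m) * (1 / r))"
        using tail unfolding tail_majorant_def by auto
      interpret tilted_product d "H n" r
        by unfold_locales (use d2 finite_H r in auto)
      define R where "R = 1 / r"
      have R: "R \<ge> 2" "R > 0" "R \<le> real n" using r by (auto simp: R_def)
      have rR: "r * real h = real h / R" for h using r by (simp add: R_def)
      define l where "l = ln (real n)"
      have l: "l \<ge> 1" unfolding l_def by (rule ln_ge_1[OF elim(3)])
      define L where "L = l ^ (m - 1)"
      have L1: "L \<ge> 1" using l by (simp add: L_def)
      have lL: "l \<le> L" unfolding L_def using l m2 by (intro self_le_power) auto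
      define s where "s = scale l R"
      have s_eq: "s = sqrt L * R" by (simp add: s_def scale_def L_def)
      have sq1: "sqrt L \<ge> 1" using L1 by simp
      have sqL: "sqrt L \<le> L"
      proof -
        have "sqrt L * 1 \<le> sqrt L * sqrt L" using sq1 by (intro mult_left_mono) auto
        then show ?thesis using L1 by simp
      qed
      have sR: "s \<ge> R" unfolding s_eq using sq1 R by simp
      then have s: "s \<ge> 2" "s > 0" using R by auto
      define E where "E = {h \<in> parity_class 0. real h \<le> R}"
      have EH: "E \<subseteq> H n" using parity_class_subset R by (auto simp: E_def H_def)
      have decay: "char_decay eta E" unfolding eta_def
        by (rule char_decay_tilt) (use R in \<open>auto simp: E_def rR\<close>)
      have Sq: "(\<Sum>h\<in>H n. real h ^ q * exp (- (r * real h))) \<le> k q * L * R ^ q" if "q \<ge> 1" for q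
        using sum_H_exp_le[OF elim(3) R(2) that] unfolding k_def L_def l_def rR .
      have n_eq: "real n = (\<Sum>h\<in>H n. real h * mu h)"
        using mean unfolding mean_value_def mu_def Ex1_def by simp
      define \<delta> where "\<delta> = KK / sqrt L"
      have \<delta>: "\<delta> \<ge> 0" using KK L1 by (simp add: \<delta>_def)
      have moments: "(\<Sum>h\<in>H n. \<bar>2 * pi * \<theta> * real h\<bar>^3 * Ex1 h (\<lambda>k. \<bar>real k - mu h\<bar>^3) + (2 * pi * \<theta> * real h)^4 * (var1 h)^2) \<le> \<delta>"
        if \<theta>: "\<bar>\<theta>\<bar> \<le> A / s" for \<theta>
      proof -
        have x: "2 * pi * \<bar>\<theta>\<bar> \<le> 2 * pi * A / s" using \<theta> by (simp add: mult_left_mono flip: times_divide_eq_right)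
        have "(\<Sum>h\<in>H n. \<bar>2 * pi * \<theta> * real h\<bar>^3 * Ex1 h (\<lambda>k. \<bar>real k - mu h\<bar>^3) + (2 * pi * \<theta> * real h)^4 * (var1 h)^2)
            \<le> (\<Sum>h\<in>H n. ((2 * pi * \<bar>\<theta>\<bar>)^3 * real d ^ 4) * (real h ^ 3 * exp (- (r * real h)))
                 + ((2 * pi * \<bar>\<theta>\<bar>)^4 * real d ^ 5) * (real h ^ 4 * exp (- (r * real h))))"
        proof (rule sum_mono, rule add_mono)
          fix h
          have "Ex1 h (\<lambda>k. \<bar>real k - mu h\<bar>^3) \<le> real d * (real d ^ 3 * exp (- (r * real h)))"
            using third_moment_le[of h] var1_le[of h] by (meson mult_left_mono of_nat_0_le_iff order_trans)
          then have "(2 * pi * \<bar>\<theta>\<bar> * real h)^3 * Ex1 h (\<lambda>k. \<bar>real k - mu h\<bar>^3)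
              \<le> (2 * pi * \<bar>\<theta>\<bar> * real h)^3 * (real d * (real d ^ 3 * exp (- (r * real h))))"
            by (intro mult_left_mono) auto
          then show "\<bar>2 * pi * \<theta> * real h\<bar>^3 * Ex1 h (\<lambda>k. \<bar>real k - mu h\<bar>^3) \<le> ((2 * pi * \<bar>\<theta>\<bar>)^3 * real d ^ 4) * (real h ^ 3 * exp (- (r * real h)))"
            by (simp add: abs_mult power_mult_distrib eval_nat_numeral mult_ac)
          have "(2 * pi * \<bar>\<theta>\<bar> * real h)^4 * (var1 h)^2 \<le> (2 * pi * \<bar>\<theta>\<bar> * real h)^4 * (real d ^ 5 * exp (- (r * real h)))"
            by (intro mult_left_mono var1_square_le) auto
          moreover have "(2 * pi * \<theta> * real h)^4 = (2 * pi * \<bar>\<theta>\<bar> * real h)^4"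
            by (simp add: power_mult_distrib power_even_abs)
          ultimately show "(2 * pi * \<theta> * real h)^4 * (var1 h)^2 \<le> ((2 * pi * \<bar>\<theta>\<bar>)^4 * real d ^ 5) * (real h ^ 4 * exp (- (r * real h)))"
            by (simp add: power_mult_distrib mult_ac)
        qed
        also have "\<dots> = ((2 * pi * \<bar>\<theta>\<bar>)^3 * real d ^ 4) * (\<Sum>h\<in>H n. real h ^ 3 * exp (- (r * real h)))
            + ((2 * pi * \<bar>\<theta>\<bar>)^4 * real d ^ 5) * (\<Sum>h\<in>H n. real h ^ 4 * exp (- (r * real h)))"
          by (simp only: sum.distrib sum_distrib_left)
        also have "\<dots> \<le> ((2 * pi * A / s)^3 * real d ^ 4) * (k 3 * L * R ^ 3) + ((2 * pi * A / s)^4 * real d ^ 5) * (k 4 * L * R ^ 4)"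
          using x by (intro add_mono mult_mono power_mono Sq) (auto intro!: sum_nonneg simp: A(2) s(2) less_imp_le)
        also have "\<dots> = (2 * pi * A)^3 * real d ^ 4 * k 3 * (L * R ^ 3 / s ^ 3) + (2 * pi * A)^4 * real d ^ 5 * k 4 * (L * R ^ 4 / s ^ 4)"
          by (simp add: power_divide mult_ac)
        also have "L * R ^ 3 / s ^ 3 = 1 / sqrt L"
        proof -
          have "s ^ 3 = L * sqrt L * R ^ 3" unfolding s_eq using L1 by (simp add: power_mult_distrib power3_eq_cube)
          then show ?thesis using L1 R by (simp add: field_simps)
        qed
        also have "L * R ^ 4 / s ^ 4 = 1 / L"
        proof -
          have "s ^ 4 = (sqrt L ^ 2) ^ 2 * R ^ 4" unfolding s_eq power_mult_distrib power_mult[symmetric] by simp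
          then have "s ^ 4 = L^2 * R ^ 4" using L1 by simp
          then show ?thesis using L1 R by (simp add: field_simps power2_eq_square)
        qed
        also have "(2 * pi * A)^3 * real d ^ 4 * k 3 * (1 / sqrt L) + (2 * pi * A)^4 * real d ^ 5 * k 4 * (1 / L) \<le> \<delta>"
        proof -
          have "1 / L \<le> 1 / sqrt L" using L1 sqL by (intro divide_left_mono) auto
          then have "(2 * pi * A)^4 * real d ^ 5 * k 4 * (1 / L) \<le> (2 * pi * A)^4 * real d ^ 5 * k 4 * (1 / sqrt L)"
            using less_imp_le[OF k] A by (intro mult_left_mono mult_nonneg_nonneg) auto
          then show ?thesis unfolding \<delta>_def KK_def by (simp add: add_divide_distrib)
        qed
        finally show ?thesis .
      qed
      have var: "2 * pi^2 * (\<Sum>h\<in>H n. (real h)^2 * var1 h) \<le> C3 * s^2"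
      proof -
        have "(\<Sum>h\<in>H n. (real h)^2 * var1 h) \<le> (\<Sum>h\<in>H n. real d ^ 3 * (real h ^ 2 * exp (- (r * real h))))"
        proof (rule sum_mono)
          fix h
          have "(real h)^2 * var1 h \<le> (real h)^2 * (real d ^ 3 * exp (- (r * real h)))" by (intro mult_left_mono var1_le) auto
          then show "(real h)^2 * var1 h \<le> real d ^ 3 * (real h ^ 2 * exp (- (r * real h)))" by (simp add: mult_ac)
        qed
        also have "\<dots> = real d ^ 3 * (\<Sum>h\<in>H n. real h ^ 2 * exp (- (r * real h)))" by (rule sum_distrib_left[symmetric])
        also have "\<dots> \<le> real d ^ 3 * (k 2 * L * R ^ 2)" by (intro mult_left_mono Sq) auto
        finally have "2 * pi^2 * (\<Sum>h\<in>H n. (real h)^2 * var1 h) \<le> 2 * pi^2 * (real d ^ 3 * (k 2 * L * R ^ 2))"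
          by (intro mult_left_mono) auto
        also have "\<dots> = (2 * pi^2 * real d ^ 3 * k 2) * s^2"
          unfolding s_eq using L1 by (simp add: power_mult_distrib)
        also have "\<dots> \<le> C3 * s^2" using C3 by (intro mult_right_mono) auto
        finally show ?thesis .
      qed
      have nb: "norm (Ex (\<lambda>a. cis (2 * pi * \<theta> * real (rep_value (H n) a)))) \<le> exp (- c * (s * \<theta>)^2) + g \<theta>"
        if "\<bar>\<theta>\<bar> \<le> 1/2" for \<theta>
        using norm_Ex_cis_subset_le[OF EH decay, of \<theta>] gauss that
        unfolding s_def l_def R_def E_def gauss_majorant_def class_upto_def by (meson order_trans)
      have main: "(2 * exp (- C3) - 2 * pi * \<delta> * A - 2 * pi * exp (- c * A^2 / 2) / sqrt (c / 2)) / s - integral {-1/2..1/2} g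
          \<le> Ex (\<lambda>a. if rep_value (H n) a = n then 1 else 0)"
        by (rule local_limit_lower_bound[OF n_eq s(1) A(2) c C3(1) \<delta> moments var g(1) _ nb]) (use g(2) in auto)
      have "2 * pi * \<delta> * A \<le> exp (- C3) / 2"
      proof -
        have "4 * pi * A * KK * exp C3 \<le> sqrt L"
          using elim(1) lL real_sqrt_le_mono[of l L] unfolding l_def by linarith
        then show ?thesis using L1 unfolding \<delta>_def by (simp add: exp_minus field_simps)
      qed
      then have "2 * exp (- C3) - 2 * pi * \<delta> * A - 2 * pi * exp (- c * A^2 / 2) / sqrt (c / 2) \<ge> exp (- C3)"
        using A(1) by linarith
      then have "(2 * exp (- C3) - 2 * pi * \<delta> * A - 2 * pi * exp (- c * A^2 / 2) / sqrt (c / 2)) / s \<ge> exp (- C3) / s"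
        using s by (intro divide_right_mono) auto
      moreover have "integral {-1/2..1/2} g \<le> exp (- C3) / (2 * s)"
      proof -
        have "2 * exp C3 * s \<le> l ^ (5*m) * R"
        proof -
          have "2 * exp C3 * sqrt L \<le> l * l ^ (m - 1)"
            using elim(2) sqL l unfolding l_def[symmetric] L_def[symmetric] by (intro mult_mono) (use L1 in auto)
          also have "\<dots> = l ^ m" using m2 by (simp add: power_eq_if)
          also have "\<dots> \<le> l ^ (5*m)" using l by (intro power_increasing) auto
          finally show ?thesis unfolding s_eq using R by (simp add: mult_right_mono flip: mult.assoc)
        qed
        then have "1 / (l ^ (5*m) * R) \<le> 1 / (2 * exp C3 * s)" using s R l by (intro divide_left_mono mult_pos_pos) auto
        also have "\<dots> = exp (- C3) / (2 * s)" by (simp add: exp_minus field_simps)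
        finally show ?thesis using g(3) unfolding l_def R_def by linarith
      qed
      moreover have "exp (- C3) / s - exp (- C3) / (2 * s) = 1 / ((2 * exp C3) * s)"
        using s by (simp add: exp_minus field_simps)
      ultimately show "1 / ((2 * exp C3) * scale (ln (real n)) (1 / r)) \<le> hit_prob n r"
        using main unfolding hit_prob_def s_def l_def R_def by linarith
    qed
  qed
  then show ?thesis by (intro exI[of _ "2 * exp C3"]) auto
qed

text \<open>The two terms of the last bound come from the tail majorant and from the central arc,
  where the minimum is O(K R / R^2) on a length O(1 / R). The third clause becomes the density
  bound, the fourth the decoupling error.\<close>

definition core_bounds :: "real \<Rightarrow> real \<Rightarrow> nat \<Rightarrow> real \<Rightarrow> bool" where
  "core_bounds C2 C n r \<longleftrightarrow> 1 / r \<le> real n \<and> real n \<le> C * ln (real n) ^ (m - 1) * (1 / r) \<and>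
    1 / (C * scale (ln (real n)) (1 / r)) \<le> hit_prob n r \<and>
    (\<forall>e\<le>1. integral {-1/2..1/2} (\<lambda>\<theta>. exp (- eta * phase_defect (class_upto e (1 / r)) \<theta>))
        \<le> C / scale (ln (real n)) (1 / r)) \<and>
    (\<forall>e\<le>1. \<forall>K\<ge>0. integral {-1/2..1/2} (\<lambda>\<theta>. min 2 (4 * pi * K * \<bar>\<theta>\<bar>) *
          exp (- eta * phase_defect (smoothing C2 (ln (real n)) (1 / r) e) \<theta>))
        \<le> 2 / (ln (real n) ^ (5*m) * (1 / r)) + 32 * K / (1 / r)^2)"

lemma tilted_core:
  "\<exists>C2>0. \<exists>C\<ge>1. \<forall>\<^sub>F n in sequentially. \<exists>r>0. core_bounds C2 C n r"
proof -
  obtain C2 c where C2: "C2 > 0" and c: "c > 0" and ev1: "\<forall>\<^sub>F l in at_top. \<forall>R e. exp (l/2) \<le> R \<longrightarrow> R \<le> exp l \<longrightarrow> e \<le> 1 \<longrightarrow>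
    (\<exists>g. tail_majorant eta (smoothing C2 l R e) R (1 / (l ^ (5*m) * R)) g \<and> gauss_majorant c l R e g)"
    using smoothing_bounds by blast
  obtain C4 where C4: "C4 > 0" and ev2: "\<forall>\<^sub>F n in sequentially. \<forall>r g Q. r > 0 \<longrightarrow> 2 \<le> 1 / r \<longrightarrow> 1 / r \<le> real n \<longrightarrow> mean_value n r = real n \<longrightarrow>
    tail_majorant eta Q (1 / r) (1 / (ln (real n) ^ (5*m) * (1 / r))) g \<longrightarrow> gauss_majorant c (ln (real n)) (1 / r) 0 g \<longrightarrow>
    1 / (C4 * scale (ln (real n)) (1 / r)) \<le> hit_prob n r"
    using tilted_prob_lower[OF c] by blast
  obtain C5 where C5: "C5 > 0" and ev3: "\<forall>\<^sub>F n in sequentially. \<exists>r>0. 1 / r \<le> real n \<and> real n \<le> C5 * ln (real n) ^ (m - 1) * (1 / r)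
      \<and> mean_value n r = real n"
    using saddle_exists by blast
  have ev1': "\<forall>\<^sub>F n in sequentially. \<forall>R e. exp (ln (real n)/2) \<le> R \<longrightarrow> R \<le> exp (ln (real n)) \<longrightarrow> e \<le> 1 \<longrightarrow>
    (\<exists>g. tail_majorant eta (smoothing C2 (ln (real n)) R e) R (1 / (ln (real n) ^ (5*m) * R)) g \<and> gauss_majorant c (ln (real n)) R e g)"
    by (rule eventually_compose_filterlim[OF ev1 filterlim_ln_nat])
  have ev4: "\<forall>\<^sub>F n in sequentially. C5 * ln (real n) ^ (m - 1) * exp (ln (real n) / 2) \<le> real n" using C5 by real_asymp
  have ev5: "\<forall>\<^sub>F n in sequentially. exp (ln (real n) / 2) \<ge> 2" by real_asymp
  define C where "C = max (max C4 C5) (pi / sqrt c + 1) + 1"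
  have C: "C \<ge> 1" "C4 \<le> C" "C5 \<le> C" "pi / sqrt c + 1 \<le> C" unfolding C_def using C4 by linarith+
  have "\<forall>\<^sub>F n in sequentially. \<exists>r>0. core_bounds C2 C n r"
    using ev1' ev2 ev3 ev4 ev5 eventually_ge_at_top[of 3]
  proof eventually_elim
    case (elim n)
    define l where "l = ln (real n)"
    have l: "l \<ge> 1" unfolding l_def by (rule ln_ge_1[OF elim(6)])
    have L0: "l ^ (m - 1) \<ge> 1" using l by simp
    obtain r where r: "r > 0" "1 / r \<le> real n" "real n \<le> C5 * l ^ (m - 1) * (1 / r)" "mean_value n r = real n"
      using elim(3) unfolding l_def by blast
    define R where "R = 1 / r"
    have R0: "R > 0" using r by (simp add: R_def)
    \<comment> \<open>The saddle has R at least n / (C5 l ^ (m - 1)), far above sqrt n = exp (l /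
      2), so it lies in the range of the smoothing bounds.\<close>
    have "C5 * l ^ (m - 1) * exp (l / 2) \<le> C5 * l ^ (m - 1) * R" using elim(4) r(3) unfolding l_def R_def by linarith
    then have R1: "exp (l / 2) \<le> R" using C5 L0 by (simp add: mult_le_cancel_left_pos)
    have R2: "R \<le> exp l" using r(2) elim(6) by (simp add: R_def l_def)
    have R2': "2 \<le> R" using R1 elim(5) unfolding l_def by linarith
    define s where "s = scale l R"
    have s_eq: "s = sqrt (l ^ (m - 1)) * R" by (simp add: s_def scale_def)
    have s0: "s > 0" unfolding s_eq using L0 R0 by simp
    have G: "\<exists>g. tail_majorant eta (smoothing C2 l R e) R (1 / (l ^ (5*m) * R)) g \<and> gauss_majorant c l R e g" if "e \<le> 1" for e
      using elim(1) R1 R2 that unfolding l_def by blast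
    have p1: "real n \<le> C * l ^ (m - 1) * R"
    proof -
      have "C5 * l ^ (m - 1) * R \<le> C * l ^ (m - 1) * R" using C R0 L0 by (intro mult_right_mono) auto
      then show ?thesis using r(3) unfolding R_def by linarith
    qed
    have p2: "1 / (C * s) \<le> hit_prob n r"
    proof -
      obtain g where g: "tail_majorant eta (smoothing C2 l R 0) R (1 / (l ^ (5*m) * R)) g" "gauss_majorant c l R 0 g"
        using G[of 0] by auto
      have "1 / (C4 * s) \<le> hit_prob n r"
        using elim(2) r g R2' unfolding l_def s_def R_def by blast
      moreover have "1 / (C * s) \<le> 1 / (C4 * s)" using C C4 s0 by (intro divide_left_mono mult_right_mono) auto
      ultimately show ?thesis by linarith
    qed
    have p3: "integral {-1/2..1/2} (\<lambda>\<theta>. exp (- eta * phase_defect (class_upto e R) \<theta>)) \<le> C / s" if e: "e \<le> 1" for e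
    proof -
      obtain g where g: "continuous_on UNIV g" "integral {-1/2..1/2} g \<le> 1 / (l ^ (5*m) * R)"
        "\<And>\<theta>. \<bar>\<theta>\<bar> \<le> 1/2 \<Longrightarrow> exp (- eta * phase_defect (class_upto e R) \<theta>) \<le> exp (- c * (s * \<theta>)^2) + g \<theta>"
        using G[OF e] unfolding s_def tail_majorant_def gauss_majorant_def by blast
      have gi: "g integrable_on {-1/2..1/2}"
        by (rule integrable_continuous_real) (rule continuous_on_subset[OF g(1)], simp)
      have qi: "(\<lambda>\<theta>. 1 / (1 + (k * \<theta>)^2)) integrable_on {-1/2..1/2}" for k :: real
        by (intro integrable_continuous_real continuous_intros) (auto simp: add_pos_nonneg less_imp_neq[symmetric])
      have "integral {-1/2..1/2} (\<lambda>\<theta>. exp (- eta * phase_defect (class_upto e R) \<theta>))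
          \<le> integral {-1/2..1/2} (\<lambda>\<theta>. 1 / (1 + (sqrt c * s * \<theta>)^2) + g \<theta>)"
      proof (rule integral_le)
        fix \<theta> :: real assume "\<theta> \<in> {-1/2..1/2}"
        then have "\<bar>\<theta>\<bar> \<le> 1/2" by auto
        from g(3)[OF this] have "exp (- eta * phase_defect (class_upto e R) \<theta>) \<le> exp (- (c * (s * \<theta>)^2)) + g \<theta>" by simp
        also have "exp (- (c * (s * \<theta>)^2)) \<le> 1 / (1 + c * (s * \<theta>)^2)" by (rule exp_minus_le_inverse) (use c in simp)
        also have "c * (s * \<theta>)^2 = (sqrt c * s * \<theta>)^2" using c by (simp add: power_mult_distrib)
        finally show "exp (- eta * phase_defect (class_upto e R) \<theta>) \<le> 1 / (1 + (sqrt c * s * \<theta>)^2) + g \<theta>" by simp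
      next
        show "(\<lambda>\<theta>. exp (- eta * phase_defect (class_upto e R) \<theta>)) integrable_on {-1/2..1/2}"
          by (intro integrable_continuous_real continuous_intros)
        show "(\<lambda>\<theta>. 1 / (1 + (sqrt c * s * \<theta>)^2) + g \<theta>) integrable_on {-1/2..1/2}"
          by (intro integrable_add qi gi)
      qed
      also have "\<dots> = integral {-1/2..1/2} (\<lambda>\<theta>. 1 / (1 + (sqrt c * s * \<theta>)^2)) + integral {-1/2..1/2} g"
        by (rule integral_add[OF qi gi])
      also have "\<dots> \<le> pi / (sqrt c * s) + 1 / s"
      proof (rule add_mono)
        show "integral {-1/2..1/2} (\<lambda>\<theta>. 1 / (1 + (sqrt c * s * \<theta>)^2)) \<le> pi / (sqrt c * s)"
          by (rule integral_inverse_quadratic_le) (use c s0 in simp)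
        have "sqrt (l ^ (m - 1)) \<le> l ^ (5 * m)"
        proof -
          have "sqrt (l ^ (m - 1)) \<le> sqrt ((l ^ (m - 1))^2)" using L0 by (intro real_sqrt_le_mono) (simp add: self_le_power)
          also have "\<dots> = l ^ (m - 1)" using L0 by simp
          also have "\<dots> \<le> l ^ (5 * m)" using l by (intro power_increasing) auto
          finally show ?thesis .
        qed
        then have "s \<le> l ^ (5*m) * R" unfolding s_eq using R0 by (intro mult_right_mono) auto
        then have "1 / (l ^ (5*m) * R) \<le> 1 / s" using s0 by (intro divide_left_mono) auto
        then show "integral {-1/2..1/2} g \<le> 1 / s" using g(2) by linarith
      qed
      also have "\<dots> = (pi / sqrt c + 1) / s" by (simp add: add_divide_distrib)
      also have "\<dots> \<le> C / s" using C s0 by (intro divide_right_mono) auto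
      finally show ?thesis .
    qed
    have p4: "integral {-1/2..1/2} (\<lambda>\<theta>. min 2 (4 * pi * K * \<bar>\<theta>\<bar>) *
          exp (- eta * phase_defect (smoothing C2 l R e) \<theta>))
        \<le> 2 / (l ^ (5*m) * R) + 32 * K / R^2" if e: "e \<le> 1" and K: "K \<ge> 0" for e K
    proof -
      let ?Q = "smoothing C2 l R e"
      obtain g where g: "continuous_on UNIV g" "\<And>\<theta>. g \<theta> \<ge> 0" "integral {-1/2..1/2} g \<le> 1 / (l ^ (5*m) * R)"
        "\<And>\<theta>. \<bar>\<theta>\<bar> \<le> 1/2 \<Longrightarrow> 1 / (2*R) < \<bar>\<theta>\<bar> \<Longrightarrow> exp (- eta * phase_defect ?Q \<theta>) \<le> g \<theta>"
        using G[OF e] unfolding tail_majorant_def by blast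
      have gi: "g integrable_on {-1/2..1/2}"
        by (rule integrable_continuous_real) (rule continuous_on_subset[OF g(1)], simp)
      have qi: "(\<lambda>\<theta>. 1 / (1 + (k * \<theta>)^2)) integrable_on {-1/2..1/2}" for k :: real
        by (intro integrable_continuous_real continuous_intros) (auto simp: add_pos_nonneg less_imp_neq[symmetric])
      \<comment> \<open>The rational function is at least 1/2 in the central arc, so its multiple
        dominates the coupling there, and over the whole interval it integrates to O(1 / R).\<close>
      have "integral {-1/2..1/2} (\<lambda>\<theta>. min 2 (4 * pi * K * \<bar>\<theta>\<bar>) * exp (- eta * phase_defect ?Q \<theta>))
          \<le> integral {-1/2..1/2} (\<lambda>\<theta>. 2 * g \<theta> + (4 * pi * K / R) * (1 / (1 + (2 * R * \<theta>)^2)))"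
      proof (rule integral_le)
        fix \<theta> :: real assume "\<theta> \<in> {-1/2..1/2}"
        then have \<theta>: "\<bar>\<theta>\<bar> \<le> 1/2" by auto
        have nn: "(4 * pi * K / R) * (1 / (1 + (2 * R * \<theta>)^2)) \<ge> 0" using K R0 by (simp add: add_nonneg_nonneg)
        have e1: "exp (- eta * phase_defect ?Q \<theta>) \<le> 1" using eta_pos phase_defect_nonneg[of ?Q \<theta>] by simp
        show "min 2 (4 * pi * K * \<bar>\<theta>\<bar>) * exp (- eta * phase_defect ?Q \<theta>) \<le> 2 * g \<theta> + (4 * pi * K / R) * (1 / (1 + (2 * R * \<theta>)^2))"
        proof (cases "1 / (2*R) < \<bar>\<theta>\<bar>")
          case True
          have "min 2 (4 * pi * K * \<bar>\<theta>\<bar>) * exp (- eta * phase_defect ?Q \<theta>) \<le> 2 * g \<theta>"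
            using g(4)[OF \<theta> True] by (intro mult_mono) auto
          then show ?thesis using nn by linarith
        next
          case False
          have "min 2 (4 * pi * K * \<bar>\<theta>\<bar>) * exp (- eta * phase_defect ?Q \<theta>) \<le> (4 * pi * K * (1 / (2*R))) * 1"
          proof (rule mult_mono[OF _ e1])
            have "4 * pi * K * \<bar>\<theta>\<bar> \<le> 4 * pi * K * (1 / (2*R))" using False K by (intro mult_left_mono) auto
            then show "min 2 (4 * pi * K * \<bar>\<theta>\<bar>) \<le> 4 * pi * K * (1 / (2*R))" by (rule min.coboundedI2)
          qed (use K R0 in auto)
          also have "\<dots> = (4 * pi * K / R) * (1/2)" by simp
          also have "\<dots> \<le> (4 * pi * K / R) * (1 / (1 + (2 * R * \<theta>)^2))"
          proof (rule mult_left_mono)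
            have "\<bar>2 * R * \<theta>\<bar> \<le> 1" using False R0 by (simp add: abs_mult field_simps)
            then have "(2 * R * \<theta>)^2 \<le> 1" by (simp only: abs_square_le_1)
            then show "1/2 \<le> 1 / (1 + (2 * R * \<theta>)^2)" by (intro divide_left_mono) (auto simp: add_pos_nonneg)
          qed (use K R0 in auto)
          finally show ?thesis using g(2)[of \<theta>] by linarith
        qed
      next
        show "(\<lambda>\<theta>. min 2 (4 * pi * K * \<bar>\<theta>\<bar>) * exp (- eta * phase_defect ?Q \<theta>)) integrable_on {-1/2..1/2}"
          by (intro integrable_continuous_real continuous_intros)
        show "(\<lambda>\<theta>. 2 * g \<theta> + (4 * pi * K / R) * (1 / (1 + (2 * R * \<theta>)^2))) integrable_on {-1/2..1/2}"
          by (intro integrable_add integrable_on_mult_right qi gi)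
      qed
      also have "\<dots> = 2 * integral {-1/2..1/2} g + (4 * pi * K / R) * integral {-1/2..1/2} (\<lambda>\<theta>. 1 / (1 + (2 * R * \<theta>)^2))"
        by (subst integral_add) (simp_all only: integrable_on_mult_right qi gi integral_mult_right)
      also have "\<dots> \<le> 2 * (1 / (l ^ (5*m) * R)) + (4 * pi * K / R) * (pi / (2 * R))"
        by (intro add_mono mult_left_mono g(3) integral_inverse_quadratic_le) (use R0 K in auto)
      also have "\<dots> = 2 / (l ^ (5*m) * R) + 2 * (pi * pi) * (K / R^2)" by (simp add: power2_eq_square)
      also have "\<dots> \<le> 2 / (l ^ (5*m) * R) + 32 * (K / R^2)"
      proof -
        have "pi * pi \<le> 4 * 4" using pi_less_4 by (intro mult_mono) auto
        then have "2 * (pi * pi) * (K / R^2) \<le> 32 * (K / R^2)" using K by (intro mult_right_mono) auto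
        then show ?thesis by simp
      qed
      finally show ?thesis by simp
    qed
    show ?case
      by (rule exI[of _ r]) (use r(1,2) p1 p2 p3 p4 in \<open>simp only: core_bounds_def l_def s_def R_def; blast\<close>)
  qed
  then show ?thesis using C2 C(1) by blast
qed

end

section \<open>Conditioning on the represented integer\<close>

text \<open>\<open>T\<close> holds the small elements, \<open>U e\<close> the others of parity \<open>e\<close>. The smoothing set \<open>Q e\<close> decouples \<open>T\<close> from
  \<open>U (1 - e)\<close> up to the error \<open>\<epsilon>\<close>; the set \<open>E e\<close> shows that the conditioned law of the digits on \<open>U (1 - e)\<close>
  has density at most \<open>D\<close>.\<close>

locale conditioned_product = tilted_product d H r
  for d :: nat and H :: "nat set" and r :: real +
  fixes n :: nat and T :: "nat set" and U Q E :: "nat \<Rightarrow> nat set"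
    and \<eta> K D \<epsilon> \<rho> N0 N1 :: real
  assumes H_eq: "H = T \<union> U 0 \<union> U 1"
    and T_U: "e \<le> 1 \<Longrightarrow> T \<inter> U e = {}" and U_U: "U 0 \<inter> U 1 = {}"
    and Q: "e \<le> 1 \<Longrightarrow> Q e \<subseteq> U e" "e \<le> 1 \<Longrightarrow> char_decay \<eta> (Q e)"
    and E: "e \<le> 1 \<Longrightarrow> E e \<subseteq> H" "e \<le> 1 \<Longrightarrow> char_decay \<eta> (E e)" "e \<le> 1 \<Longrightarrow> U (1 - e) \<inter> E e = {}"
    and prob_pos: "Ex (\<lambda>a. if rep_value H a = n then 1 else 0) > (0::real)"
    and contig: "e \<le> 1 \<Longrightarrow> integral {-1/2..1/2} (\<lambda>\<theta>. exp (- \<eta> * phase_defect (E e) \<theta>))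
        \<le> D * Ex (\<lambda>a. if rep_value H a = n then 1 else 0)"
    and indep: "e \<le> 1 \<Longrightarrow> integral {-1/2..1/2} (\<lambda>\<theta>. min 2 (4 * pi * K * \<bar>\<theta>\<bar>) * exp (- \<eta> * phase_defect (Q e) \<theta>))
        \<le> \<epsilon> * Ex (\<lambda>a. if rep_value H a = n then 1 else 0)"
    and K_bound: "a \<in> digit_configs d H \<Longrightarrow> real (rep_value T a) \<le> K"
    and \<rho>_bound: "h \<in> T \<Longrightarrow> r * real h \<le> \<rho>"
    and N0: "real (card H) \<le> N0" and N1: "real (card (U 0 \<union> U 1)) \<le> N1"
    and eps_nonneg: "\<epsilon> \<ge> 0" and D_nonneg: "D \<ge> 0" and \<rho>_nonneg: "\<rho> \<ge> 0"
begin

definition prob :: real where "prob = Ex (\<lambda>a. if rep_value H a = n then 1 else 0)"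

definition CE :: "((nat \<Rightarrow> nat) \<Rightarrow> 'b::real_normed_field) \<Rightarrow> 'b" where
  "CE F = Ex (\<lambda>a. if rep_value H a = n then F a else 0) / of_real prob"

lemma prob_gt_0: "prob > 0" using prob_pos by (simp add: prob_def)

lemma CE_add:
  fixes f g :: "(nat \<Rightarrow> nat) \<Rightarrow> 'b::real_normed_field"
  shows "CE (\<lambda>a. f a + g a) = CE f + CE g"
proof -
  have "(\<lambda>a. if rep_value H a = n then f a + g a else 0) =
      (\<lambda>a. (if rep_value H a = n then f a else 0) + (if rep_value H a = n then g a else 0))" by auto
  then show ?thesis unfolding CE_def by (simp only: Ex_add add_divide_distrib)
qed

lemma CE_cmult:
  fixes c :: "'b::real_normed_field"
  shows "CE (\<lambda>a. c * f a) = c * CE f"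
proof -
  have "(\<lambda>a. if rep_value H a = n then c * f a else 0) = (\<lambda>a. c * (if rep_value H a = n then f a else 0))" by auto
  then show ?thesis unfolding CE_def by (simp only: Ex_cmult times_divide_eq_right)
qed

lemma CE_const:
  fixes c :: "'b::real_normed_field"
  shows "CE (\<lambda>a. c) = c"
proof -
  have "of_real prob = (Ex (\<lambda>a. if rep_value H a = n then 1 else 0) :: 'b)"
    unfolding prob_def Ex_def of_real_sum by (intro sum.cong) (auto simp: scaleR_conv_of_real)
  then have "CE (\<lambda>a. 1) = (1 :: 'b)" using prob_gt_0 unfolding CE_def by (metis divide_self_if less_irrefl of_real_eq_0_iff)
  then show ?thesis using CE_cmult[of c "\<lambda>_. 1"] by simp
qed

lemma CE_minus: "CE (\<lambda>a. - f a) = - CE f"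
  using CE_cmult[of "-1" f] by simp

lemma CE_diff: "CE (\<lambda>a. f a - g a) = CE f - CE g"
  using CE_add[of f "\<lambda>a. - g a"] CE_minus[of g] by simp

lemma CE_mono:
  fixes f g :: "(nat \<Rightarrow> nat) \<Rightarrow> real"
  assumes "\<And>a. a \<in> digit_configs d H \<Longrightarrow> f a \<le> g a"
  shows "CE f \<le> CE g"
  unfolding CE_def using prob_gt_0 assms by (auto intro!: divide_right_mono Ex_mono)

lemma CE_cong: "(\<And>a. a \<in> digit_configs d H \<Longrightarrow> f a = g a) \<Longrightarrow> CE f = CE g"
  unfolding CE_def Ex_def by (intro arg_cong2[where f = "(/)"] sum.cong) auto

lemma of_real_CE: "(of_real (CE f) :: complex) = CE (\<lambda>a. of_real (f a))"
proof -
  have "(\<lambda>a. complex_of_real (if rep_value H a = n then f a else 0)) =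
      (\<lambda>a. if rep_value H a = n then of_real (f a) else 0)" by auto
  then show ?thesis unfolding CE_def of_real_divide of_real_Ex by simp
qed

lemma norm_CE_le: "norm (CE f) \<le> CE (\<lambda>a. norm (f a))"
proof -
  have "norm (CE f) = norm (Ex (\<lambda>a. if rep_value H a = n then f a else 0)) / prob"
    unfolding CE_def using prob_gt_0 by (simp add: norm_divide)
  also have "\<dots> \<le> Ex (\<lambda>a. norm (if rep_value H a = n then f a else 0)) / prob"
    using prob_gt_0 by (intro divide_right_mono norm_Ex_le) auto
  also have "(\<lambda>a. norm (if rep_value H a = n then f a else 0)) = (\<lambda>a. if rep_value H a = n then norm (f a) else 0)"
    by auto
  finally show ?thesis unfolding CE_def by simp
qed

lemma abs_CE_le_const:
  fixes f :: "(nat \<Rightarrow> nat) \<Rightarrow> real"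
  assumes "\<And>a. a \<in> digit_configs d H \<Longrightarrow> \<bar>f a\<bar> \<le> B"
  shows "\<bar>CE f\<bar> \<le> B"
  using norm_CE_le[of f] CE_mono[of "\<lambda>a. norm (f a)" "\<lambda>_. B"] assms by (simp add: CE_const)

lemma subsets: "T \<subseteq> H" "e \<le> 1 \<Longrightarrow> U e \<subseteq> H" "e \<le> 1 \<Longrightarrow> Q e \<subseteq> H"
proof -
  show "T \<subseteq> H" using H_eq by blast
  show U: "e \<le> 1 \<Longrightarrow> U e \<subseteq> H" for e using H_eq by (cases "e = 0") (auto simp: le_Suc_eq)
  show "e \<le> 1 \<Longrightarrow> Q e \<subseteq> H" using U Q(1) by blast
qed

lemma U_disjoint: "e \<le> 1 \<Longrightarrow> U e \<inter> U (1 - e) = {}"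
  using U_U by (cases "e = 0") (auto simp: le_Suc_eq)

text \<open>\<open>E (1 - e)\<close> avoids the digits on \<open>U e\<close>. Its independent digits
  bound the chance of completing any given pattern on \<open>U e\<close> to the value
  \<open>n\<close> by \<open>D\<close> times the overall chance.\<close>

lemma CE_le_Ex:
  fixes F :: "(nat \<Rightarrow> nat) \<Rightarrow> real"
  assumes e: "e \<le> 1" and F: "\<And>a. F a \<ge> 0" "depends_on (U e) F"
  shows "CE F \<le> D * Ex F"
proof -
  have e': "1 - e \<le> 1" "1 - (1 - e) = e" using e by auto
  have "Ex (\<lambda>a. if rep_value H a = n then F a else 0) \<le> Ex F * integral {-1/2..1/2} (\<lambda>\<theta>. exp (- \<eta> * phase_defect (E (1 - e)) \<theta>))"
    by (rule Ex_restricted_le[OF F subsets(2)[OF e] E(1)[OF e'(1)] _ E(2)[OF e'(1)]]) (use E(3)[OF e'(1)] e'(2) in simp)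
  also have "\<dots> \<le> Ex F * (D * prob)"
    using contig[OF e'(1)] unfolding prob_def by (intro mult_left_mono Ex_nonneg F(1))
  finally show ?thesis unfolding CE_def using prob_gt_0 by (simp add: field_simps)
qed

text \<open>Both \<open>T\<close> and \<open>U e\<close> avoid the smoothing set
  \<open>Q (1 - e)\<close> of the other half. Only one half at a time can be decoupled from
  \<open>T\<close> in this way, since a function of both halves would involve the smoothing digits
  themselves.\<close>

lemma CE_indep_complex:
  fixes f g :: "(nat \<Rightarrow> nat) \<Rightarrow> complex"
  assumes e: "e \<le> 1"
    and f: "depends_on T f" "\<And>a. a \<in> digit_configs d H \<Longrightarrow> norm (f a) \<le> Bf"
    and g: "depends_on (U e) g" "\<And>a. a \<in> digit_configs d H \<Longrightarrow> norm (g a) \<le> Bg"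
    and B: "Bf \<ge> 0" "Bg \<ge> 0"
  shows "norm (CE (\<lambda>a. f a * g a) - Ex f * CE g) \<le> Bf * Bg * \<epsilon>"
proof -
  have e': "1 - e \<le> 1" using e by auto
  have disj: "T \<inter> U e = {}" "T \<inter> Q (1 - e) = {}" "U e \<inter> Q (1 - e) = {}"
    using T_U[OF e] T_U[OF e'] Q(1)[OF e'] U_disjoint[OF e] by blast+
  have "norm (Ex (\<lambda>a. if rep_value H a = n then f a * g a else 0) - Ex f * Ex (\<lambda>a. if rep_value H a = n then g a else 0))
      \<le> Bf * Bg * integral {-1/2..1/2} (\<lambda>\<theta>. min 2 (4 * pi * K * \<bar>\<theta>\<bar>) * exp (- \<eta> * phase_defect (Q (1 - e)) \<theta>))"
    by (rule Ex_indicator_indep[OF f g subsets(1) subsets(2)[OF e] subsets(3)[OF e'] disj Q(2)[OF e'] K_bound])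
  also have "\<dots> \<le> Bf * Bg * (\<epsilon> * prob)"
    using indep[OF e'] B unfolding prob_def by (intro mult_left_mono) auto
  finally have 1: "norm (Ex (\<lambda>a. if rep_value H a = n then f a * g a else 0) - Ex f * Ex (\<lambda>a. if rep_value H a = n then g a else 0))
      \<le> Bf * Bg * (\<epsilon> * prob)" .
  have "CE (\<lambda>a. f a * g a) - Ex f * CE g =
      (Ex (\<lambda>a. if rep_value H a = n then f a * g a else 0) - Ex f * Ex (\<lambda>a. if rep_value H a = n then g a else 0)) / of_real prob"
    unfolding CE_def by (simp add: diff_divide_distrib)
  then show ?thesis using 1 prob_gt_0 by (simp add: norm_divide divide_le_eq mult_ac)
qed

lemma CE_indep:
  fixes f g :: "(nat \<Rightarrow> nat) \<Rightarrow> real"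
  assumes e: "e \<le> 1"
    and f: "depends_on T f" "\<And>a. a \<in> digit_configs d H \<Longrightarrow> \<bar>f a\<bar> \<le> Bf"
    and g: "depends_on (U e) g" "\<And>a. a \<in> digit_configs d H \<Longrightarrow> \<bar>g a\<bar> \<le> Bg"
    and B: "Bf \<ge> 0" "Bg \<ge> 0"
  shows "\<bar>CE (\<lambda>a. f a * g a) - Ex f * CE g\<bar> \<le> Bf * Bg * \<epsilon>"
proof -
  have "norm (CE (\<lambda>a. complex_of_real (f a) * of_real (g a)) - Ex (\<lambda>a. complex_of_real (f a)) * CE (\<lambda>a. complex_of_real (g a))) \<le> Bf * Bg * \<epsilon>"
    by (rule CE_indep_complex[OF e depends_on_comp[OF f(1)] _ depends_on_comp[OF g(1)]]) (use f g B in auto)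
  then show ?thesis
    unfolding of_real_mult[symmetric] of_real_CE[symmetric] of_real_Ex[symmetric] of_real_diff[symmetric] norm_of_real .
qed

lemma CE_approx:
  fixes f :: "(nat \<Rightarrow> nat) \<Rightarrow> real"
  assumes f: "depends_on T f" "\<And>a. a \<in> digit_configs d H \<Longrightarrow> \<bar>f a\<bar> \<le> Bf" and B: "Bf \<ge> 0"
  shows "\<bar>CE f - Ex f\<bar> \<le> Bf * \<epsilon>"
  using CE_indep[of 0 f Bf "\<lambda>_. 1" 1] f B depends_on_const[of "U 0" "1::real"] by (simp add: CE_const)

section \<open>Decomposition of the digit sum and its conditional moments\<close>

definition Y :: "(nat \<Rightarrow> nat) \<Rightarrow> real" where "Y a = (\<Sum>h\<in>T. real (a h) - mu h)"
definition Z :: "nat \<Rightarrow> (nat \<Rightarrow> nat) \<Rightarrow> real" where "Z e a = (\<Sum>h\<in>U e. real (a h) - mu h)"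
definition X :: "(nat \<Rightarrow> nat) \<Rightarrow> real" where "X a = (\<Sum>h\<in>H. real (a h))"
definition VT :: real where "VT = (\<Sum>h\<in>T. var1 h)"

lemma finite_sets: "finite T" "e \<le> 1 \<Longrightarrow> finite (U e)"
  by (rule finite_subset[OF subsets(1) finH]) (rule finite_subset[OF subsets(2) finH])

lemma depends_Y: "depends_on T Y"
  unfolding Y_def[abs_def] by (rule depends_on_sum[where g = "\<lambda>h k. real k - mu h"]) simp

lemma depends_Z: "depends_on (U e) (Z e)"
  unfolding Z_def[abs_def] by (rule depends_on_sum[where g = "\<lambda>h k. real k - mu h"]) simp

lemma abs_centered_sum_le:
  assumes "a \<in> digit_configs d H" "V \<subseteq> H"
  shows "\<bar>\<Sum>h\<in>V. real (a h) - mu h\<bar> \<le> real d * real (card V)"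
proof -
  have "\<bar>\<Sum>h\<in>V. real (a h) - mu h\<bar> \<le> (\<Sum>h\<in>V. real d)"
    by (rule order_trans[OF sum_abs], rule sum_mono) (use assms abs_centered_le in \<open>auto simp: digit_configs_def\<close>)
  then show ?thesis by (simp add: mult.commute)
qed

lemma card_bounds: "real (card T) \<le> N0" "e \<le> 1 \<Longrightarrow> real (card (U e)) \<le> N1" "N1 \<ge> 0" "N0 \<ge> 0"
  "real (card (U 0 \<union> U 1)) \<le> N0"
proof -
  have "card T \<le> card H" by (rule card_mono[OF finH subsets(1)])
  then show "real (card T) \<le> N0" using N0 by linarith
  show "N1 \<ge> 0" "N0 \<ge> 0" using N0 N1 by (meson of_nat_0_le_iff order_trans)+
  have "card (U 0 \<union> U 1) \<le> card H" by (rule card_mono[OF finH]) (use H_eq in blast)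
  then show "real (card (U 0 \<union> U 1)) \<le> N0" using N0 by linarith
  show "real (card (U e)) \<le> N1" if "e \<le> 1" for e
  proof -
    have "card (U e) \<le> card (U 0 \<union> U 1)"
      by (rule card_mono) (use that finite_sets in \<open>auto simp: le_Suc_eq\<close>)
    then show ?thesis using N1 by linarith
  qed
qed

lemma abs_Y_le: "a \<in> digit_configs d H \<Longrightarrow> \<bar>Y a\<bar> \<le> real d * N0"
  unfolding Y_def using abs_centered_sum_le[OF _ subsets(1), of a] card_bounds(1)
  by (meson mult_left_mono of_nat_0_le_iff order_trans)

lemma abs_Z_le: assumes "e \<le> 1" "a \<in> digit_configs d H" shows "\<bar>Z e a\<bar> \<le> real d * N0"
proof -
  have "card (U e) \<le> card H" by (rule card_mono[OF finH subsets(2)[OF assms(1)]])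
  then have "real (card (U e)) \<le> N0" using N0 by linarith
  then show ?thesis unfolding Z_def using abs_centered_sum_le[OF assms(2) subsets(2)[OF assms(1)]]
    by (meson mult_left_mono of_nat_0_le_iff order_trans)
qed

lemma dN0: "real d * N0 \<ge> 0" using card_bounds by simp

lemma Ex_Y: "Ex Y = 0"
proof -
  have "Ex Y = (\<Sum>h\<in>T. Ex (\<lambda>a. real (a h) - mu h))" unfolding Y_def by (rule Ex_sum)
  also have "\<dots> = 0"
  proof (rule sum.neutral, rule ballI)
    fix h assume "h \<in> T"
    then have "h \<in> H" using subsets by blast
    then show "Ex (\<lambda>a. real (a h) - mu h) = 0"
      using Ex_single[of h real] by (simp add: Ex_diff Ex_const mu_def)
  qed
  finally show ?thesis .
qed

lemma abs_CE_Y_le: "\<bar>CE Y\<bar> \<le> real d * N0 * \<epsilon>"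
  using CE_approx[OF depends_Y abs_Y_le dN0] by (simp add: Ex_Y)

lemma abs_CE_Y_square_le: "\<bar>CE (\<lambda>a. (Y a)^2) - VT\<bar> \<le> (real d * N0)^2 * \<epsilon>"
proof -
  have "\<bar>(Y a)^2\<bar> \<le> (real d * N0)^2" if "a \<in> digit_configs d H" for a
    using abs_Y_le[OF that] dN0 by (simp add: abs_le_square_iff[symmetric])
  moreover have "Ex (\<lambda>a. (Y a)^2) = VT" unfolding Y_def VT_def by (rule Ex_centered_square[OF subsets(1)])
  ultimately show ?thesis
    using CE_approx[OF depends_on_comp[OF depends_Y, where g = "\<lambda>y. y^2"], of "(real d * N0)^2"] by simp
qed

lemma abs_CE_Y_Z_le: "e \<le> 1 \<Longrightarrow> \<bar>CE (\<lambda>a. Y a * Z e a)\<bar> \<le> (real d * N0)^2 * \<epsilon>"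
  using CE_indep[OF _ depends_Y abs_Y_le depends_Z abs_Z_le dN0 dN0, of e] by (simp add: Ex_Y power2_eq_square)

lemma CE_Z_square_le: assumes "e \<le> 1" shows "CE (\<lambda>a. (Z e a)^2) \<le> D * (real d ^ 2 * real (card (U e)))"
proof -
  have "CE (\<lambda>a. (Z e a)^2) \<le> D * Ex (\<lambda>a. (Z e a)^2)"
    by (rule CE_le_Ex[OF assms _ depends_on_comp[OF depends_Z]]) simp
  also have "Ex (\<lambda>a. (Z e a)^2) = (\<Sum>h\<in>U e. var1 h)"
    unfolding Z_def by (rule Ex_centered_square[OF subsets(2)[OF assms]])
  also have "D * (\<Sum>h\<in>U e. var1 h) \<le> D * (\<Sum>h\<in>U e. real d ^ 2)"
    using D_nonneg by (intro mult_left_mono sum_mono var1_le_d) auto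
  finally show ?thesis by (simp add: mult_ac)
qed

definition Zs :: "(nat \<Rightarrow> nat) \<Rightarrow> real" where "Zs a = Z 0 a + Z 1 a"

text \<open>The density bound treats one half at a time, and after conditioning the halves are not
  independent; so the square of the sum is bounded by twice the sum of the squares.\<close>

lemma CE_Zs_square_le: "CE (\<lambda>a. (Zs a)^2) \<le> 2 * D * real d ^ 2 * N1"
proof -
  have "(x + y)^2 \<le> 2 * x^2 + 2 * y^2" for x y :: real
    using zero_le_power2[of "x - y"] by (simp add: power2_eq_square algebra_simps)
  then have "CE (\<lambda>a. (Zs a)^2) \<le> CE (\<lambda>a. 2 * (Z 0 a)^2 + 2 * (Z 1 a)^2)"
    unfolding Zs_def by (intro CE_mono)
  also have "\<dots> = 2 * CE (\<lambda>a. (Z 0 a)^2) + 2 * CE (\<lambda>a. (Z 1 a)^2)" by (simp only: CE_add CE_cmult)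
  also have "\<dots> \<le> 2 * (D * (real d ^ 2 * real (card (U 0)))) + 2 * (D * (real d ^ 2 * real (card (U 1))))"
    using CE_Z_square_le[of 0] CE_Z_square_le[of 1] by linarith
  also have "\<dots> = 2 * D * real d ^ 2 * real (card (U 0 \<union> U 1))"
    using U_U finite_sets by (simp add: card_Un_disjoint algebra_simps)
  also have "\<dots> \<le> 2 * D * real d ^ 2 * N1"
    using N1 D_nonneg by (intro mult_left_mono) auto
  finally show ?thesis .
qed

lemma X_eq: "X a = Y a + Zs a + (\<Sum>h\<in>H. mu h)"
proof -
  have dis: "T \<inter> (U 0 \<union> U 1) = {}" using T_U[of 0] T_U[of 1] by auto
  have "(\<Sum>h\<in>H. f h) = (\<Sum>h\<in>T. f h) + ((\<Sum>h\<in>U 0. f h) + (\<Sum>h\<in>U 1. f h))" for f :: "nat \<Rightarrow> real"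
  proof -
    have "H = T \<union> (U 0 \<union> U 1)" using H_eq by blast
    then show ?thesis using dis U_U finite_sets by (simp add: sum.union_disjoint)
  qed
  from this[of "\<lambda>h. real (a h) - mu h"] show ?thesis
    unfolding X_def Y_def Zs_def Z_def by (simp add: sum_subtractf)
qed

lemma abs_Zs_le: assumes "a \<in> digit_configs d H" shows "\<bar>Zs a\<bar> \<le> real d * N0"
proof -
  have "Zs a = (\<Sum>h\<in>U 0 \<union> U 1. real (a h) - mu h)"
    unfolding Zs_def Z_def using U_U finite_sets by (simp add: sum.union_disjoint)
  moreover have "\<bar>\<Sum>h\<in>U 0 \<union> U 1. real (a h) - mu h\<bar> \<le> real d * real (card (U 0 \<union> U 1))"
    by (rule abs_centered_sum_le[OF assms]) (use subsets(2)[of 0] subsets(2)[of 1] in auto)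
  moreover have "real d * real (card (U 0 \<union> U 1)) \<le> real d * N0"
    by (intro mult_left_mono card_bounds(5)) simp
  ultimately show ?thesis by linarith
qed

lemma CE_X: "CE X = CE Y + CE Zs + (\<Sum>h\<in>H. mu h)"
  unfolding X_eq[abs_def] by (simp only: CE_add CE_const)

text \<open>After expansion, every term containing \<open>Y\<close> is controlled by \<epsilon>;
  what remains is the conditional variance of \<open>Zs\<close>, bounded by its second moment. The
  factor 8 counts the errors: 1 from the square of \<open>Y\<close>, 4 from the two cross terms, 1
  and 2 from the products of the mean of \<open>Y\<close> with itself and with the mean of
  \<open>Zs\<close>.\<close>

lemma variance_bound:
  "\<bar>CE (\<lambda>a. (X a - CE X)^2) - VT\<bar> \<le> 8 * (real d * N0)^2 * \<epsilon> + 2 * D * real d ^ 2 * N1"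
proof -
  let ?B = "(real d * N0)^2 * \<epsilon>"
  have "(X a - CE X)^2 = ((Y a)^2 + 2 * (Y a * Z 0 a) + 2 * (Y a * Z 1 a) + (Zs a)^2) - (2 * (CE Y + CE Zs)) * Y a
      - (2 * (CE Y + CE Zs)) * Zs a + (CE Y + CE Zs)^2" for a
    unfolding CE_X X_eq Zs_def by (simp add: power2_eq_square algebra_simps)
  then have "CE (\<lambda>a. (X a - CE X)^2) = (CE (\<lambda>a. (Y a)^2) + 2 * CE (\<lambda>a. Y a * Z 0 a) + 2 * CE (\<lambda>a. Y a * Z 1 a) + CE (\<lambda>a. (Zs a)^2))
      - (2 * (CE Y + CE Zs)) * CE Y - (2 * (CE Y + CE Zs)) * CE Zs + (CE Y + CE Zs)^2"
    by (simp only: CE_add CE_diff CE_cmult CE_const)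
  also have "\<dots> = CE (\<lambda>a. (Y a)^2) + 2 * CE (\<lambda>a. Y a * Z 0 a) + 2 * CE (\<lambda>a. Y a * Z 1 a)
      + (CE (\<lambda>a. (Zs a)^2) - (CE Zs)^2) - CE Y * CE Y - 2 * (CE Y * CE Zs)"
    by (simp add: power2_eq_square algebra_simps)
  finally have eq: "CE (\<lambda>a. (X a - CE X)^2) - VT = (CE (\<lambda>a. (Y a)^2) - VT) + 2 * CE (\<lambda>a. Y a * Z 0 a) + 2 * CE (\<lambda>a. Y a * Z 1 a)
      + (CE (\<lambda>a. (Zs a)^2) - (CE Zs)^2) - CE Y * CE Y - 2 * (CE Y * CE Zs)" by simp
  have YY: "\<bar>CE Y * c\<bar> \<le> ?B" if "\<bar>c\<bar> \<le> real d * N0" for c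
  proof -
    have "\<bar>CE Y * c\<bar> \<le> (real d * N0 * \<epsilon>) * (real d * N0)"
      unfolding abs_mult using abs_CE_Y_le that dN0 eps_nonneg by (intro mult_mono) auto
    then show ?thesis by (simp add: power2_eq_square mult_ac)
  qed
  have cY: "\<bar>CE Y\<bar> \<le> real d * N0" by (rule abs_CE_le_const[OF abs_Y_le])
  have cZ: "\<bar>CE Zs\<bar> \<le> real d * N0" by (rule abs_CE_le_const[OF abs_Zs_le])
  have jensen: "0 \<le> CE (\<lambda>a. (Zs a)^2) - (CE Zs)^2"
  proof -
    have "(Zs a - CE Zs)^2 = (Zs a)^2 - (2 * CE Zs) * Zs a + (CE Zs)^2" for a
      by (simp add: power2_eq_square algebra_simps)
    then have "CE (\<lambda>a. (Zs a - CE Zs)^2) = CE (\<lambda>a. (Zs a)^2) - (2 * CE Zs) * CE Zs + (CE Zs)^2"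
      by (simp only: CE_add CE_diff CE_cmult CE_const)
    moreover have "CE (\<lambda>a. (Zs a - CE Zs)^2) \<ge> 0"
      using CE_mono[of "\<lambda>_. 0" "\<lambda>a. (Zs a - CE Zs)^2"] by (simp add: CE_const)
    ultimately show ?thesis by (simp add: power2_eq_square)
  qed
  have "CE (\<lambda>a. (Zs a)^2) - (CE Zs)^2 \<le> 2 * D * real d ^ 2 * N1"
    using CE_Zs_square_le zero_le_power2[of "CE Zs"] by linarith
  then show ?thesis
    using eq abs_CE_Y_square_le abs_CE_Y_Z_le[of 0] abs_CE_Y_Z_le[of 1] YY[OF cY] YY[OF cZ] jensen
    unfolding mult.assoc[of 8] by linarith
qed

text \<open>The digits outside \<open>T\<close> are bounded trivially by \<open>d\<close> each;
  their number \<open>N1\<close> is already within the permitted error.\<close>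

lemma mean_bound:
  "\<bar>CE X - (real d - 1) / 2 * real (card T)\<bar> \<le> real d * N0 * \<epsilon> + N0 * (\<rho> * real d ^ 3) + real d * N1"
proof -
  have eqT: "(\<Sum>h\<in>T. real (a h)) = Y a + (\<Sum>h\<in>T. mu h)" for a by (simp add: Y_def sum_subtractf)
  have "X = (\<lambda>a. Y a + ((\<Sum>h\<in>T. mu h) + (\<Sum>h\<in>U 0 \<union> U 1. real (a h))))"
  proof
    fix a
    have "H = T \<union> (U 0 \<union> U 1)" "T \<inter> (U 0 \<union> U 1) = {}" using H_eq T_U[of 0] T_U[of 1] by auto
    then show "X a = Y a + ((\<Sum>h\<in>T. mu h) + (\<Sum>h\<in>U 0 \<union> U 1. real (a h)))"
      using eqT[of a] finite_sets unfolding X_def by (simp add: sum.union_disjoint)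
  qed
  then have "CE X = CE Y + ((\<Sum>h\<in>T. mu h) + CE (\<lambda>a. \<Sum>h\<in>U 0 \<union> U 1. real (a h)))"
    by (simp only: CE_add CE_const)
  moreover have "\<bar>CE (\<lambda>a. \<Sum>h\<in>U 0 \<union> U 1. real (a h))\<bar> \<le> real d * N1"
  proof (rule abs_CE_le_const)
    fix a assume a: "a \<in> digit_configs d H"
    have "(\<Sum>h\<in>U 0 \<union> U 1. real (a h)) \<le> (\<Sum>h\<in>U 0 \<union> U 1. real d)"
      by (rule sum_mono) (use a subsets(2)[of 0] subsets(2)[of 1] in \<open>auto simp: digit_configs_def subset_iff less_imp_le\<close>)
    also have "\<dots> = real d * real (card (U 0 \<union> U 1))" by (simp add: mult.commute)
    also have "\<dots> \<le> real d * N1" using N1 by (intro mult_left_mono) auto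
    finally show "\<bar>\<Sum>h\<in>U 0 \<union> U 1. real (a h)\<bar> \<le> real d * N1" by (simp add: sum_nonneg)
  qed
  moreover have "\<bar>(\<Sum>h\<in>T. mu h) - (real d - 1) / 2 * real (card T)\<bar> \<le> N0 * (\<rho> * real d ^ 3)"
  proof -
    have "(\<Sum>h\<in>T. mu h) - (real d - 1) / 2 * real (card T) = (\<Sum>h\<in>T. mu h - (real d - 1) / 2)"
      by (simp add: sum_subtractf)
    also have "\<bar>\<dots>\<bar> \<le> (\<Sum>h\<in>T. \<rho> * real d ^ 3)"
    proof (rule order_trans[OF sum_abs], rule sum_mono)
      fix h assume "h \<in> T"
      then have "r * real h * real d ^ 3 \<le> \<rho> * real d ^ 3" by (intro mult_right_mono \<rho>_bound) auto
      then show "\<bar>mu h - (real d - 1) / 2\<bar> \<le> \<rho> * real d ^ 3" using mu_approx[of h] by linarith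
    qed
    also have "\<dots> = real (card T) * (\<rho> * real d ^ 3)" by simp
    also have "\<dots> \<le> N0 * (\<rho> * real d ^ 3)" using card_bounds \<rho>_nonneg by (intro mult_right_mono) auto
    finally show ?thesis .
  qed
  ultimately show ?thesis using abs_CE_Y_le by linarith
qed

lemma VT_bound:
  "\<bar>VT - (real d - 1) * (real d + 1) / 12 * real (card T)\<bar> \<le> N0 * (3 * \<rho> * real d ^ 4)"
proof -
  have "VT - (real d - 1) * (real d + 1) / 12 * real (card T) = (\<Sum>h\<in>T. var1 h - (real d - 1) * (real d + 1) / 12)"
    by (simp add: VT_def sum_subtractf)
  also have "\<bar>\<dots>\<bar> \<le> (\<Sum>h\<in>T. 3 * \<rho> * real d ^ 4)"
  proof (rule order_trans[OF sum_abs], rule sum_mono)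
    fix h assume "h \<in> T"
    then have "3 * (r * real h) * real d ^ 4 \<le> 3 * \<rho> * real d ^ 4" by (intro mult_right_mono mult_left_mono \<rho>_bound) auto
    then show "\<bar>var1 h - (real d - 1) * (real d + 1) / 12\<bar> \<le> 3 * \<rho> * real d ^ 4" using var1_approx[of h] by linarith
  qed
  also have "\<dots> = real (card T) * (3 * \<rho> * real d ^ 4)" by simp
  also have "\<dots> \<le> N0 * (3 * \<rho> * real d ^ 4)" using card_bounds \<rho>_nonneg by (intro mult_right_mono) auto
  finally show ?thesis .
qed

text \<open>Three replacements: the centred digit sum by \<open>Y\<close>, at the cost of |\<tau>|
  times the mean modulus of the remaining terms; the conditioned law by the product law; the product
  by a Gaussian. The parameter \<open>q\<close> trades the second moment of \<open>Zs\<close> for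
  its first moment and is best taken of the order of the square root of that second moment.\<close>

lemma char_bound:
  assumes q: "q > 0"
  shows "norm (CE (\<lambda>a. cis (\<tau> * (X a - CE X))) - of_real (exp (- (\<tau>^2 * VT / 2))))
    \<le> \<bar>\<tau>\<bar> * (2 * D * real d ^ 2 * N1 / q + q + real d * N0 * \<epsilon>) + \<epsilon> + N0 * (\<bar>\<tau>\<bar>^3 * real d ^ 3 + \<tau>^4 * real d ^ 4)"
proof -
  define B where "B a = Zs a - CE Zs - CE Y" for a
  have XB: "X a - CE X = Y a + B a" for a unfolding CE_X X_eq B_def by simp
  have "norm (CE (\<lambda>a. cis (\<tau> * (X a - CE X))) - CE (\<lambda>a. cis (\<tau> * Y a))) \<le> CE (\<lambda>a. norm (cis (\<tau> * (X a - CE X)) - cis (\<tau> * Y a)))"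
    unfolding CE_diff[symmetric] by (rule norm_CE_le)
  also have "\<dots> \<le> CE (\<lambda>a. \<bar>\<tau>\<bar> * ((Zs a)^2 / (2 * q) + q / 2 + (\<bar>CE Zs\<bar> + \<bar>CE Y\<bar>)))"
  proof (rule CE_mono)
    fix a
    have "cis (\<tau> * (X a - CE X)) - cis (\<tau> * Y a) = cis (\<tau> * Y a) * (cis (\<tau> * B a) - 1)"
      unfolding XB by (simp add: right_diff_distrib cis_mult distrib_left)
    then have "norm (cis (\<tau> * (X a - CE X)) - cis (\<tau> * Y a)) \<le> \<bar>\<tau> * B a\<bar>"
      using norm_cis_diff_1_le[of "\<tau> * B a"] by (simp add: norm_mult)
    also have "\<dots> = \<bar>\<tau>\<bar> * \<bar>B a\<bar>" by (rule abs_mult)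
    also have "\<dots> \<le> \<bar>\<tau>\<bar> * ((Zs a)^2 / (2 * q) + q / 2 + (\<bar>CE Zs\<bar> + \<bar>CE Y\<bar>))"
    proof (rule mult_left_mono)
      \<comment> \<open>The inequality of arithmetic and geometric means serves in place of
        Cauchy-Schwarz for \<open>CE\<close>.\<close>
      have "2 * \<bar>Zs a\<bar> * q \<le> (Zs a)^2 + q^2"
        using zero_le_power2[of "\<bar>Zs a\<bar> - q"] by (simp add: power2_eq_square algebra_simps)
      then have "\<bar>Zs a\<bar> \<le> (Zs a)^2 / (2 * q) + q / 2" using q by (simp add: field_simps power2_eq_square)
      then show "\<bar>B a\<bar> \<le> (Zs a)^2 / (2 * q) + q / 2 + (\<bar>CE Zs\<bar> + \<bar>CE Y\<bar>)" unfolding B_def by linarith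
    qed simp
    finally show "norm (cis (\<tau> * (X a - CE X)) - cis (\<tau> * Y a)) \<le> \<bar>\<tau>\<bar> * ((Zs a)^2 / (2 * q) + q / 2 + (\<bar>CE Zs\<bar> + \<bar>CE Y\<bar>))" .
  qed
  also have "\<dots> = \<bar>\<tau>\<bar> * (CE (\<lambda>a. (Zs a)^2) / (2 * q) + q / 2 + (\<bar>CE Zs\<bar> + \<bar>CE Y\<bar>))"
    using CE_cmult[of "1 / (2 * q)" "\<lambda>a. (Zs a)^2"] by (simp add: CE_cmult CE_add CE_const)
  also have "\<dots> \<le> \<bar>\<tau>\<bar> * (2 * D * real d ^ 2 * N1 / q + q + real d * N0 * \<epsilon>)"
  proof (rule mult_left_mono)
    have z: "CE (\<lambda>a. (Zs a)^2) / (2 * q) \<le> (2 * D * real d ^ 2 * N1) / (2 * q)"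
      using CE_Zs_square_le q by (intro divide_right_mono) auto
    have "\<bar>CE Zs\<bar> \<le> CE (\<lambda>a. (1 / (2 * q)) * (Zs a)^2 + q / 2)"
    proof (rule order_trans[OF norm_CE_le[of Zs, unfolded real_norm_def]], rule CE_mono)
      fix a
      have "2 * \<bar>Zs a\<bar> * q \<le> (Zs a)^2 + q^2"
        using zero_le_power2[of "\<bar>Zs a\<bar> - q"] by (simp add: power2_eq_square algebra_simps)
      then show "\<bar>Zs a\<bar> \<le> (1 / (2 * q)) * (Zs a)^2 + q / 2" using q by (simp add: field_simps power2_eq_square)
    qed
    also have "\<dots> = CE (\<lambda>a. (Zs a)^2) / (2 * q) + q / 2" by (simp only: CE_add CE_cmult CE_const) simp
    finally have "\<bar>CE Zs\<bar> \<le> CE (\<lambda>a. (Zs a)^2) / (2 * q) + q / 2" .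
    moreover have "(2 * D * real d ^ 2 * N1) / (2 * q) + (2 * D * real d ^ 2 * N1) / (2 * q) = 2 * D * real d ^ 2 * N1 / q"
      using q by (simp add: field_simps)
    ultimately show "CE (\<lambda>a. (Zs a)^2) / (2 * q) + q / 2 + (\<bar>CE Zs\<bar> + \<bar>CE Y\<bar>) \<le> 2 * D * real d ^ 2 * N1 / q + q + real d * N0 * \<epsilon>"
      using z abs_CE_Y_le
      by (smt (verit, best) field_sum_of_halves)
  qed simp
  finally have 1: "norm (CE (\<lambda>a. cis (\<tau> * (X a - CE X))) - CE (\<lambda>a. cis (\<tau> * Y a)))
      \<le> \<bar>\<tau>\<bar> * (2 * D * real d ^ 2 * N1 / q + q + real d * N0 * \<epsilon>)" .
  have 2: "norm (CE (\<lambda>a. cis (\<tau> * Y a)) - Ex (\<lambda>a. cis (\<tau> * Y a))) \<le> \<epsilon>"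
    using CE_indep_complex[of 0 "\<lambda>a. cis (\<tau> * Y a)" 1 "\<lambda>_. 1" 1]
      depends_on_comp[OF depends_Y, where g = "\<lambda>y. cis (\<tau> * y)"] depends_on_const[of "U 0" "1::complex"]
    by (simp add: CE_const)
  have 3: "norm (Ex (\<lambda>a. cis (\<tau> * Y a)) - of_real (exp (- (\<tau>^2 * VT / 2)))) \<le> N0 * (\<bar>\<tau>\<bar>^3 * real d ^ 3 + \<tau>^4 * real d ^ 4)"
  proof -
    have e1: "(\<Sum>h\<in>T. \<tau> * (real (a h) - mu h)) = \<tau> * Y a" for a
      unfolding Y_def by (rule sum_distrib_left[symmetric])
    have e2: "- (\<Sum>h\<in>T. \<tau>^2 * var1 h) / 2 = - (\<tau>^2 * VT / 2)"
      unfolding VT_def by (simp add: sum_distrib_left)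
    have "norm (Ex (\<lambda>a. cis (\<tau> * Y a)) - of_real (exp (- (\<tau>^2 * VT / 2)))) \<le>
        (\<Sum>h\<in>T. \<bar>\<tau>\<bar>^3 * Ex1 h (\<lambda>k. \<bar>real k - mu h\<bar>^3) + \<tau>^4 * (var1 h)^2)"
      using norm_Ex_cis_gauss_le[OF subsets(1), of "\<lambda>_. \<tau>"] unfolding e1 e2 .
    also have "\<dots> \<le> (\<Sum>h\<in>T. \<bar>\<tau>\<bar>^3 * real d ^ 3 + \<tau>^4 * real d ^ 4)"
    proof (rule sum_mono, rule add_mono; rule mult_left_mono)
      fix h
      have "real d * var1 h \<le> real d * real d ^ 2" by (intro mult_left_mono var1_le_d) auto
      then show "Ex1 h (\<lambda>k. \<bar>real k - mu h\<bar>^3) \<le> real d ^ 3"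
        using third_moment_le[of h] by (simp add: power3_eq_cube power2_eq_square)
      have "(var1 h)^2 \<le> (real d ^ 2)^2" by (intro power_mono var1_le_d var1_nonneg)
      then show "(var1 h)^2 \<le> real d ^ 4" by (simp add: power_mult[symmetric])
    qed auto
    also have "\<dots> = real (card T) * (\<bar>\<tau>\<bar>^3 * real d ^ 3 + \<tau>^4 * real d ^ 4)" by simp
    also have "\<dots> \<le> N0 * (\<bar>\<tau>\<bar>^3 * real d ^ 3 + \<tau>^4 * real d ^ 4)"
      by (intro mult_right_mono card_bounds(1)) (auto intro!: add_nonneg_nonneg mult_nonneg_nonneg)
    finally show ?thesis .
  qed
  show ?thesis
    using norm_triangle_ineq[of "CE (\<lambda>a. cis (\<tau> * (X a - CE X))) - CE (\<lambda>a. cis (\<tau> * Y a))" "CE (\<lambda>a. cis (\<tau> * Y a)) - Ex (\<lambda>a. cis (\<tau> * Y a))"]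
      norm_triangle_ineq[of "CE (\<lambda>a. cis (\<tau> * (X a - CE X))) - Ex (\<lambda>a. cis (\<tau> * Y a))" "Ex (\<lambda>a. cis (\<tau> * Y a)) - of_real (exp (- (\<tau>^2 * VT / 2)))"]
      1 2 3 by simp
qed

end

section \<open>Random multi-base representations\<close>

text \<open>Two families of \<open>J\<close> rows each, with at most 1 + ln R terms per row because
  the ratios are at least 4 > e.\<close>

lemma card_smoothing_set_le:
  assumes ab: "a \<ge> 2" "b \<ge> 2" and R: "R \<ge> 1"
  shows "real (card (smoothing_set a b e J R)) \<le> 2 * (ln R + 1) * real J"
proof -
  define k0 where "k0 = nat \<lfloor>ln R\<rfloor>"
  have k: "k \<le> k0" if le: "real (c ^ (2*k) * x) \<le> R" and c: "c \<ge> 2" "x > 0" for c x k :: nat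
  proof -
    have "exp (real k) = exp 1 ^ k" by (simp add: exp_of_nat_mult[symmetric])
    also have "\<dots> \<le> 4 ^ k" using exp_le by (intro power_mono) auto
    also have "\<dots> = real (2 ^ (2 * k))" by (simp add: power_mult)
    also have "\<dots> \<le> real (c ^ (2*k) * x)"
    proof -
      have "2 ^ (2*k) \<le> c ^ (2*k)" using c by (intro power_mono) auto
      also have "\<dots> \<le> c ^ (2*k) * x" using c by simp
      finally show ?thesis by (simp only: of_nat_le_iff)
    qed
    finally have "exp (real k) \<le> R" using le by linarith
    then have "real k \<le> ln R" using R by (subst ln_ge_iff) auto
    then show ?thesis unfolding k0_def by (rule le_nat_floor)
  qed
  let ?f = "\<lambda>c c' (k, j). c ^ (2*k) * c' ^ (2*j+e) :: nat"
  have sub: "smoothing_set a b e J R \<subseteq> ?f a b ` ({..k0} \<times> {..<J}) \<union> ?f b a ` ({..k0} \<times> {..<J})"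
  proof
    fix h assume "h \<in> smoothing_set a b e J R"
    then obtain i j where h: "real h \<le> R" "j < J" "h = a ^ (2*i) * b ^ (2*j+e) \<or> h = b ^ (2*i) * a ^ (2*j+e)"
      by (auto simp: smoothing_set_def)
    from h(3) show "h \<in> ?f a b ` ({..k0} \<times> {..<J}) \<union> ?f b a ` ({..k0} \<times> {..<J})"
    proof
      assume eq: "h = a ^ (2*i) * b ^ (2*j+e)"
      then have "i \<le> k0" using k[of a i "b ^ (2*j+e)"] h ab by simp
      then show ?thesis using eq h(2) by (intro UnI1 image_eqI[of _ _ "(i, j)"]) auto
    next
      assume eq: "h = b ^ (2*i) * a ^ (2*j+e)"
      then have "i \<le> k0" using k[of b i "a ^ (2*j+e)"] h ab by simp
      then show ?thesis using eq h(2) by (intro UnI2 image_eqI[of _ _ "(i, j)"]) auto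
    qed
  qed
  have fin: "finite ({..k0} \<times> {..<J})" by simp
  have "card (smoothing_set a b e J R) \<le> card (?f a b ` ({..k0} \<times> {..<J}) \<union> ?f b a ` ({..k0} \<times> {..<J}))"
    by (rule card_mono[OF _ sub]) simp
  also have "\<dots> \<le> card (?f a b ` ({..k0} \<times> {..<J})) + card (?f b a ` ({..k0} \<times> {..<J}))" by (rule card_Un_le)
  also have "\<dots> \<le> card ({..k0} \<times> {..<J}) + card ({..k0} \<times> {..<J})" by (intro add_mono card_image_le fin)
  also have "\<dots> = 2 * (k0 + 1) * J" by simp
  finally have "real (card (smoothing_set a b e J R)) \<le> real (2 * (k0 + 1) * J)" by (simp only: of_nat_le_iff)
  also have "\<dots> = 2 * (real k0 + 1) * real J" by (simp add: algebra_simps)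
  also have "\<dots> \<le> 2 * (ln R + 1) * real J"
    using R unfolding k0_def by (intro mult_right_mono mult_left_mono add_mono of_nat_floor) auto
  finally show ?thesis .
qed

context multi_base
begin

text \<open>A nonzero digit at \<open>h\<close> contributes at least \<open>h\<close>, so only
  elements up to \<open>n\<close> can occur.\<close>

lemma mb_reps_eq: "mb_reps d p m n = {a \<in> digit_configs d (H n). rep_value (H n) a = n}"
proof (intro equalityI subsetI)
  fix a assume a: "a \<in> mb_reps d p m n"
  have fin: "finite {h. a h \<noteq> 0}" and sum: "(\<Sum>h\<in>{h. a h \<noteq> 0}. a h * h) = n"
    and lt: "\<And>h. a h < d" and S: "\<And>h. h \<notin> mb_S p m \<Longrightarrow> a h = 0"
    using a by (auto simp: mb_reps_def)
  have sup: "h \<in> H n" if "a h \<noteq> 0" for h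
  proof -
    have "h \<le> a h * h" using that by simp
    also have "\<dots> \<le> n" unfolding sum[symmetric]
      using member_le_sum[of h "{h. a h \<noteq> 0}" "\<lambda>h. a h * h"] that fin by simp
    finally show ?thesis using S[of h] that by (auto simp: H_def)
  qed
  have "rep_value (H n) a = (\<Sum>h\<in>{h. a h \<noteq> 0}. a h * h)" unfolding rep_value_def
    by (rule sum.mono_neutral_right[OF finite_H]) (use sup in auto)
  then show "a \<in> {a \<in> digit_configs d (H n). rep_value (H n) a = n}"
    using sum sup lt by (auto simp: digit_configs_def)
next
  fix a assume "a \<in> {a \<in> digit_configs d (H n). rep_value (H n) a = n}"
  then have a: "\<And>h. h \<in> H n \<Longrightarrow> a h < d" "\<And>h. h \<notin> H n \<Longrightarrow> a h = 0" and n: "rep_value (H n) a = n"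
    by (auto simp: digit_configs_def)
  have sub: "{h. a h \<noteq> 0} \<subseteq> H n"
  proof
    fix h assume "h \<in> {h. a h \<noteq> 0}"
    then show "h \<in> H n" using a(2)[of h] by auto
  qed
  have "(\<Sum>h\<in>{h. a h \<noteq> 0}. a h * h) = rep_value (H n) a" unfolding rep_value_def
    by (rule sum.mono_neutral_left[OF finite_H sub]) auto
  moreover have "a h < d" for h using a(1)[of h] a(2)[of h] d2 by (cases "h \<in> H n") auto
  moreover have "a h = 0" if "h \<notin> mb_S p m" for h using a(2)[of h] that by (auto simp: H_def)
  ultimately show "a \<in> mb_reps d p m n"
    using n finite_subset[OF sub finite_H] by (auto simp: mb_reps_def)
qed

lemma digit_sum_eq:
  assumes "a \<in> digit_configs d (H n)" shows "real (digit_sum a) = (\<Sum>h\<in>H n. real (a h))"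
proof -
  have "(\<Sum>h\<in>{h. a h \<noteq> 0}. a h) = (\<Sum>h\<in>H n. a h)"
    by (rule sum.mono_neutral_left[OF finite_H]) (use assms in \<open>force simp: digit_configs_def\<close>)+
  then show ?thesis by (simp add: digit_sum_def)
qed

text \<open>The weight of a configuration depends on it only through exp (- r * value), hence equals
  a constant \<open>W\<close> on all representations of \<open>n\<close>, which cancels in the
  quotient.\<close>

lemma expectation_mb_dist:
  fixes F :: "(nat \<Rightarrow> nat) \<Rightarrow> 'b::{real_normed_field,banach,second_countable_topology}"
  assumes pos: "tilted_Ex n r (\<lambda>a. if rep_value (H n) a = n then 1 else 0) > (0::real)"
  shows "measure_pmf.expectation (mb_dist d p m n) F =
    tilted_Ex n r (\<lambda>a. if rep_value (H n) a = n then F a else 0) /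
    of_real (tilted_Ex n r (\<lambda>a. if rep_value (H n) a = n then 1 else 0))"
proof -
  interpret digit_product d "H n" "\<lambda>h. tilt d (r * real h)"
    by (rule digit_product_tilt) (use d2 finite_H in auto)
  let ?R = "mb_reps d p m n"
  have fin: "finite ?R" unfolding mb_reps_eq using finite_digit_configs[OF finite_H] by simp
  define W where "W = exp (- r * real n) / (\<Prod>h\<in>H n. \<Sum>j<d. exp (- (r * real h) * real j))"
  have wt: "weight (H n) a = W" if "a \<in> ?R" for a
  proof -
    have "(\<Prod>h\<in>H n. exp (- (r * real h) * real (a h))) = exp (\<Sum>h\<in>H n. - (r * real h) * real (a h))"
      by (rule exp_sum[OF finite_H, symmetric])
    also have "(\<Sum>h\<in>H n. - (r * real h) * real (a h)) = - r * real (rep_value (H n) a)"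
      by (simp add: rep_value_def sum_distrib_left sum_negf mult_ac)
    also have "rep_value (H n) a = n" using that by (simp add: mb_reps_eq)
    finally show ?thesis unfolding weight_def tilt_def W_def by (simp add: prod_dividef)
  qed
  have Ex_eq: "Ex (\<lambda>a. if rep_value (H n) a = n then G a else 0) = W *\<^sub>R (\<Sum>a\<in>?R. G a)" for G :: "(nat \<Rightarrow> nat) \<Rightarrow> 'c::real_normed_field"
  proof -
    have "Ex (\<lambda>a. if rep_value (H n) a = n then G a else 0) = (\<Sum>a\<in>?R. weight (H n) a *\<^sub>R (if rep_value (H n) a = n then G a else 0))"
      unfolding Ex_def by (rule sum.mono_neutral_right[OF finite_digit_configs[OF finite_H]]) (auto simp: mb_reps_eq)
    also have "\<dots> = (\<Sum>a\<in>?R. W *\<^sub>R G a)" by (intro sum.cong refl) (use wt in \<open>auto simp: mb_reps_eq\<close>)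
    finally show ?thesis by (simp add: scaleR_right.sum)
  qed
  have p: "Ex (\<lambda>a. if rep_value (H n) a = n then 1 else 0) = W * real (card ?R)"
    using Ex_eq[of "\<lambda>_. 1::real"] by simp
  then have ne: "?R \<noteq> {}" and W: "W \<noteq> 0" using pos by auto
  have "measure_pmf.expectation (mb_dist d p m n) F = (\<Sum>a\<in>?R. pmf (pmf_of_set ?R) a *\<^sub>R F a)"
    unfolding mb_dist_def by (rule integral_measure_pmf[OF fin]) (use fin ne in auto)
  also have "\<dots> = (\<Sum>a\<in>?R. (1 / real (card ?R)) *\<^sub>R F a)"
    by (intro sum.cong refl) (use fin ne in \<open>simp add: pmf_of_set\<close>)
  also have "\<dots> = (\<Sum>a\<in>?R. F a) / of_nat (card ?R)"
    by (simp add: scaleR_conv_of_real sum_divide_distrib)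
  also have "\<dots> = (W *\<^sub>R (\<Sum>a\<in>?R. F a)) / of_real (W * real (card ?R))"
    using W by (simp add: scaleR_conv_of_real)
  finally show ?thesis unfolding Ex_eq by simp
qed

section \<open>Estimates for the digit sum of a random representation\<close>

definition simplex_denom :: real where "simplex_denom = fact m * (\<Prod>i<m. ln (real (p i)))"

lemma simplex_denom_pos: "simplex_denom > 0" unfolding simplex_denom_def
proof (intro mult_pos_pos prod_pos ballI)
  fix i assume "i \<in> {..<m}"
  then show "0 < ln (real (p i))" using p_ge2[of i] by simp
qed simp

text \<open>\<open>V\<close> will be the variance of the small digits under the product law. It is
  the variance of the approximating Gaussian, and the third clause ties it to the true
  variance.\<close>

definition estimates :: "real \<Rightarrow> nat \<Rightarrow> real \<Rightarrow> bool" where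
  "estimates C n V \<longleftrightarrow>
    \<bar>mb_mean d p m n - (real d - 1) / 2 * (ln (real n) ^ m / simplex_denom)\<bar>
       \<le> C * (ln (real n) ^ (m - 1) * ln (ln (real n))) \<and>
    \<bar>mb_var d p m n - (real d - 1) * (real d + 1) / 12 * (ln (real n) ^ m / simplex_denom)\<bar>
       \<le> C * (ln (real n) ^ (m - 1) * ln (ln (real n))) \<and>
    \<bar>mb_var d p m n - V\<bar> \<le> C * (ln (real n) ^ (m - 1) * ln (ln (real n))) \<and>
    (\<forall>\<tau>. norm (measure_pmf.expectation (mb_dist d p m n) (\<lambda>a. cis (\<tau> * (real (digit_sum a) - mb_mean d p m n))) - of_real (exp (- (\<tau>^2 * V / 2))))
       \<le> \<bar>\<tau>\<bar> * (C * (sqrt (ln (real n) ^ (m - 1) * ln (ln (real n))) + 1)) + C / ln (real n)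
          + C * ln (real n) ^ m * (\<bar>\<tau>\<bar>^3 + \<tau>^4))"

lemma conditioned_estimates:
  "\<exists>C>0. \<forall>\<^sub>F n in sequentially. \<exists>V. estimates C n V"
proof -
  obtain C2 C where C2: "C2 > 0" and C: "C \<ge> 1" and core: "\<forall>\<^sub>F n in sequentially. \<exists>r>0. core_bounds C2 C n r"
    using tilted_core by blast
  obtain CH where CH: "CH \<ge> 0" "\<And>n. n \<ge> 3 \<Longrightarrow> \<bar>real (card (H n)) - ln (real n) ^ m / simplex_denom\<bar> \<le> CH * ln (real n) ^ (m - 1)"
    using card_H_asymp unfolding simplex_denom_def by blast
  define c0 where "c0 = 1 / simplex_denom + CH"
  define c1 where "c1 = C * (2 + 32 * real d * c0)"
  define c2 where "c2 = 8 * (C2 + 1) + 3 ^ (m - 1) * (1 + 2 * (ln C + 6 * real m))"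
  have c0: "c0 > 0" using simplex_denom_pos CH by (simp add: c0_def add_pos_nonneg)
  have c1: "c1 > 0" using C c0 by (simp add: c1_def add_pos_nonneg)
  have c2: "c2 \<ge> 0" using C2 C by (auto simp: c2_def intro!: add_nonneg_nonneg mult_nonneg_nonneg)
  define B1 where "B1 = real d * c0 * c1 + c0 * real d ^ 3 + real d * c2 + real d * (c2 + CH)"
  define B2 where "B2 = 8 * (real d * c0)^2 * c1 + 2 * C^2 * real d ^ 2 * c2"
  define B3 where "B3 = 3 * c0 * real d ^ 4 + real d ^ 2 * (c2 + CH)"
  define B4 where "B4 = 2 * C^2 * real d ^ 2 * c2 + 1 + real d * c0 * c1"
  define B5 where "B5 = c0 * real d ^ 4"
  define CC where "CC = B1 + B2 + B3 + B4 + B5 + c1"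
  have Bpos: "B1 \<ge> 0" "B2 \<ge> 0" "B3 \<ge> 0" "B4 \<ge> 1" "B5 \<ge> 0"
    using c0 c1 c2 CH C by (auto simp: B1_def B2_def B3_def B4_def B5_def intro!: add_nonneg_nonneg mult_nonneg_nonneg)
  have ev2: "\<forall>\<^sub>F n in sequentially. ln (ln (real n)) \<ge> 1" by real_asymp
  have ev3: "\<forall>\<^sub>F n in sequentially. C * ln (real n) ^ (m - 1) \<le> real n" using C by real_asymp
  have "\<forall>\<^sub>F n in sequentially. \<exists>V. estimates CC n V"
    using core ev2 eventually_ge_at_top[of 3] ev3
  proof eventually_elim
    case (elim n)
    define l where "l = ln (real n)"
    have l: "l \<ge> 1" unfolding l_def by (rule ln_ge_1[OF elim(3)])
    have ll: "ln l \<ge> 1" using elim(2) by (simp add: l_def)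
    define g where "g = l ^ (m - 1) * ln l"
    have L1: "l ^ (m - 1) \<ge> 1" using l by simp
    have lpos: "l ^ k > 0" "l ^ k \<ge> 1" for k using l by auto
    have gL: "l ^ (m - 1) \<le> g" unfolding g_def using mult_left_mono[OF ll, of "l ^ (m - 1)"] L1 by simp
    have g1: "g \<ge> 1" using gL L1 by linarith
    have lm: "l ^ m = l * l ^ (m - 1)" using m2 by (simp add: power_eq_if)
    obtain r where r0: "r > 0" and core: "core_bounds C2 C n r" using elim(1) by blast
    have r: "r > 0" "1 / r \<le> real n" "real n \<le> C * l ^ (m - 1) * (1 / r)" "1 / (C * scale l (1 / r)) \<le> hit_prob n r"
      and cont: "\<And>e. e \<le> 1 \<Longrightarrow> integral {-1/2..1/2} (\<lambda>\<theta>. exp (- eta * phase_defect (class_upto e (1 / r)) \<theta>)) \<le> C / scale l (1 / r)"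
      and ind: "\<And>e K. e \<le> 1 \<Longrightarrow> K \<ge> 0 \<Longrightarrow> integral {-1/2..1/2} (\<lambda>\<theta>. min 2 (4 * pi * K * \<bar>\<theta>\<bar>) *
          exp (- eta * phase_defect (smoothing C2 l (1 / r) e) \<theta>)) \<le> 2 / (l ^ (5*m) * (1 / r)) + 32 * K / (1 / r)^2"
      using core r0 unfolding l_def core_bounds_def by auto
    define R where "R = 1 / r"
    have R0: "R > 0" using r by (simp add: R_def)
    have rR: "r * real h = real h / R" for h using r by (simp add: R_def)
    define s where "s = scale l R"
    have s_eq: "s = sqrt (l ^ (m - 1)) * R" by (simp add: s_def scale_def)
    have s0: "s > 0" unfolding s_eq using L1 R0 by simp
    have s_le: "s \<le> l ^ m * R"
    proof -
      have "sqrt (l ^ (m - 1)) \<le> sqrt ((l ^ (m - 1))^2)" using L1 by (intro real_sqrt_le_mono) (simp add: self_le_power)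
      also have "\<dots> = l ^ (m - 1)" using L1 by simp
      also have "\<dots> \<le> l ^ m" using l by (intro power_increasing) auto
      finally show ?thesis unfolding s_eq using R0 by (intro mult_right_mono) auto
    qed
    define pr where "pr = hit_prob n r"
    have pr: "1 / (C * s) \<le> pr" using r(4) unfolding pr_def s_def R_def .
    have pr0: "pr > 0" using pr C s0 by (smt (verit) mult_pos_pos zero_less_divide_1_iff)
    have R1: "R \<ge> 1"
    proof -
      have "C * l ^ (m - 1) * 1 \<le> C * l ^ (m - 1) * R" using elim(4) r(3) unfolding l_def R_def by linarith
      then show ?thesis using C L1 by (simp only: mult_le_cancel_left_pos[OF mult_pos_pos] lpos)
    qed
    define J where "J = nat \<lceil>C2 * ln l\<rceil>"
    define Q where "Q e = smoothing_set (p 0) (p 1) e J R" for e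
    \<comment> \<open>Low enough for the values on \<open>T\<close> to perturb the phases
      negligibly, yet within a power of l of \<open>n\<close>, so that only O(l ^ (m - 1) ln l)
      elements lie above it.\<close>
    define M1 where "M1 = R / l ^ (5*m)"
    \<comment> \<open>Both smoothing sets are removed from \<open>T\<close>, so that each
      \<open>Q e\<close> ends up inside \<open>U e\<close>.\<close>
    define T where "T = {h \<in> H n. real h \<le> M1} - Q 0 - Q 1"
    define U where "U e = (H n - T) \<inter> parity_class e" for e
    define E where "E e = {h \<in> parity_class e. real h \<le> R}" for e
    define K where "K = real d * (M1 * (c0 * l ^ m))"
    \<comment> \<open>The exponent leaves room for the factor N0^2, of order l ^ (2 m), in the
      variance bound.\<close>
    define \<epsilon> where "\<epsilon> = c1 / l ^ (3*m)"
    define \<rho> where "\<rho> = 1 / l ^ (5*m)"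
    define N0 where "N0 = c0 * l ^ m"
    define N1 where "N1 = c2 * g"
    have Rn: "R \<le> real n" using r(2) by (simp add: R_def)
    have M1: "0 < M1" "M1 \<le> R"
    proof -
      show "0 < M1" using R0 lpos by (simp add: M1_def)
      have "M1 \<le> R / 1" unfolding M1_def using R0 lpos by (intro divide_left_mono) auto
      then show "M1 \<le> R" by simp
    qed
    have cardH: "real (card (H n)) \<le> N0"
    proof -
      have "CH * l ^ (m - 1) \<le> CH * l ^ m" using CH(1) l by (intro mult_left_mono power_increasing) auto
      then show ?thesis using CH(2)[OF elim(3)] unfolding N0_def c0_def l_def by (simp add: algebra_simps abs_le_iff)
    qed
    have EH: "E e \<subseteq> H n" for e using parity_class_subset[of e] Rn by (auto simp: E_def H_def)
    have Q_par: "Q e \<subseteq> parity_class e" if "e \<le> 1" for e unfolding Q_def by (rule smoothing_set_subset[OF that])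
    have Q_R: "real h \<le> R" if "h \<in> Q e" for h e using that by (simp add: Q_def smoothing_set_def)
    have QE: "Q e \<subseteq> E e" if "e \<le> 1" for e using Q_par[OF that] Q_R by (auto simp: E_def)
    have T_H: "T \<subseteq> H n" by (auto simp: T_def)
    have H_par: "H n \<subseteq> parity_class 0 \<union> parity_class 1" using mb_S_parity by (auto simp: H_def)
    have par_disj: "parity_class e \<inter> parity_class e' = {}" if "e \<noteq> e'" for e e' by (rule parity_class_disjoint[OF that])
    interpret tp: tilted_product d "H n" r
      by unfold_locales (use d2 finite_H r in auto)
    have f1: "H n = T \<union> U 0 \<union> U 1" using T_H H_par by (auto simp: U_def)
    have f2: "T \<inter> U e = {}" for e by (auto simp: U_def)
    have f3: "U 0 \<inter> U 1 = {}" using par_disj[of 0 1] by (auto simp: U_def)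
    have f4: "Q e \<subseteq> U e" if "e \<le> 1" for e
    proof -
      have "e = 0 \<or> e = 1" using that by auto
      then have "Q e \<inter> T = {}" by (auto simp: T_def)
      then show ?thesis using Q_par[OF that] QE[OF that] EH[of e] by (auto simp: U_def)
    qed
    have f5: "tp.char_decay eta (E e)" for e unfolding eta_def
      by (rule tp.char_decay_tilt) (use R0 in \<open>auto simp: E_def rR\<close>)
    have f6: "tp.char_decay eta (Q e)" if "e \<le> 1" for e
      using f5[of e] QE[OF that] unfolding tp.char_decay_def by blast
    have f7: "U (1 - e) \<inter> E e = {}" if "e \<le> 1" for e
    proof -
      have "1 - e \<noteq> e" using that by presburger
      from par_disj[OF this] show ?thesis by (auto simp: U_def E_def)
    qed
    have f8: "tp.Ex (\<lambda>a. if rep_value (H n) a = n then 1 else 0) > (0::real)" using pr0 unfolding pr_def hit_prob_def .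
    have f9: "integral {-1/2..1/2} (\<lambda>\<theta>. exp (- eta * phase_defect (E e) \<theta>)) \<le> C^2 * tp.Ex (\<lambda>a. if rep_value (H n) a = n then 1 else 0)"
      if "e \<le> 1" for e
    proof -
      \<comment> \<open>The density constant is C^2: an upper bound C / s for completing a pattern,
        against the lower bound 1 / (C s) for the hitting probability.\<close>
      have "C / s = C^2 * (1 / (C * s))" using C by (simp add: power2_eq_square)
      also have "\<dots> \<le> C^2 * pr" by (intro mult_left_mono pr) simp
      finally show ?thesis using cont[OF that] unfolding E_def s_def R_def pr_def hit_prob_def class_upto_def by linarith
    qed
    have K0: "K \<ge> 0" using M1 c0 lpos less_imp_le by (auto simp: K_def intro!: mult_nonneg_nonneg)
    have f10: "integral {-1/2..1/2} (\<lambda>\<theta>. min 2 (4 * pi * K * \<bar>\<theta>\<bar>) * exp (- eta * phase_defect (Q e) \<theta>))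
        \<le> \<epsilon> * tp.Ex (\<lambda>a. if rep_value (H n) a = n then 1 else 0)" if "e \<le> 1" for e
    proof -
      have "integral {-1/2..1/2} (\<lambda>\<theta>. min 2 (4 * pi * K * \<bar>\<theta>\<bar>) * exp (- eta * phase_defect (Q e) \<theta>))
          \<le> 2 / (l ^ (5*m) * R) + 32 * K / R^2" using ind[OF that K0] unfolding Q_def J_def R_def smoothing_def .
      also have "32 * K / R^2 = 32 * real d * c0 * l ^ m / (l ^ (5*m) * R)"
        unfolding K_def M1_def using R0 by (simp add: power2_eq_square field_simps)
      also have "2 / (l ^ (5*m) * R) + 32 * real d * c0 * l ^ m / (l ^ (5*m) * R) = (2 + 32 * real d * c0 * l ^ m) / (l ^ (5*m) * R)"
        by (simp add: add_divide_distrib)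
      also have "\<dots> \<le> ((2 + 32 * real d * c0) * l ^ m) / (l ^ (5*m) * R)"
        using lpos(2)[of m] lpos(1) R0 by (intro divide_right_mono) (auto simp: distrib_right intro!: mult_nonneg_nonneg less_imp_le)
      also have "\<dots> = (2 + 32 * real d * c0) / (l ^ (3*m) * (l ^ m * R))"
      proof -
        have "l ^ (5*m) = l ^ (3*m) * l ^ m * l ^ m" by (simp add: power_add[symmetric])
        then show ?thesis using lpos(1)[of m] by simp
      qed
      also have "\<dots> \<le> (2 + 32 * real d * c0) / (l ^ (3*m) * s)"
        using s_le s0 lpos(1) c0 by (intro divide_left_mono mult_left_mono mult_pos_pos add_nonneg_nonneg mult_nonneg_nonneg) (auto simp: less_imp_le R0)
      also have "\<dots> = \<epsilon> * (1 / (C * s))" unfolding \<epsilon>_def c1_def using C by simp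
      also have "\<dots> \<le> \<epsilon> * pr" using c1 lpos(1) by (intro mult_left_mono pr) (auto simp: \<epsilon>_def less_imp_le)
      finally show ?thesis unfolding pr_def hit_prob_def .
    qed
    have f11: "real (rep_value T a) \<le> K" if a: "a \<in> digit_configs d (H n)" for a
    proof -
      have "real (rep_value T a) = (\<Sum>h\<in>T. real (a h) * real h)" by (simp add: rep_value_def)
      also have "\<dots> \<le> (\<Sum>h\<in>T. real d * M1)"
      proof (rule sum_mono, rule mult_mono)
        fix h assume h: "h \<in> T"
        then have "h \<in> H n" using T_H by blast
        then show "real (a h) \<le> real d" using a by (simp add: digit_configs_def less_imp_le)
        show "real h \<le> M1" using h by (simp add: T_def)
      qed auto
      also have "\<dots> = real d * (M1 * real (card T))" by simp
      also have "\<dots> \<le> real d * (M1 * N0)"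
      proof -
        have "card T \<le> card (H n)" by (rule card_mono[OF finite_H T_H])
        then have "real (card T) \<le> N0" using cardH by linarith
        then show ?thesis using M1 by (intro mult_left_mono) auto
      qed
      finally show ?thesis unfolding K_def N0_def .
    qed
    have f12: "r * real h \<le> \<rho>" if "h \<in> T" for h
    proof -
      have "real h / R \<le> M1 / R" using that R0 by (intro divide_right_mono) (auto simp: T_def)
      then show ?thesis unfolding rR \<rho>_def M1_def using R0 by simp
    qed
    have f13: "real (card (U 0 \<union> U 1)) \<le> N1"
    proof -
      have J_le: "real J \<le> (C2 + 1) * ln l"
      proof -
        have "real J \<le> C2 * ln l + 1" unfolding J_def using C2 ll by (simp add: of_nat_nat)
        then show ?thesis using ll by (simp add: distrib_right)
      qed
      have cQ: "real (card (Q e)) \<le> 4 * (C2 + 1) * g" for e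
      proof -
        have "ln R \<le> l" unfolding l_def using Rn R0 by (simp add: ln_mono)
        then have lnR: "ln R + 1 \<le> 2 * l" using l by linarith
        have p01: "p 0 \<ge> 2" "p 1 \<ge> 2" using p_ge2[of 0] p_ge2[of 1] m2 by auto
        have "real (card (Q e)) \<le> 2 * (ln R + 1) * real J" unfolding Q_def
          by (rule card_smoothing_set_le[OF p01 R1])
        also have "\<dots> \<le> 2 * (2 * l) * ((C2 + 1) * ln l)"
          using lnR J_le l R1 by (intro mult_mono) auto
        also have "\<dots> = 4 * (C2 + 1) * (l * ln l)" by simp
        also have "\<dots> \<le> 4 * (C2 + 1) * g" unfolding g_def
          using C2 ll l m2 by (intro mult_left_mono mult_right_mono self_le_power) auto
        finally show ?thesis .
      qed
      have above: "real (card {h \<in> H n. M1 < real h}) \<le> 3 ^ (m - 1) * (1 + 2 * (ln C + 6 * real m)) * g"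
      proof -
        have "real n / M1 = real n / R * l ^ (5*m)" unfolding M1_def by simp
        also have "\<dots> \<le> C * l ^ (m - 1) * l ^ (5*m)"
          using r(3) R0 lpos(1) unfolding R_def[symmetric] by (intro mult_right_mono) (auto simp: divide_le_eq less_imp_le)
        also have "\<dots> \<le> C * l ^ (6*m)"
        proof -
          have "l ^ (m - 1) * l ^ (5*m) \<le> l ^ (6*m)" unfolding power_add[symmetric] using l by (intro power_increasing) auto
          then show ?thesis using C by (simp add: mult.assoc)
        qed
        finally have "ln (real n / M1) \<le> ln (C * l ^ (6*m))"
          using M1 elim(3) C lpos(1) by (intro ln_mono) auto
        also have "\<dots> = ln C + 6 * real m * ln l" using C lpos(1) l by (simp add: ln_mult ln_realpow)
        also have "\<dots> \<le> (ln C + 6 * real m) * ln l"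
          using ll C mult_left_mono[OF ll, of "ln C"] by (simp add: distrib_right)
        finally have "1 + 2 * ln (real n / M1) \<le> (1 + 2 * (ln C + 6 * real m)) * ln l"
          using ll by (simp add: distrib_right)
        then have "3 ^ (m - 1) * l ^ (m - 1) * (1 + 2 * ln (real n / M1))
            \<le> 3 ^ (m - 1) * l ^ (m - 1) * ((1 + 2 * (ln C + 6 * real m)) * ln l)"
          using lpos by (intro mult_left_mono) (auto simp: less_imp_le)
        moreover have "real (card {h \<in> H n. M1 < real h}) \<le> 3 ^ (m - 1) * l ^ (m - 1) * (1 + 2 * ln (real n / M1))"
          unfolding l_def by (rule card_H_above_le[OF elim(3)]) (use M1 Rn in auto)
        ultimately show ?thesis unfolding g_def by (simp add: mult_ac)
      qed
      have "U 0 \<union> U 1 \<subseteq> (Q 0 \<union> Q 1) \<union> {h \<in> H n. M1 < real h}" by (auto simp: U_def T_def)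
      then have "card (U 0 \<union> U 1) \<le> card ((Q 0 \<union> Q 1) \<union> {h \<in> H n. M1 < real h})"
        by (rule card_mono[rotated]) (auto simp: Q_def finite_smoothing_set finite_H)
      also have "\<dots> \<le> card (Q 0 \<union> Q 1) + card {h \<in> H n. M1 < real h}" by (rule card_Un_le)
      also have "\<dots> \<le> card (Q 0) + card (Q 1) + card {h \<in> H n. M1 < real h}" using card_Un_le[of "Q 0" "Q 1"] by simp
      finally have "real (card (U 0 \<union> U 1)) \<le> real (card (Q 0)) + real (card (Q 1)) + real (card {h \<in> H n. M1 < real h})" by linarith
      also have "\<dots> \<le> 4 * (C2 + 1) * g + 4 * (C2 + 1) * g + 3 ^ (m - 1) * (1 + 2 * (ln C + 6 * real m)) * g"
        by (intro add_mono cQ above)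
      also have "\<dots> = N1" unfolding N1_def c2_def by (simp add: algebra_simps)
      finally show ?thesis .
    qed
    have f14: "\<epsilon> \<ge> 0" "C^2 \<ge> 0" "\<rho> \<ge> 0" using c1 lpos(1) by (auto simp: \<epsilon>_def \<rho>_def less_imp_le)
    interpret cp: conditioned_product d "H n" r n T U Q E eta K "C^2" \<epsilon> \<rho> N0 N1
      by unfold_locales (rule f1 f2 f3 f4 f5 f6 f7 f8 f9 f10 f11 f12 f13 f14 cardH EH; assumption)+
    have exp_CE: "measure_pmf.expectation (mb_dist d p m n) F = cp.CE F"
      for F :: "(nat \<Rightarrow> nat) \<Rightarrow> 'b::{real_normed_field,banach,second_countable_topology}"
      unfolding cp.CE_def cp.prob_def by (rule expectation_mb_dist[OF f8])
    have ds: "real (digit_sum a) = cp.X a" if "a \<in> digit_configs d (H n)" for a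
      unfolding cp.X_def by (rule digit_sum_eq[OF that])
    have mean_eq: "mb_mean d p m n = cp.CE cp.X"
      unfolding mb_mean_def exp_CE by (rule cp.CE_cong[OF ds])
    have var_eq: "mb_var d p m n = cp.CE (\<lambda>a. (cp.X a - cp.CE cp.X)^2)"
      unfolding mb_var_def mb_mean_def[symmetric] mean_eq unfolding exp_CE by (rule cp.CE_cong) (simp add: ds)
    have char_eq: "measure_pmf.expectation (mb_dist d p m n) (\<lambda>a. cis (\<tau> * (real (digit_sum a) - mb_mean d p m n))) =
        cp.CE (\<lambda>a. cis (\<tau> * (cp.X a - cp.CE cp.X)))" for \<tau>
      unfolding mean_eq exp_CE by (rule cp.CE_cong) (simp add: ds)
    have frac: "l ^ i / l ^ j \<le> 1" if "i \<le> j" for i j using l that by (simp add: power_increasing)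
    have e1: "real d * N0 * \<epsilon> \<le> real d * c0 * c1"
    proof -
      have "real d * N0 * \<epsilon> = real d * c0 * c1 * (l ^ m / l ^ (3*m))" unfolding N0_def \<epsilon>_def by simp
      also have "\<dots> \<le> real d * c0 * c1 * 1" using c0 c1 by (intro mult_left_mono frac) auto
      finally show ?thesis by simp
    qed
    have e2: "(real d * N0)^2 * \<epsilon> \<le> (real d * c0)^2 * c1"
    proof -
      have "(real d * N0)^2 * \<epsilon> = (real d * c0)^2 * c1 * (l ^ (2*m) / l ^ (3*m))"
        unfolding N0_def \<epsilon>_def by (simp add: power_mult_distrib power_mult[symmetric] mult.commute[of m 2])
      also have "\<dots> \<le> (real d * c0)^2 * c1 * 1" using c0 c1 by (intro mult_left_mono frac) auto
      finally show ?thesis by simp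
    qed
    have e3: "N0 * \<rho> \<le> c0"
    proof -
      have "N0 * \<rho> = c0 * (l ^ m / l ^ (5*m))" unfolding N0_def \<rho>_def by simp
      also have "\<dots> \<le> c0 * 1" using c0 by (intro mult_left_mono frac) auto
      finally show ?thesis by simp
    qed
    have cardT: "\<bar>real (card T) - l ^ m / simplex_denom\<bar> \<le> (c2 + CH) * g"
    proof -
      have "H n = T \<union> (U 0 \<union> U 1)" "T \<inter> (U 0 \<union> U 1) = {}" using f1 f2 by auto
      then have "card (H n) = card T + card (U 0 \<union> U 1)"
        using finite_subset[OF T_H finite_H] finite_H by (metis card_Un_disjoint finite_Un)
      then have "real (card T) = real (card (H n)) - real (card (U 0 \<union> U 1))" by simp
      moreover have "CH * l ^ (m - 1) \<le> CH * g" using gL CH(1) by (intro mult_left_mono) auto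
      moreover have "\<bar>real (card (H n)) - l ^ m / simplex_denom\<bar> \<le> CH * l ^ (m - 1)" using CH(2)[OF elim(3)] unfolding l_def .
      ultimately show ?thesis using f13 unfolding N1_def by (simp add: distrib_right abs_le_iff)
    qed
    have mult_g: "x \<le> x * g" if "x \<ge> 0" for x using mult_left_mono[OF g1 that] by simp
    have mean_le: "\<bar>mb_mean d p m n - (real d - 1) / 2 * (l ^ m / simplex_denom)\<bar> \<le> B1 * g"
    proof -
      have "(real d - 1) / 2 * \<bar>real (card T) - l ^ m / simplex_denom\<bar> \<le> real d * ((c2 + CH) * g)"
        using d2 cardT by (intro mult_mono) auto
      then have "\<bar>(real d - 1) / 2 * real (card T) - (real d - 1) / 2 * (l ^ m / simplex_denom)\<bar> \<le> real d * ((c2 + CH) * g)"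
        unfolding right_diff_distrib[symmetric] abs_mult using d2 by simp
      moreover have "N0 * (\<rho> * real d ^ 3) \<le> c0 * real d ^ 3"
        using mult_right_mono[OF e3, of "real d ^ 3"] by (simp add: mult.assoc)
      moreover have "real d * c0 * c1 \<le> real d * c0 * c1 * g" "c0 * real d ^ 3 \<le> c0 * real d ^ 3 * g"
        using c0 c1 by (auto intro!: mult_g)
      ultimately show ?thesis using cp.mean_bound e1 unfolding mean_eq N1_def B1_def distrib_right mult.assoc by linarith
    qed
    have var_VT: "\<bar>mb_var d p m n - cp.VT\<bar> \<le> B2 * g"
    proof -
      have "8 * (real d * c0)^2 * c1 \<le> 8 * (real d * c0)^2 * c1 * g" using c1 by (intro mult_g) auto
      then show ?thesis using cp.variance_bound e2 unfolding var_eq N1_def B2_def distrib_right mult.assoc by linarith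
    qed
    have VT_le: "\<bar>cp.VT - (real d - 1) * (real d + 1) / 12 * (l ^ m / simplex_denom)\<bar> \<le> B3 * g"
    proof -
      have "(real d - 1) * (real d + 1) / 12 \<le> real d ^ 2" by (simp add: power2_eq_square algebra_simps)
      then have "(real d - 1) * (real d + 1) / 12 * \<bar>real (card T) - l ^ m / simplex_denom\<bar> \<le> real d ^ 2 * ((c2 + CH) * g)"
        using d2 cardT by (intro mult_mono) auto
      then have "\<bar>(real d - 1) * (real d + 1) / 12 * real (card T) - (real d - 1) * (real d + 1) / 12 * (l ^ m / simplex_denom)\<bar> \<le> real d ^ 2 * ((c2 + CH) * g)"
        unfolding right_diff_distrib[symmetric] abs_mult using d2 by simp
      moreover have "N0 * (3 * \<rho> * real d ^ 4) \<le> 3 * c0 * real d ^ 4"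
        using mult_right_mono[OF e3, of "3 * real d ^ 4"] by (simp add: mult_ac)
      moreover have "3 * c0 * real d ^ 4 \<le> 3 * c0 * real d ^ 4 * g" using c0 by (intro mult_g) auto
      ultimately show ?thesis using cp.VT_bound unfolding B3_def distrib_right mult.assoc by linarith
    qed
    have CCg: "x * g \<le> CC * g" if "x \<le> CC" for x using that g1 by (intro mult_right_mono) auto
    have le1: "B1 \<le> CC" "B2 \<le> CC" "B2 + B3 \<le> CC" "B4 \<le> CC" "B5 \<le> CC" "c1 \<le> CC"
      unfolding CC_def using Bpos c1 by linarith+
    have char_le: "norm (measure_pmf.expectation (mb_dist d p m n) (\<lambda>a. cis (\<tau> * (real (digit_sum a) - mb_mean d p m n))) - of_real (exp (- (\<tau>^2 * cp.VT / 2))))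
       \<le> \<bar>\<tau>\<bar> * (CC * (sqrt g + 1)) + CC / l + CC * l ^ m * (\<bar>\<tau>\<bar>^3 + \<tau>^4)" for \<tau>
    proof -
      \<comment> \<open>With q = sqrt g, both N1 / q and \<open>q\<close> are of order sqrt
        g.\<close>
      have q: "sqrt g > 0" using g1 by simp
      have "2 * C^2 * real d ^ 2 * N1 / sqrt g = 2 * C^2 * real d ^ 2 * c2 * sqrt g"
        unfolding N1_def using g1 by (simp add: real_div_sqrt flip: times_divide_eq_right)
      then have "2 * C^2 * real d ^ 2 * N1 / sqrt g + sqrt g + real d * N0 * \<epsilon> \<le> 2 * C^2 * real d ^ 2 * c2 * sqrt g + sqrt g + real d * c0 * c1"
        using e1 by linarith
      also have "\<dots> \<le> B4 * (sqrt g + 1)"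
      proof -
        have "0 \<le> real d * c0 * c1 * sqrt g" "0 \<le> 2 * C^2 * real d ^ 2 * c2" using c0 c1 c2 g1 by auto
        then show ?thesis unfolding B4_def by (simp add: distrib_right distrib_left)
      qed
      also have "\<dots> \<le> CC * (sqrt g + 1)" using le1 q by (intro mult_right_mono) auto
      finally have 1: "\<bar>\<tau>\<bar> * (2 * C^2 * real d ^ 2 * N1 / sqrt g + sqrt g + real d * N0 * \<epsilon>) \<le> \<bar>\<tau>\<bar> * (CC * (sqrt g + 1))"
        by (intro mult_left_mono) auto
      have 2: "\<epsilon> \<le> CC / l"
      proof -
        have "l \<le> l ^ (3*m)" using l m2 by (intro self_le_power) auto
        then have "\<epsilon> \<le> c1 / l" unfolding \<epsilon>_def using c1 l by (intro divide_left_mono) auto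
        also have "\<dots> \<le> CC / l" using le1 l by (intro divide_right_mono) auto
        finally show ?thesis .
      qed
      have 3: "N0 * (\<bar>\<tau>\<bar>^3 * real d ^ 3 + \<tau>^4 * real d ^ 4) \<le> CC * l ^ m * (\<bar>\<tau>\<bar>^3 + \<tau>^4)"
      proof -
        have "real d ^ 3 \<le> real d ^ 4" using d2 by (intro power_increasing) auto
        then have "\<bar>\<tau>\<bar>^3 * real d ^ 3 + \<tau>^4 * real d ^ 4 \<le> \<bar>\<tau>\<bar>^3 * real d ^ 4 + \<tau>^4 * real d ^ 4"
          by (intro add_mono mult_left_mono) auto
        then have "N0 * (\<bar>\<tau>\<bar>^3 * real d ^ 3 + \<tau>^4 * real d ^ 4) \<le> N0 * (\<bar>\<tau>\<bar>^3 * real d ^ 4 + \<tau>^4 * real d ^ 4)"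
          using cp.card_bounds(4) by (rule mult_left_mono)
        also have "\<dots> = B5 * (l ^ m * (\<bar>\<tau>\<bar>^3 + \<tau>^4))" unfolding N0_def B5_def by (simp add: algebra_simps)
        also have "\<dots> \<le> CC * (l ^ m * (\<bar>\<tau>\<bar>^3 + \<tau>^4))"
          using le1 lpos(1)[of m] by (intro mult_right_mono mult_nonneg_nonneg add_nonneg_nonneg) (auto simp: less_imp_le)
        finally show ?thesis by (simp add: mult.assoc)
      qed
      show ?thesis using cp.char_bound[OF q, of \<tau>] 1 2 3 unfolding char_eq by linarith
    qed
    have var_le: "\<bar>mb_var d p m n - (real d - 1) * (real d + 1) / 12 * (l ^ m / simplex_denom)\<bar> \<le> (B2 + B3) * g"
      using var_VT VT_le unfolding distrib_right by linarith
    show ?case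
      using order_trans[OF mean_le CCg[OF le1(1)]] order_trans[OF var_le CCg[OF le1(3)]]
        order_trans[OF var_VT CCg[OF le1(2)]] char_le
      unfolding g_def l_def estimates_def by blast
  qed
  moreover have "CC > 0" using Bpos c1 by (simp add: CC_def)
  ultimately show ?thesis by blast
qed

end

section \<open>Normalization and the central limit theorem\<close>

lemma abs_exp_minus_diff_le:
  fixes x y :: real
  assumes "x \<ge> 0" "y \<ge> 0" shows "\<bar>exp (- x) - exp (- y)\<bar> \<le> \<bar>x - y\<bar>"
proof -
  have *: "exp (- x) - exp (- y) \<le> y - x" if "0 \<le> x" "x \<le> y" for x y :: real
  proof -
    have "exp (- x) - exp (- y) = exp (- x) * (1 - exp (- (y - x)))"
      by (simp add: right_diff_distrib exp_add[symmetric])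
    also have "\<dots> \<le> 1 * (y - x)"
    proof (rule mult_mono)
      show "1 - exp (- (y - x)) \<le> y - x" using exp_ge_add_one_self[of "- (y - x)"] by linarith
    qed (use that in auto)
    finally show ?thesis by simp
  qed
  show ?thesis using *[of x y] *[of y x] assms by (cases "x \<le> y") (auto simp: abs_if)
qed

context multi_base
begin

text \<open>The main terms are multiples of the asymptotic number of multi-base elements up to
  \<open>n\<close>; the factor ln d in \<open>mb_kappa\<close> cancels.\<close>

lemma kappa_eq:
  "mb_kappa d p m * (real d - 1) / (2 * ln (real d)) * x = (real d - 1) / 2 * (x / simplex_denom)"
  "mb_kappa d p m * (real d - 1) * (real d + 1) / (12 * ln (real d)) * x =
     (real d - 1) * (real d + 1) / 12 * (x / simplex_denom)"
  using d2 by (simp_all add: mb_kappa_def simplex_denom_def prod_dividef)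

lemma char_normalized:
  "char (distr (measure_pmf (mb_dist d p m n)) borel (\<lambda>a. (real (digit_sum a) - mb_mean d p m n) / sqrt (mb_var d p m n))) t =
   measure_pmf.expectation (mb_dist d p m n) (\<lambda>a. cis (t / sqrt (mb_var d p m n) * (real (digit_sum a) - mb_mean d p m n)))"
  unfolding char_def by (subst integral_distr) (auto simp: cis_conv_exp)

text \<open>With \<tau> = t / sqrt v and v of order l ^ m, the three error terms of the
  characteristic function are O(sqrt (ln l / l)), O(1 / l) and O(1 / sqrt l). Replacing
  \<open>V\<close> by v in the Gaussian costs O(ln l / l).\<close>

lemma clt:
  "weak_conv_m (\<lambda>n. distr (measure_pmf (mb_dist d p m n)) borel
     (\<lambda>a. (real (digit_sum a) - mb_mean d p m n) / sqrt (mb_var d p m n))) std_normal_distribution"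
proof (rule levy_continuity)
  show "real_distribution (distr (measure_pmf (mb_dist d p m n)) borel
     (\<lambda>a. (real (digit_sum a) - mb_mean d p m n) / sqrt (mb_var d p m n)))" for n
    by (rule prob_space.real_distribution_distr[OF prob_space_measure_pmf]) simp
  show "real_distribution std_normal_distribution" by (rule real_dist_normal_dist)
next
  fix t :: real
  define A where "A = (real d - 1) * (real d + 1) / 12 / simplex_denom / 2"
  have A: "A > 0" using simplex_denom_pos d2 by (simp add: A_def)
  obtain C where C: "C > 0" and est: "\<forall>\<^sub>F n in sequentially. \<exists>V. estimates C n V"
    using conditioned_estimates by blast
  \<comment> \<open>Slightly larger than t^2 so as to be positive also at t = 0; the error bound
    \<open>b\<close> is then an expression in positive parameters.\<close>
  define S where "S = t^2 + 1"
  have S: "S > 0" "t^2 \<le> S" by (auto simp: S_def add_nonneg_pos)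
  define b where "b l = C * sqrt (S * ln l / (A * l)) + C * sqrt (S / (A * l)) + C / l
      + C * (S / A * sqrt (S / (A * l)) + S / A * (S / (A * l))) + S * C * ln l / (A * l)" for l :: real
  have ev1: "\<forall>\<^sub>F n in sequentially. C * ln (ln (real n)) \<le> A * ln (real n)" using A C by real_asymp
  have ev2: "\<forall>\<^sub>F n in sequentially. ln (ln (real n)) \<ge> 1" by real_asymp
  have "((\<lambda>n. char (distr (measure_pmf (mb_dist d p m n)) borel
      (\<lambda>a. (real (digit_sum a) - mb_mean d p m n) / sqrt (mb_var d p m n))) t - of_real (exp (- (t^2 / 2)))) \<longlongrightarrow> 0) sequentially"
  proof (rule Lim_null_comparison)
    show "((\<lambda>n. b (ln (real n))) \<longlongrightarrow> 0) sequentially"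
      unfolding b_def using A C S(1) by real_asymp
    show "\<forall>\<^sub>F n in sequentially. norm (char (distr (measure_pmf (mb_dist d p m n)) borel
      (\<lambda>a. (real (digit_sum a) - mb_mean d p m n) / sqrt (mb_var d p m n))) t - of_real (exp (- (t^2 / 2)))) \<le> b (ln (real n))"
      using est ev1 ev2 eventually_ge_at_top[of 3]
    proof eventually_elim
      case (elim n)
      define l where "l = ln (real n)"
      have l: "l \<ge> 1" unfolding l_def by (rule ln_ge_1[OF elim(4)])
      have ll: "ln l \<ge> 1" using elim(3) by (simp add: l_def)
      define g where "g = l ^ (m - 1) * ln l"
      have Lp: "l ^ (m - 1) \<ge> 1" using l by simp
      have lm: "l ^ m = l * l ^ (m - 1)" using m2 by (simp add: power_eq_if)
      define v where "v = mb_var d p m n"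
      obtain V where V: "\<bar>v - 2 * A * l ^ m\<bar> \<le> C * g" "\<bar>v - V\<bar> \<le> C * g"
        and ch: "\<And>\<tau>. norm (measure_pmf.expectation (mb_dist d p m n) (\<lambda>a. cis (\<tau> * (real (digit_sum a) - mb_mean d p m n))) - of_real (exp (- (\<tau>^2 * V / 2))))
       \<le> \<bar>\<tau>\<bar> * (C * (sqrt g + 1)) + C / l + C * l ^ m * (\<bar>\<tau>\<bar>^3 + \<tau>^4)"
        using elim(1) unfolding estimates_def l_def[symmetric] g_def[symmetric] v_def[symmetric] A_def by auto
      have Cg: "C * g \<le> A * l ^ m"
      proof -
        have "C * ln l * l ^ (m - 1) \<le> A * l * l ^ (m - 1)" using elim(2) Lp unfolding l_def by (intro mult_right_mono) auto
        then show ?thesis unfolding g_def lm by (simp add: mult_ac)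
      qed
      have v: "v \<ge> A * l ^ m" using V(1) Cg by (simp add: abs_le_iff)
      have lm0: "l ^ m > 0" using l by simp
      have v0: "v > 0" using v A lm0 by (meson less_le_trans mult_pos_pos)
      have V0: "V \<ge> 0" using V(2) v Cg by (simp add: abs_le_iff)
      define \<tau> where "\<tau> = t / sqrt v"
      have \<tau>2: "\<tau>^2 = t^2 / v" using v0 by (simp add: \<tau>_def power_divide)
      have t2v: "t^2 / v \<le> S / (A * l ^ m)" using S v A lm0 by (intro frac_le) auto
      have lml: "A * l \<le> A * l ^ m" using A l m2 by (intro mult_left_mono self_le_power) auto
      have "S / (A * l ^ m) \<le> S / (A * l)" using S A l lml lm0 by (intro divide_left_mono) auto
      then have \<tau>2l: "\<tau>^2 \<le> S / (A * l)" using \<tau>2 t2v by linarith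
      then have \<tau>1: "\<bar>\<tau>\<bar> \<le> sqrt (S / (A * l))" by (intro real_le_rsqrt) simp
      have gl: "g / (A * l ^ m) = ln l / (A * l)" unfolding g_def lm using Lp by simp
      have lnl: "ln l \<ge> 0" using ll by simp
      have g0: "g \<ge> 0" unfolding g_def using Lp lnl by simp
      have \<tau>g: "\<bar>\<tau>\<bar> * sqrt g \<le> sqrt (S * ln l / (A * l))"
      proof (rule real_le_rsqrt)
        have "(\<bar>\<tau>\<bar> * sqrt g)^2 = \<tau>^2 * g" using g0 by (simp add: power_mult_distrib)
        also have "\<dots> \<le> S / (A * l ^ m) * g" using \<tau>2 t2v g0 by (intro mult_right_mono) auto
        also have "\<dots> = S * (g / (A * l ^ m))" by simp
        finally show "(\<bar>\<tau>\<bar> * sqrt g)^2 \<le> S * ln l / (A * l)" unfolding gl by simp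
      qed
      have l\<tau>: "l ^ m * \<tau>^2 \<le> S / A"
      proof -
        have "l ^ m * \<tau>^2 \<le> l ^ m * (S / (A * l ^ m))" using \<tau>2 t2v lm0 by (intro mult_left_mono) auto
        also have "\<dots> = S / A" using l by simp
        finally show ?thesis .
      qed
      have cube: "l ^ m * (\<bar>\<tau>\<bar>^3 + \<tau>^4) \<le> S / A * sqrt (S / (A * l)) + S / A * (S / (A * l))"
      proof -
        have "l ^ m * (\<bar>\<tau>\<bar>^3 + \<tau>^4) = (l ^ m * \<tau>^2) * \<bar>\<tau>\<bar> + (l ^ m * \<tau>^2) * \<tau>^2"
          by (simp add: power3_eq_cube power4_eq_xxxx power2_eq_square abs_mult_self_eq algebra_simps)
        also have "\<dots> \<le> S / A * sqrt (S / (A * l)) + S / A * (S / (A * l))"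
          using l\<tau> \<tau>1 \<tau>2l S A lm0 by (intro add_mono mult_mono) auto
        finally show ?thesis .
      qed
      have "norm (complex_of_real (exp (- (\<tau>^2 * V / 2))) - of_real (exp (- (t^2 / 2)))) \<le> \<bar>\<tau>^2 * V / 2 - t^2 / 2\<bar>"
        unfolding of_real_diff[symmetric] norm_of_real by (rule abs_exp_minus_diff_le) (use V0 in auto)
      also have "\<tau>^2 * V / 2 - t^2 / 2 = t^2 / v * (V - v) / 2" unfolding \<tau>2 using v0 by (simp add: field_simps)
      also have "\<bar>\<dots>\<bar> = t^2 / v * \<bar>V - v\<bar> / 2" using v0 by (simp add: abs_mult)
      also have "\<dots> \<le> t^2 / v * \<bar>V - v\<bar>"
      proof -
        have "x / 2 \<le> x" if "0 \<le> x" for x :: real using that by simp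
        then show ?thesis using v0 by (simp only: mult_nonneg_nonneg divide_nonneg_pos zero_le_power2 abs_ge_zero)
      qed
      also have "\<dots> \<le> S / (A * l ^ m) * (C * g)"
        using t2v V(2) v0 S A lm0 by (intro mult_mono) (auto simp: abs_minus_commute)
      also have "\<dots> = S * C * (g / (A * l ^ m))" by simp
      also have "\<dots> = S * C * ln l / (A * l)" unfolding gl by simp
      finally have n2: "norm (complex_of_real (exp (- (\<tau>^2 * V / 2))) - of_real (exp (- (t^2 / 2)))) \<le> S * C * ln l / (A * l)" .
      have n1: "\<bar>\<tau>\<bar> * (C * (sqrt g + 1)) + C / l + C * l ^ m * (\<bar>\<tau>\<bar>^3 + \<tau>^4)
          \<le> C * sqrt (S * ln l / (A * l)) + C * sqrt (S / (A * l)) + C / l + C * (S / A * sqrt (S / (A * l)) + S / A * (S / (A * l)))"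
      proof -
        have "\<bar>\<tau>\<bar> * (C * (sqrt g + 1)) = C * (\<bar>\<tau>\<bar> * sqrt g) + C * \<bar>\<tau>\<bar>" by (simp add: algebra_simps)
        also have "\<dots> \<le> C * sqrt (S * ln l / (A * l)) + C * sqrt (S / (A * l))"
          using \<tau>g \<tau>1 C by (intro add_mono mult_left_mono) auto
        finally have "\<bar>\<tau>\<bar> * (C * (sqrt g + 1)) \<le> C * sqrt (S * ln l / (A * l)) + C * sqrt (S / (A * l))" .
        moreover have "C * l ^ m * (\<bar>\<tau>\<bar>^3 + \<tau>^4) \<le> C * (S / A * sqrt (S / (A * l)) + S / A * (S / (A * l)))"
          using mult_left_mono[OF cube, of C] C by (simp only: mult.assoc less_imp_le)
        ultimately show ?thesis by linarith
      qed
      define X where "X = measure_pmf.expectation (mb_dist d p m n) (\<lambda>a. cis (\<tau> * (real (digit_sum a) - mb_mean d p m n)))"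
      have "norm (X - of_real (exp (- (t^2 / 2)))) \<le> norm (X - of_real (exp (- (\<tau>^2 * V / 2)))) +
          norm (complex_of_real (exp (- (\<tau>^2 * V / 2))) - of_real (exp (- (t^2 / 2))))"
        using norm_triangle_ineq[of "X - of_real (exp (- (\<tau>^2 * V / 2)))" "of_real (exp (- (\<tau>^2 * V / 2))) - of_real (exp (- (t^2 / 2)))"] by simp
      then have "norm (X - of_real (exp (- (t^2 / 2)))) \<le> b l"
        using ch[of \<tau>, folded X_def] n1 n2 unfolding b_def by linarith
      then show ?case unfolding char_normalized X_def \<tau>_def v_def l_def .
    qed
  qed
  then have "((\<lambda>n. char (distr (measure_pmf (mb_dist d p m n)) borel
      (\<lambda>a. (real (digit_sum a) - mb_mean d p m n) / sqrt (mb_var d p m n))) t) \<longlongrightarrow> of_real (exp (- (t^2 / 2)))) sequentially"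
    by (rule LIM_zero_cancel)
  then show "(\<lambda>n. char (distr (measure_pmf (mb_dist d p m n)) borel
      (\<lambda>a. (real (digit_sum a) - mb_mean d p m n) / sqrt (mb_var d p m n))) t) \<longlonglongrightarrow> char std_normal_distribution t"
    by (simp add: char_std_normal_distribution)
qed

end

theorem mainTheorem3:
  fixes d m :: nat and p :: "nat \<Rightarrow> nat"
  assumes "d \<ge> 2" and "m \<ge> 2"
    and "1 < p 0"
    and "\<And>i j. i < j \<Longrightarrow> j < m \<Longrightarrow> p i < p j"
    and "\<And>i j. i < m \<Longrightarrow> j < m \<Longrightarrow> i \<noteq> j \<Longrightarrow> coprime (p i) (p j)"
  shows "(\<lambda>n. mb_mean d p m n - mb_kappa d p m * (real d - 1) / (2 * ln (real d)) * ln (real n) ^ m)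
           \<in> O(\<lambda>n. ln (real n) ^ (m - 1) * ln (ln (real n)))
    \<and> (\<lambda>n. mb_var d p m n - mb_kappa d p m * (real d - 1) * (real d + 1) / (12 * ln (real d)) * ln (real n) ^ m)
           \<in> O(\<lambda>n. ln (real n) ^ (m - 1) * ln (ln (real n)))
    \<and> weak_conv_m
           (\<lambda>n. distr (measure_pmf (mb_dist d p m n)) borel
                  (\<lambda>a. (real (digit_sum a) - mb_mean d p m n) / sqrt (mb_var d p m n)))
           std_normal_distribution"
proof -
  interpret multi_base d m p by unfold_locales (fact assms)+
  obtain C where est: "\<forall>\<^sub>F n in sequentially. \<exists>V. estimates C n V" and C: "C > 0"
    using conditioned_estimates by blast
  have norm_ge: "C * x \<le> C * norm x" for x :: real using C by (intro mult_left_mono) auto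
  show ?thesis unfolding kappa_eq
  proof (intro conjI clt)
    show "(\<lambda>n. mb_mean d p m n - (real d - 1) / 2 * (ln (real n) ^ m / simplex_denom))
           \<in> O(\<lambda>n. ln (real n) ^ (m - 1) * ln (ln (real n)))"
      by (rule bigoI[of _ C], rule eventually_mono[OF est]) (use norm_ge order_trans in \<open>fastforce simp only: real_norm_def estimates_def\<close>)
    show "(\<lambda>n. mb_var d p m n - (real d - 1) * (real d + 1) / 12 * (ln (real n) ^ m / simplex_denom))
           \<in> O(\<lambda>n. ln (real n) ^ (m - 1) * ln (ln (real n)))"
      by (rule bigoI[of _ C], rule eventually_mono[OF est]) (use norm_ge order_trans in \<open>fastforce simp only: real_norm_def estimates_def\<close>)
  qed
qed

end
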